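(* Let $k$ be a field and let $Z$ be a $k$-scheme of finite type equipped with a $\mathbb{G}_m$-action. If $Z$ is affine and smooth then $$\widetilde{p}(\widetilde{Z})=\overline{\Gamma},$$ where $\Gamma\subset\mathbb{G}_m\times Z\times Z$ is the graph of the action map $\mathbb{G}_m\times Z\to Z$, i.e. $\Gamma=\{(t,z_1,z_2)\mid t\cdot z_1=z_2\}$, and $\overline{\Gamma}$ denotes its scheme-theoretic closure in $\mathbb{A}^1\times Z\times Z$. Here $\widetilde{p}:\widetilde{Z}\to\mathbb{A}^1\times Z\times Z$ is the canonical morphism, which is a closed embedding since $Z$ is affine, and $\widetilde{p}(\widetilde{Z})$ denotes the corresponding closed subscheme.
   Context: $k$ is an arbitrary field. A $k$-space is a contravariant functor from $k$-schemes to sets which is a sheaf for the fpqc topology. $\mathbb{G}_m$ is viewed as the open subscheme $\mathbb{A}^1-\{0\}\subset\mathbb{A}^1$. Let $\mathbb{X}:=\mathbb{A}^2=\mathrm{Spec}\,k[\tau_1,\tau_2]$, viewed as a scheme over $\mathbb{A}^1$ via $(\tau_1,\tau_2)\mapsto\tau_1\tau_2$, with the $\mathbb{G}_m$-action $\lambda\cdot(\tau_1,\tau_2)=(\lambda\tau_1,\lambda^{-1}\tau_2)$. For a scheme $S$ over $\mathbb{A}^1$ set $\mathbb{X}_S:=\mathbb{X}\times_{\mathbb{A}^1}S$. $\widetilde{Z}$ is the space over $\mathbb{A}^1$ such that $\mathrm{Maps}_{\mathbb{A}^1}(S,\widetilde{Z})=\mathrm{Maps}^{\mathbb{G}_m}(\mathbb{X}_S,Z)$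 (the set of $\mathbb{G}_m$-equivariant morphisms) for any scheme $S$ over $\mathbb{A}^1$. A section of $\mathbb{X}\to\mathbb{A}^1$ induces by pullback a morphism $\widetilde{Z}\to Z$. Let $\pi_1,\pi_2:\widetilde{Z}\to Z$ be the morphisms corresponding to the sections $t\mapsto(1,t)$ and $t\mapsto(t,1)$, respectively. The morphism $\widetilde{p}:\widetilde{Z}\to\mathbb{A}^1\times Z\times Z$ has as components the tautological projection $\widetilde{Z}\to\mathbb{A}^1$, $\pi_1$, and $\pi_2$. *)

theory Defs
  imports "HOL.Hull" "HOL-Library.Poly_Mapping" "HOL-Library.Product_Plus"
begin

text \<open>
  An affine \<open>k\<close>-scheme is given by its coordinate ring: a commutative ring \<open>A\<close> (a type) with a
  structure map \<open>k \<rightarrow> A\<close>. Rings are taken of sort \<open>{comm_ring, comm_monoid_mult}\<close> rather than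
  \<open>comm_ring_1\<close>, since the latter excludes the zero ring, i.e. the empty scheme. As
  \<^typ>\<open>'m \<Rightarrow>\<^sub>0 'a\<close> has no unit for such \<open>'a\<close>, units are always written through structure maps.

  For a commutative monoid \<open>'m\<close>, the type \<^typ>\<open>'m \<Rightarrow>\<^sub>0 'a\<close> with its convolution product is the
  monoid algebra of \<open>'m\<close> over \<open>'a\<close>: \<^typ>\<open>int \<Rightarrow>\<^sub>0 'a\<close> is the ring of Laurent polynomials
  \<open>A[\<lambda>, \<lambda>\<inverse>]\<close>, i.e. the coordinate ring of \<open>G\<^sub>m \<times> Spec A\<close>, and
  \<^typ>\<open>(nat \<times> nat) \<Rightarrow>\<^sub>0 'a\<close> is \<open>A[\<tau>\<^sub>1, \<tau>\<^sub>2]\<close>.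
\<close>

definition k_algebra :: "('k::field \<Rightarrow> 'a::{comm_ring, comm_monoid_mult}) \<Rightarrow> bool" where
  "k_algebra s \<longleftrightarrow>
     s 1 = 1 \<and> (\<forall>c d. s (c + d) = s c + s d) \<and> (\<forall>c d. s (c * d) = s c * s d)"

text \<open>
  Homomorphisms of \<open>k\<close>-algebras \<open>A \<rightarrow> B\<close>, i.e. the set of \<open>B\<close>-points of \<open>Spec A\<close>.
  The unit is preserved because of the last clause for \<open>c = 1\<close>.
\<close>

definition alg_homs ::
  "('k \<Rightarrow> 'a::comm_ring) \<Rightarrow> ('k \<Rightarrow> 'b::comm_ring) \<Rightarrow> ('a \<Rightarrow> 'b) set" where
  "alg_homs sA sB =
     {h. (\<forall>a b. h (a + b) = h a + h b) \<and> (\<forall>a b. h (a * b) = h a * h b) \<and> (\<forall>c. h (sA c) = sB c)}"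

definition is_ideal :: "'b::comm_ring set \<Rightarrow> bool" where
  "is_ideal I \<longleftrightarrow> 0 \<in> I \<and> (\<forall>x\<in>I. \<forall>y\<in>I. x - y \<in> I) \<and> (\<forall>x\<in>I. \<forall>q. q * x \<in> I)"

definition coset :: "'b::comm_ring set \<Rightarrow> 'b \<Rightarrow> 'b set" where
  "coset I x = {y. y - x \<in> I}"

text \<open>
  Homomorphisms of \<open>k\<close>-algebras \<open>A \<rightarrow> B/I\<close>, where the elements of \<open>B/I\<close> are the cosets of \<open>I\<close>,
  added and multiplied through representatives.
\<close>

definition quot_homs ::
  "('k \<Rightarrow> 'a::comm_ring) \<Rightarrow> ('k \<Rightarrow> 'b::comm_ring) \<Rightarrow> 'b set \<Rightarrow> ('a \<Rightarrow> 'b set) set" where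
  "quot_homs sA sB I =
     {f. (\<forall>a. \<exists>x. f a = coset I x) \<and>
         (\<forall>a b. \<forall>x\<in>f a. \<forall>y\<in>f b. x + y \<in> f (a + b) \<and> x * y \<in> f (a * b)) \<and>
         (\<forall>c. sB c \<in> f (sA c))}"


definition is_subalgebra :: "('k \<Rightarrow> 'a::comm_ring) \<Rightarrow> 'a set \<Rightarrow> bool" where
  "is_subalgebra s B \<longleftrightarrow>
     (\<forall>c. s c \<in> B) \<and> (\<forall>x\<in>B. \<forall>y\<in>B. x + y \<in> B) \<and> (\<forall>x\<in>B. \<forall>y\<in>B. x * y \<in> B)"

definition finite_type :: "('k \<Rightarrow> 'a::comm_ring) \<Rightarrow> bool" where
  "finite_type s \<longleftrightarrow> (\<exists>X. finite X \<and> is_subalgebra s hull X = UNIV)"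

text \<open>
  Formal smoothness over \<open>k\<close>: every homomorphism \<open>A \<rightarrow> R/J\<close> with \<open>J\<^sup>2 = 0\<close> lifts to \<open>A \<rightarrow> R\<close>.
  The test algebras are the \<open>R = P/L\<close>, \<open>J = M/L\<close> for ideals \<open>L \<subseteq> M\<close> with \<open>M\<^sup>2 \<subseteq> L\<close> of the
  polynomial ring \<open>P = k[x\<^sub>0, x\<^sub>1, \<dots>]\<close>; these \<open>R\<close> are, up to isomorphism, all countably generated
  \<open>k\<close>-algebras. For \<open>A\<close> of finite type this is no restriction: writing \<open>A = P/M\<close>, lifting
  against \<open>P/M\<^sup>2 \<rightarrow> P/M\<close> already implies lifting against all square-zero extensions.
  The containment of cosets below says that \<open>h\<close> followed by \<open>P/L \<rightarrow> P/M\<close> is \<open>g\<close>.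
\<close>

definition formally_smooth :: "('k::field \<Rightarrow> 'a::comm_ring) \<Rightarrow> bool" where
  "formally_smooth s \<longleftrightarrow>
     (\<forall>(L :: ((nat \<Rightarrow>\<^sub>0 nat) \<Rightarrow>\<^sub>0 'k) set) M.
        is_ideal L \<longrightarrow> is_ideal M \<longrightarrow> L \<subseteq> M \<longrightarrow> (\<forall>x\<in>M. \<forall>y\<in>M. x * y \<in> L) \<longrightarrow>
        (\<forall>g \<in> quot_homs s (Poly_Mapping.single 0) M.
           \<exists>h \<in> quot_homs s (Poly_Mapping.single 0) L. \<forall>a. h a \<subseteq> g a))"

text \<open>Over a field, finite type and finite presentation agree.\<close>

definition smooth :: "('k::field \<Rightarrow> 'a::comm_ring) \<Rightarrow> bool" where
  "smooth s \<longleftrightarrow> finite_type s \<and> formally_smooth s"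


text \<open>
  A \<open>G\<^sub>m\<close>-action on \<open>Z = Spec A\<close> is given by the comorphism \<open>\<rho> : A \<rightarrow> A[\<lambda>, \<lambda>\<inverse>]\<close> of the action map
  \<open>G\<^sub>m \<times> Z \<rightarrow> Z\<close>, so that \<open>(\<rho> a)(\<lambda>, z) = a(\<lambda> \<cdot> z)\<close>. The second clause is
  \<open>\<lambda> \<cdot> (\<mu> \<cdot> z) = (\<lambda>\<mu>) \<cdot> z\<close>, in \<open>A[\<mu>, \<mu>\<inverse>][\<lambda>, \<lambda>\<inverse>]\<close>, and the third one is \<open>1 \<cdot> z = z\<close>.
\<close>

definition Gm_action :: "('k::field \<Rightarrow> 'a::comm_ring) \<Rightarrow> ('a \<Rightarrow> (int \<Rightarrow>\<^sub>0 'a)) \<Rightarrow> bool" where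
  "Gm_action s \<rho> \<longleftrightarrow>
     \<rho> \<in> alg_homs s (\<lambda>c. Poly_Mapping.single 0 (s c)) \<and>
     (\<forall>a. Poly_Mapping.map \<rho> (\<rho> a) =
        (\<Sum>n \<in> Poly_Mapping.keys (\<rho> a).
           Poly_Mapping.single n (Poly_Mapping.single n (Poly_Mapping.lookup (\<rho> a) n)))) \<and>
     (\<forall>a. (\<Sum>n \<in> Poly_Mapping.keys (\<rho> a). Poly_Mapping.lookup (\<rho> a) n) = a)"


text \<open>
  Let \<open>S = Spec R\<close> be a scheme over \<open>\<bbbA>\<^sup>1\<close> via \<open>t \<in> R\<close>. Then \<open>\<X>\<^sub>S\<close> is the spectrum of
  \<open>k[\<tau>\<^sub>1, \<tau>\<^sub>2] \<otimes>\<^bsub>k[\<tau>\<^sub>1\<tau>\<^sub>2]\<^esub> R = R[\<tau>\<^sub>1, \<tau>\<^sub>2] / (\<tau>\<^sub>1 \<tau>\<^sub>2 - t)\<close>.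
\<close>

definition XS_ideal :: "'r::{comm_ring, comm_monoid_mult} \<Rightarrow> ((nat \<times> nat) \<Rightarrow>\<^sub>0 'r) set" where
  "XS_ideal t =
     range (\<lambda>q. q * (Poly_Mapping.single (1, 1) 1 - Poly_Mapping.single (0, 0) t))"

text \<open>
  The substitution \<open>\<tau>\<^sub>1 \<mapsto> \<lambda>\<tau>\<^sub>1\<close>, \<open>\<tau>\<^sub>2 \<mapsto> \<lambda>\<inverse>\<tau>\<^sub>2\<close>, from \<open>R[\<tau>\<^sub>1, \<tau>\<^sub>2]\<close> to \<open>R[\<tau>\<^sub>1, \<tau>\<^sub>2][\<lambda>, \<lambda>\<inverse>]\<close>. Modulo
  \<^const>\<open>XS_ideal\<close> it is the comorphism of the \<open>G\<^sub>m\<close>-action on \<open>\<X>\<^sub>S\<close>.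
\<close>

definition XS_coaction ::
  "((nat \<times> nat) \<Rightarrow>\<^sub>0 'r::comm_ring) \<Rightarrow> (int \<Rightarrow>\<^sub>0 ((nat \<times> nat) \<Rightarrow>\<^sub>0 'r))" where
  "XS_coaction p =
     (\<Sum>(i, j) \<in> Poly_Mapping.keys p.
        Poly_Mapping.single (int i - int j)
          (Poly_Mapping.single (i, j) (Poly_Mapping.lookup p (i, j))))"

text \<open>
  Equivariant morphisms \<open>\<X>\<^sub>S \<rightarrow> Z\<close>: the two comorphisms \<open>A \<rightarrow> O(\<X>\<^sub>S)[\<lambda>, \<lambda>\<inverse>]\<close> of
  \<open>G\<^sub>m \<times> \<X>\<^sub>S \<rightarrow> \<X>\<^sub>S \<rightarrow> Z\<close> and \<open>G\<^sub>m \<times> \<X>\<^sub>S \<rightarrow> G\<^sub>m \<times> Z \<rightarrow> Z\<close> agree, which is expressed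
  coefficientwise in \<open>\<lambda>\<close>.
\<close>

definition equivariant_maps ::
  "('k::field \<Rightarrow> 'a::comm_ring) \<Rightarrow> ('a \<Rightarrow> (int \<Rightarrow>\<^sub>0 'a)) \<Rightarrow>
   ('k \<Rightarrow> 'r::{comm_ring, comm_monoid_mult}) \<Rightarrow> 'r \<Rightarrow> ('a \<Rightarrow> ((nat \<times> nat) \<Rightarrow>\<^sub>0 'r) set) set" where
  "equivariant_maps sA \<rho> sR t =
     {f \<in> quot_homs sA (\<lambda>c. Poly_Mapping.single 0 (sR c)) (XS_ideal t).
        \<forall>a. \<forall>p\<in>f a. \<forall>n.
          Poly_Mapping.lookup (XS_coaction p) n \<in> f (Poly_Mapping.lookup (\<rho> a) n)}"

text \<open>
  The \<open>R\<close>-points of the space of equivariant maps: pairs of a morphism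
  \<open>t : Spec R \<rightarrow> \<bbbA>\<^sup>1\<close> and an equivariant morphism \<open>\<X>\<^sub>S \<rightarrow> Z\<close>.
\<close>

definition Ztilde ::
  "('k::field \<Rightarrow> 'a::comm_ring) \<Rightarrow> ('a \<Rightarrow> (int \<Rightarrow>\<^sub>0 'a)) \<Rightarrow>
   ('k \<Rightarrow> 'r::{comm_ring, comm_monoid_mult}) \<Rightarrow>
   ('r \<times> ('a \<Rightarrow> ((nat \<times> nat) \<Rightarrow>\<^sub>0 'r) set)) set" where
  "Ztilde sA \<rho> sR = {(t, f). f \<in> equivariant_maps sA \<rho> sR t}"

definition eval2 ::
  "'r::{comm_ring, comm_monoid_mult} \<Rightarrow> 'r \<Rightarrow> ((nat \<times> nat) \<Rightarrow>\<^sub>0 'r) \<Rightarrow> 'r" where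
  "eval2 u v p = (\<Sum>(i, j) \<in> Poly_Mapping.keys p. Poly_Mapping.lookup p (i, j) * u ^ i * v ^ j)"

text \<open>
  The composite of \<open>f : \<X>\<^sub>S \<rightarrow> Z\<close> with the section \<open>(u, v) : S \<rightarrow> \<X>\<^sub>S\<close>, where \<open>u v = t\<close>; then
  \<^term>\<open>eval2 u v\<close> vanishes on \<^term>\<open>XS_ideal t\<close>, hence is constant on each coset \<open>f a\<close>.
\<close>

definition pull_section ::
  "'r::{comm_ring, comm_monoid_mult} \<Rightarrow> 'r \<Rightarrow> ('a \<Rightarrow> ((nat \<times> nat) \<Rightarrow>\<^sub>0 'r) set) \<Rightarrow> 'a \<Rightarrow> 'r" where
  "pull_section u v f a = the_elem (eval2 u v ` f a)"

definition ptilde ::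
  "'r::{comm_ring, comm_monoid_mult} \<times> ('a \<Rightarrow> ((nat \<times> nat) \<Rightarrow>\<^sub>0 'r) set) \<Rightarrow>
   'r \<times> ('a \<Rightarrow> 'r) \<times> ('a \<Rightarrow> 'r)" where
  "ptilde = (\<lambda>(t, f). (t, pull_section 1 t f, pull_section t 1 f))"


text \<open>
  A list of triples \<open>(n, a, b)\<close> stands for the function \<open>\<Sum> t\<^sup>n \<otimes> a \<otimes> b\<close> on \<open>\<bbbA>\<^sup>1 \<times> Z \<times> Z\<close>; every
  element of \<open>k[t] \<otimes> A \<otimes> A\<close> arises in this way. The first operation evaluates the function at an
  \<open>R\<close>-point. The second one restricts it to the graph \<open>\<Gamma>\<close>, which is identified with \<open>G\<^sub>m \<times> Z\<close> by
  \<open>(\<lambda>, z) \<mapsto> (\<lambda>, z, \<lambda> \<cdot> z)\<close> and thus has coordinate ring \<open>A[\<lambda>, \<lambda>\<inverse>]\<close>.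
\<close>

definition eval_at ::
  "'r::{comm_ring, comm_monoid_mult} \<times> ('a \<Rightarrow> 'r) \<times> ('a \<Rightarrow> 'r) \<Rightarrow> (nat \<times> 'a \<times> 'a) list \<Rightarrow> 'r" where
  "eval_at = (\<lambda>(t, z1, z2) F. \<Sum>(n, a, b)\<leftarrow>F. t ^ n * z1 a * z2 b)"

definition restrict_graph ::
  "('a \<Rightarrow> (int \<Rightarrow>\<^sub>0 'a::comm_ring)) \<Rightarrow> (nat \<times> 'a \<times> 'a) list \<Rightarrow> (int \<Rightarrow>\<^sub>0 'a)" where
  "restrict_graph \<rho> F = (\<Sum>(n, a, b)\<leftarrow>F. Poly_Mapping.single (int n) a * \<rho> b)"

text \<open>
  The \<open>R\<close>-points of the scheme-theoretic closure of \<open>\<Gamma>\<close> in \<open>\<bbbA>\<^sup>1 \<times> Z \<times> Z\<close>, that is, of the closed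
  subscheme defined by the kernel of \<open>k[t] \<otimes> A \<otimes> A \<rightarrow> O(\<Gamma>)\<close>.
\<close>

definition graph_closure ::
  "('k::field \<Rightarrow> 'a::comm_ring) \<Rightarrow> ('a \<Rightarrow> (int \<Rightarrow>\<^sub>0 'a)) \<Rightarrow>
   ('k \<Rightarrow> 'r::{comm_ring, comm_monoid_mult}) \<Rightarrow> ('r \<times> ('a \<Rightarrow> 'r) \<times> ('a \<Rightarrow> 'r)) set" where
  "graph_closure sA \<rho> sR =
     {x \<in> UNIV \<times> alg_homs sA sR \<times> alg_homs sA sR.
        \<forall>F. restrict_graph \<rho> F = 0 \<longrightarrow> eval_at x F = 0}"

end

theory Submission
  imports Defs "HOL-Computational_Algebra.Polynomial"
begin

text \<open>
The action is a grading \<open>A = \<Oplus> A\<^sub>n\<close>, where \<open>a \<in> A\<^sub>n\<close> means \<open>\<rho> a = single n a\<close>. The degree \<open>n\<close> part of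
\<open>R[\<tau>\<^sub>1, \<tau>\<^sub>2]/(\<tau>\<^sub>1 \<tau>\<^sub>2 - t)\<close> is \<open>R \<tau>\<^sub>1\<^sup>n\<close> or \<open>R \<tau>\<^sub>2\<^sup>-\<^sup>n\<close>, according to the sign of \<open>n\<close>. Hence an equivariant map
\<open>\<X>\<^sub>S \<rightarrow> Z\<close> amounts to its restrictions \<open>z\<^sub>1, z\<^sub>2\<close> to the two sections, and a pair of points \<open>z\<^sub>1, z\<^sub>2\<close> of \<open>Z\<close> arises
in this way iff \<open>z\<^sub>2 a = t\<^sup>n z\<^sub>1 a\<close> for \<open>a \<in> A\<^sub>n\<close>, \<open>n \<ge> 0\<close>, and \<open>z\<^sub>1 a = t\<^sup>-\<^sup>n z\<^sub>2 a\<close> for \<open>n \<le> 0\<close>. These relations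
hold on \<open>\<Gamma>\<close>, therefore on its closure. So \<open>ptilde\<close> is injective, and its image contains the closure.

The converse inclusion says that a function \<open>F\<close> on \<open>\<bbbA>\<^sup>1 \<times> Z \<times> Z\<close> which vanishes on \<open>\<Gamma>\<close> vanishes at all
pairs that satisfy the relations. Over \<open>t \<noteq> 0\<close> the relations define \<open>\<Gamma>\<close>, so what is needed is that the ring
of functions on the space of equivariant maps has no \<open>t\<close>-torsion. This is where smoothness enters.

Write \<open>A = k[x\<^sub>0, \<dots>, x\<^sub>m\<^sub>-\<^sub>1]/M\<close> with \<open>x\<^sub>i\<close> homogeneous of degree \<open>d\<^sub>i\<close>. For the affine space with these weights,
the space of equivariant maps is again an affine space over \<open>\<bbbA>\<^sup>1\<close>; its coordinate ring is the subring \<open>S\<close> of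
\<open>k[x\<^sub>0, \<dots>, x\<^sub>m\<^sub>-\<^sub>1][u, u\<inverse>]\<close> generated by \<open>u\<close> (which is \<open>t\<close>) and the \<open>u\<^bsup>min(d\<^sub>i, 0)\<^esup> x\<^sub>i\<close>. For \<open>Z\<close> one has to divide by the
ideal \<open>J\<close> generated by the \<open>u\<^bsup>min(n, 0)\<^esup> f\<close> with \<open>f \<in> M\<close> homogeneous of degree \<open>n\<close>, and the claim is that
\<open>u\<^sup>N x \<in> J\<close> implies \<open>x \<in> J\<close>.

Formal smoothness lifts the identity of \<open>A = P/M\<close> to \<open>P/M\<^sup>2\<close>, and taking degree components makes the lift
graded (lemma \<open>equivariant_contraction\<close>). It induces an endomorphism \<open>\<sigma>\<close> of \<open>S\<close> over \<open>k[u]\<close>, congruent to the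
identity modulo \<open>J\<close>, with \<open>\<sigma> J \<subseteq> J\<^sup>2\<close> (lemma \<open>tilde_ideal_saturated\<close>). If \<open>u\<^sup>N x \<in> J\<close>, then iterating \<open>\<sigma>\<close>
replaces \<open>x\<close> by a congruent element with \<open>u\<^sup>N x \<in> J\<^sup>c\<close> for \<open>c\<close> as large as desired, and the Artin-Rees lemma
gives \<open>u\<^sup>N x \<in> u\<^sup>N J\<close> and \<open>x \<in> J\<close> (lemma \<open>torsion_free_of_contraction\<close>). This is a direct form of the argument
that the space of equivariant maps is smooth over \<open>\<bbbA>\<^sup>1\<close>, therefore flat, therefore torsion-free.
\<close>

section \<open>Noetherian subrings\<close>

definition subring :: "'a::comm_ring_1 set \<Rightarrow> bool" where
  "subring S \<longleftrightarrow> 1 \<in> S \<and> (\<forall>x\<in>S. \<forall>y\<in>S. x - y \<in> S) \<and> (\<forall>x\<in>S. \<forall>y\<in>S. x * y \<in> S)"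

lemma subringD:
  assumes "subring S"
  shows "1 \<in> S" "0 \<in> S" "x \<in> S \<Longrightarrow> y \<in> S \<Longrightarrow> x - y \<in> S" "x \<in> S \<Longrightarrow> y \<in> S \<Longrightarrow> x * y \<in> S"
    "x \<in> S \<Longrightarrow> - x \<in> S" "x \<in> S \<Longrightarrow> y \<in> S \<Longrightarrow> x + y \<in> S"
proof -
  have 1: "1 \<in> S" and d: "\<And>x y. x \<in> S \<Longrightarrow> y \<in> S \<Longrightarrow> x - y \<in> S" and m: "\<And>x y. x \<in> S \<Longrightarrow> y \<in> S \<Longrightarrow> x * y \<in> S"
    using assms by (auto simp: subring_def)
  have 0: "0 \<in> S" using d[OF 1 1] by simp
  have n: "\<And>x. x \<in> S \<Longrightarrow> - x \<in> S" using d[OF 0] by simp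
  show "1 \<in> S" "0 \<in> S" by fact+
  show "x \<in> S \<Longrightarrow> y \<in> S \<Longrightarrow> x - y \<in> S" "x \<in> S \<Longrightarrow> y \<in> S \<Longrightarrow> x * y \<in> S" "x \<in> S \<Longrightarrow> - x \<in> S"
    by (fact d m n)+
  show "x \<in> S \<Longrightarrow> y \<in> S \<Longrightarrow> x + y \<in> S" using d[of x "- y"] n[of y] by simp
qed

lemma subring_sum: "subring S \<Longrightarrow> (\<And>i. i \<in> I \<Longrightarrow> f i \<in> S) \<Longrightarrow> sum f I \<in> S"
  by (induction I rule: infinite_finite_induct) (auto intro: subringD)

lemma subring_power: "subring S \<Longrightarrow> x \<in> S \<Longrightarrow> x ^ n \<in> S"
  by (induction n) (auto intro: subringD)

text \<open>
Ideals of a subring \<open>S\<close>, as subsets of the ambient ring: with subrings as carriers one can induct on the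
number of generators without changing the type.
\<close>

definition ideal_of :: "'a::comm_ring_1 set \<Rightarrow> 'a set \<Rightarrow> bool" where
  "ideal_of S I \<longleftrightarrow> I \<subseteq> S \<and> 0 \<in> I \<and> (\<forall>x\<in>I. \<forall>y\<in>I. x + y \<in> I) \<and> (\<forall>q\<in>S. \<forall>x\<in>I. q * x \<in> I)"

lemma ideal_ofD:
  assumes "ideal_of S I"
  shows "I \<subseteq> S" "0 \<in> I" "x \<in> I \<Longrightarrow> y \<in> I \<Longrightarrow> x + y \<in> I" "q \<in> S \<Longrightarrow> x \<in> I \<Longrightarrow> q * x \<in> I"
  using assms by (auto simp: ideal_of_def)

lemma ideal_ofI:
  assumes "I \<subseteq> S" "0 \<in> I" "\<And>x y. x \<in> I \<Longrightarrow> y \<in> I \<Longrightarrow> x + y \<in> I"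
    "\<And>q x. q \<in> S \<Longrightarrow> x \<in> I \<Longrightarrow> q * x \<in> I"
  shows "ideal_of S I"
  using assms by (auto simp: ideal_of_def)

lemma ideal_of_uminus: "subring S \<Longrightarrow> ideal_of S I \<Longrightarrow> x \<in> I \<Longrightarrow> - x \<in> I"
  using ideal_ofD(4)[of S I "- 1" x] subringD(1,5)[of S] by simp

lemma ideal_of_sum: "ideal_of S I \<Longrightarrow> (\<And>i. i \<in> K \<Longrightarrow> f i \<in> I) \<Longrightarrow> sum f K \<in> I"
  by (induction K rule: infinite_finite_induct) (auto intro: ideal_ofD)

lemma ideal_of_self: "subring S \<Longrightarrow> ideal_of S S"
  by (auto simp: ideal_of_def intro: subringD)

lemma ideal_of_hull_minimal: "G \<subseteq> I \<Longrightarrow> ideal_of S I \<Longrightarrow> ideal_of S hull G \<subseteq> I"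
  by (rule hull_minimal)

lemma ideal_of_hull: "subring S \<Longrightarrow> G \<subseteq> S \<Longrightarrow> ideal_of S (ideal_of S hull G)"
proof -
  assume S: "subring S" and G: "G \<subseteq> S"
  have "ideal_of S hull G \<subseteq> S" by (rule ideal_of_hull_minimal[OF G ideal_of_self[OF S]])
  then show ?thesis unfolding ideal_of_def by (auto simp: hull_def ideal_of_def)
qed

definition noetherian :: "'a::comm_ring_1 set \<Rightarrow> bool" where
  "noetherian S \<longleftrightarrow> (\<forall>I. ideal_of S I \<longrightarrow> (\<exists>G. finite G \<and> G \<subseteq> I \<and> I = ideal_of S hull G))"

text \<open>
The ideals generated by the initial segments of the sequence form a chain, so their union is an ideal.
\<close>

lemma hull_range_finite_stage:
  assumes S: "subring S" and a: "range a \<subseteq> S" and x: "x \<in> ideal_of S hull range (a :: nat \<Rightarrow> _)"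
  shows "\<exists>N. x \<in> ideal_of S hull (a ` {..<N})"
proof -
  have sub: "a ` {..<N} \<subseteq> S" for N using a by auto
  note H = ideal_of_hull[OF S sub]
  have mono: "ideal_of S hull (a ` {..<N}) \<subseteq> ideal_of S hull (a ` {..<N'})" if "N \<le> N'" for N N'
    using that by (intro hull_mono) auto
  have "range a \<subseteq> {x. \<exists>N. x \<in> ideal_of S hull (a ` {..<N})}"
  proof
    fix x assume "x \<in> range a"
    then obtain i where "x = a i" by auto
    then have "x \<in> ideal_of S hull (a ` {..<Suc i})" by (intro hull_inc) auto
    then show "x \<in> {x. \<exists>N. x \<in> ideal_of S hull (a ` {..<N})}" by blast
  qed
  moreover have "ideal_of S {x. \<exists>N. x \<in> ideal_of S hull (a ` {..<N})}"
  proof (rule ideal_ofI)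
    show "{x. \<exists>N. x \<in> ideal_of S hull (a ` {..<N})} \<subseteq> S" using ideal_ofD(1)[OF H] by blast
    show "0 \<in> {x. \<exists>N. x \<in> ideal_of S hull (a ` {..<N})}" using ideal_ofD(2)[OF H] by blast
    fix x y assume "x \<in> {x. \<exists>N. x \<in> ideal_of S hull (a ` {..<N})}" "y \<in> {x. \<exists>N. x \<in> ideal_of S hull (a ` {..<N})}"
    then obtain N N' where "x \<in> ideal_of S hull (a ` {..<N})" "y \<in> ideal_of S hull (a ` {..<N'})" by auto
    then have "x \<in> ideal_of S hull (a ` {..<max N N'})" "y \<in> ideal_of S hull (a ` {..<max N N'})"
      using mono[of N "max N N'"] mono[of N' "max N N'"] by auto
    then show "x + y \<in> {x. \<exists>N. x \<in> ideal_of S hull (a ` {..<N})}" using ideal_ofD(3)[OF H] by blast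
  next
    fix q x assume "q \<in> S" "x \<in> {x. \<exists>N. x \<in> ideal_of S hull (a ` {..<N})}"
    then show "q * x \<in> {x. \<exists>N. x \<in> ideal_of S hull (a ` {..<N})}" using ideal_ofD(4)[OF H] by blast
  qed
  ultimately show ?thesis using ideal_of_hull_minimal x by blast
qed

lemma hull_image_combination:
  assumes S: "subring S" and a: "a ` {..<N} \<subseteq> S" and x: "x \<in> ideal_of S hull (a ` {..<N::nat})"
  shows "\<exists>c. (\<forall>i. c i \<in> S) \<and> x = (\<Sum>i<N. c i * a i)"
proof -
  let ?I = "{x. \<exists>c. (\<forall>i. c i \<in> S) \<and> x = (\<Sum>i<N. c i * a i)}"
  have "a ` {..<N} \<subseteq> ?I"
  proof
    fix x assume "x \<in> a ` {..<N}"
    then obtain j where j: "j < N" "x = a j" by auto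
    have "(\<Sum>i<N. (if i = j then 1 else 0) * a i) = (\<Sum>i<N. if i = j then a i else 0)"
      by (intro sum.cong) auto
    with j have "x = (\<Sum>i<N. (if i = j then 1 else 0) * a i)" by simp
    moreover have "(if i = j then 1 else 0) \<in> S" for i using subringD(1,2)[OF S] by auto
    ultimately show "x \<in> ?I" by (auto intro!: exI[of _ "\<lambda>i. if i = j then 1 else 0"])
  qed
  moreover have "ideal_of S ?I"
  proof (rule ideal_ofI)
    show "?I \<subseteq> S" using a by (auto intro!: subring_sum[OF S] subringD(4)[OF S])
    show "0 \<in> ?I" using subringD(2)[OF S] by (auto intro!: exI[of _ "\<lambda>_. 0"])
    fix x y assume "x \<in> ?I" "y \<in> ?I"
    then obtain c c' where "\<forall>i. c i \<in> S" "x = (\<Sum>i<N. c i * a i)" "\<forall>i. c' i \<in> S" "y = (\<Sum>i<N. c' i * a i)"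
      by auto
    then show "x + y \<in> ?I" using subringD(6)[OF S]
      by (auto intro!: exI[of _ "\<lambda>i. c i + c' i"] simp: sum.distrib distrib_right)
  next
    fix q x assume "q \<in> S" "x \<in> ?I"
    then obtain c where "\<forall>i. c i \<in> S" "x = (\<Sum>i<N. c i * a i)" by auto
    with \<open>q \<in> S\<close> show "q * x \<in> ?I" using subringD(4)[OF S]
      by (auto intro!: exI[of _ "\<lambda>i. q * c i"] simp: sum_distrib_left mult.assoc)
  qed
  ultimately show ?thesis using ideal_of_hull_minimal x by blast
qed

definition adjoin :: "'a::comm_ring_1 set \<Rightarrow> 'a \<Rightarrow> 'a set" where
  "adjoin S x = {poly p x |p. \<forall>i. coeff p i \<in> S}"

lemma subring_adjoin:
  assumes S: "subring S" shows "subring (adjoin S x)"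
  unfolding subring_def
proof (intro conjI ballI)
  show "1 \<in> adjoin S x" using subringD(1,2)[OF S]
    by (auto simp: adjoin_def coeff_pCons split: nat.split intro!: exI[of _ "[:1:]"])
  fix a b assume "a \<in> adjoin S x" "b \<in> adjoin S x"
  then obtain p q where p: "\<forall>i. coeff p i \<in> S" "a = poly p x" and q: "\<forall>i. coeff q i \<in> S" "b = poly q x"
    by (auto simp: adjoin_def)
  from p q show "a - b \<in> adjoin S x" using subringD(3)[OF S]
    by (auto simp: adjoin_def intro!: exI[of _ "p - q"])
  have "coeff (p * q) n \<in> S" for n
    using p q by (auto simp: coeff_mult intro!: subring_sum[OF S] subringD(4)[OF S])
  with p q show "a * b \<in> adjoin S x" 
    by (auto simp: adjoin_def intro!: exI[of _ "p * q"])
qed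

text \<open>
Hilbert's basis theorem. The element \<open>x\<close> may be algebraic over \<open>S\<close>, so the argument is carried out for the
polynomials whose value at \<open>x\<close> lies in the given ideal \<open>I\<close>: if \<open>I\<close> is not finitely generated, choose a
sequence of polynomials, each of minimal degree among those whose value is not yet generated by the
previous ones. Some leading coefficient is a combination of the previous ones, which lets one lower
the degree of the corresponding polynomial.
\<close>

lemma noetherian_adjoin:
  fixes x :: "'a::comm_ring_1"
  assumes S: "subring S" and N: "noetherian S"
  shows "noetherian (adjoin S x)"
  unfolding noetherian_def
proof (intro allI impI, rule ccontr)
  let ?T = "adjoin S x"
  let ?ev = "\<lambda>p. poly p x"
  fix I assume I: "ideal_of ?T I"
    and nfg: "\<nexists>G. finite G \<and> G \<subseteq> I \<and> I = ideal_of ?T hull G"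
  have T: "subring ?T" by (rule subring_adjoin[OF S])
  define I' where "I' = {p. (\<forall>i. coeff p i \<in> S) \<and> poly p x \<in> I}"
  have evI: "?ev ` F \<subseteq> I" if "F \<subseteq> I'" for F using that by (auto simp: I'_def)
  define H where "H F = ideal_of ?T hull (?ev ` F)" for F
  have H: "ideal_of ?T (H F)" if "F \<subseteq> I'" for F
    unfolding H_def by (rule ideal_of_hull[OF T]) (use evI[OF that] ideal_ofD(1)[OF I] in auto)
  have ex: "\<exists>p\<in>I'. poly p x \<notin> H F" if F: "F \<subseteq> I'" "finite F" for F
  proof -
    have "H F \<subseteq> I" unfolding H_def by (rule ideal_of_hull_minimal[OF evI[OF F(1)] I])
    moreover have "H F \<noteq> I" using nfg F(2) evI[OF F(1)] unfolding H_def by blast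
    ultimately obtain a where a: "a \<in> I" "a \<notin> H F" by blast
    with ideal_ofD(1)[OF I] obtain p where "\<forall>i. coeff p i \<in> S" "a = poly p x" by (auto simp: adjoin_def)
    with a show ?thesis by (auto simp: I'_def intro!: bexI[of _ p])
  qed
  define P where "P f n r \<longleftrightarrow> r \<in> I' \<and> poly r x \<notin> H (f ` {..<n}) \<and>
     (\<forall>q\<in>I'. poly q x \<notin> H (f ` {..<n}) \<longrightarrow> degree r \<le> degree q)" for f and n :: nat and r
  have "\<exists>f. \<forall>n. P f n (f n)"
  proof (rule dependent_wellorder_choice)
    fix r :: "'a poly" and f g :: "nat \<Rightarrow> 'a poly" and n
    assume "\<And>y. y < n \<Longrightarrow> f y = g y"
    then have "f ` {..<n} = g ` {..<n}" by auto
    then show "P f n r = P g n r" by (simp add: P_def)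
  next
    fix n :: nat and f assume "\<And>y. y < n \<Longrightarrow> P f y (f y)"
    then have "f ` {..<n} \<subseteq> I'" by (auto simp: P_def)
    from ex[OF this] obtain p where p: "p \<in> I' \<and> poly p x \<notin> H (f ` {..<n})" by auto
    from ex_has_least_nat[of "\<lambda>p. p \<in> I' \<and> poly p x \<notin> H (f ` {..<n})", OF p, of degree]
    show "\<exists>r. P f n r" by (auto simp: P_def)
  qed
  then obtain f where f: "\<And>n. P f n (f n)" by blast
  have fI: "f n \<in> I'" for n using f[of n] by (simp add: P_def)
  have fr: "f ` K \<subseteq> I'" for K using fI by auto
  have fH: "poly (f n) x \<notin> H (f ` {..<n})" for n using f[of n] by (simp add: P_def)
  have min: "degree (f n) \<le> degree q" if "q \<in> I'" "poly q x \<notin> H (f ` {..<n})" for q n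
    using f[of n] that by (simp add: P_def)
  have mono: "degree (f m) \<le> degree (f n)" if "m < n" for m n
  proof (rule min[OF fI])
    have "H (f ` {..<m}) \<subseteq> H (f ` {..<n})" unfolding H_def
      by (intro hull_mono image_mono) (use that in auto)
    then show "poly (f n) x \<notin> H (f ` {..<m})" using fH[of n] by auto
  qed
  define a where "a n = lead_coeff (f n)" for n
  have aS: "range a \<subseteq> S" using fI by (auto simp: a_def I'_def)
  have "\<exists>G. finite G \<and> G \<subseteq> ideal_of S hull range a \<and> ideal_of S hull range a = ideal_of S hull G"
    using N ideal_of_hull[OF S aS] unfolding noetherian_def by blast
  then obtain G where G: "finite G" "G \<subseteq> ideal_of S hull range a" "ideal_of S hull range a = ideal_of S hull G"
    by blast
  have "\<exists>n. \<forall>g\<in>G. g \<in> ideal_of S hull (a ` {..<n})"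
    using G(1,2)
  proof (induction G)
    case (insert g G)
    then obtain n where n: "\<forall>g\<in>G. g \<in> ideal_of S hull (a ` {..<n})" by auto
    from hull_range_finite_stage[OF S aS] insert.prems obtain n' where
      n': "g \<in> ideal_of S hull (a ` {..<n'})" by blast
    have "ideal_of S hull (a ` {..<k}) \<subseteq> ideal_of S hull (a ` {..<max n n'})" if "k \<le> max n n'" for k
      using that by (intro hull_mono) auto
    from this[of n] this[of n'] n n' show ?case by (intro exI[of _ "max n n'"]) auto
  qed simp
  then obtain n where "G \<subseteq> ideal_of S hull (a ` {..<n})" by blast
  moreover have an: "a ` {..<n} \<subseteq> S" using aS by auto
  ultimately have "ideal_of S hull G \<subseteq> ideal_of S hull (a ` {..<n})"
    by (intro ideal_of_hull_minimal ideal_of_hull[OF S])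
  moreover have "a n \<in> ideal_of S hull range a" by (intro hull_inc) auto
  ultimately have "a n \<in> ideal_of S hull (a ` {..<n})" using G(3) by auto
  from hull_image_combination[OF S an this] obtain c where
    c: "\<And>i. c i \<in> S" "a n = (\<Sum>i<n. c i * a i)" by auto
  define d where "d i = degree (f i)" for i
  define g where "g = (\<Sum>i<n. monom (c i) (d n - d i) * f i)"
  have xT: "monom u k \<in> {p. \<forall>i. coeff p i \<in> S}" if "u \<in> S" for u k
    using that subringD(2)[OF S] by (auto simp: coeff_monom)
  have gS: "coeff g k \<in> S" for k
    unfolding g_def coeff_sum coeff_mult
    using xT[OF c(1)] fI by (intro subring_sum[OF S] subringD(4)[OF S]) (auto simp: I'_def)
  have gH: "poly g x \<in> H (f ` {..<n})"
    unfolding g_def poly_sum poly_mult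
  proof (intro ideal_of_sum[OF H[OF fr]] ideal_ofD(4)[OF H[OF fr]])
    fix i assume "i \<in> {..<n}"
    then show "poly (f i) x \<in> H (f ` {..<n})" unfolding H_def by (intro hull_inc) auto
    show "poly (monom (c i) (d n - d i)) x \<in> ?T" using xT[OF c(1)] by (auto simp: adjoin_def)
  qed
  have HI: "H (f ` {..<n}) \<subseteq> I" unfolding H_def by (rule ideal_of_hull_minimal[OF evI[OF fr] I])
  \<comment> \<open>The polynomial \<open>g\<close> has the degree and the leading coefficient of \<open>f n\<close>, but its value is generated by the
    previous values; hence \<open>q\<close> contradicts the minimal choice of \<open>f n\<close>.\<close>
  define q where "q = f n - g"
  have qI: "q \<in> I'"
  proof -
    have "poly (f n) x + - poly g x \<in> I"
      by (intro ideal_ofD(3)[OF I] ideal_of_uminus[OF T I]) (use fI gH HI in \<open>auto simp: I'_def\<close>)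
    then show ?thesis using fI gS subringD(3)[OF S] by (auto simp: I'_def q_def)
  qed
  have qH: "poly q x \<notin> H (f ` {..<n})"
  proof
    assume "poly q x \<in> H (f ` {..<n})"
    from ideal_ofD(3)[OF H[OF fr] this gH] fH show False by (simp add: q_def)
  qed
  have deg: "d n \<le> degree q" using min[OF qI qH] by (simp add: d_def)
  have tm: "coeff (monom (c i) (d n - d i) * f i) (d n) = c i * a i" if "i < n" for i
    using mono[OF that] coeff_monom_mult[of "c i" "d n - d i" "f i" "d n"]
    by (simp add: d_def a_def)
  have dt: "degree (monom (c i) (d n - d i) * f i) \<le> d n" if "i < n" for i
    using mono[OF that] degree_mult_le[of "monom (c i) (d n - d i)" "f i"] degree_monom_le[of "c i" "d n - d i"]
    by (simp add: d_def)
  have "degree g \<le> d n" unfolding g_def by (intro degree_sum_le) (use dt in auto)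
  then have dq: "degree q \<le> d n" unfolding q_def by (intro degree_diff_le) (simp_all add: d_def)
  have "coeff q (d n) = a n - (\<Sum>i<n. c i * a i)"
    unfolding q_def g_def coeff_diff coeff_sum using tm by (simp add: d_def a_def)
  with c(2) have "coeff q (d n) = 0" by simp
  with deg dq have "lead_coeff q = 0" by simp
  then have "q = 0" by simp
  with qH ideal_ofD(2)[OF H[OF fr]] show False by simp
qed

lemma k_algebra_0:
  fixes s :: "'k::field \<Rightarrow> 'a::{comm_ring, comm_monoid_mult}"
  assumes "k_algebra s" shows "s 0 = 0" 
proof -
  have "s 0 + s 0 = s (0 + 0)" using assms unfolding k_algebra_def by metis
  then show ?thesis by simp
qed

lemma k_algebra_uminus:
  fixes s :: "'k::field \<Rightarrow> 'a::{comm_ring, comm_monoid_mult}"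
  assumes "k_algebra s" shows "s (- c) = - s c"
proof -
  have "s (- c) + s c = s (- c + c)" using assms unfolding k_algebra_def by metis
  then show ?thesis using k_algebra_0[OF assms] by (simp add: eq_neg_iff_add_eq_0)
qed

lemma is_subalgebraI:
  assumes "\<And>c. s c \<in> B" "\<And>x y. x \<in> B \<Longrightarrow> y \<in> B \<Longrightarrow> x + y \<in> B"
    "\<And>x y. x \<in> B \<Longrightarrow> y \<in> B \<Longrightarrow> x * y \<in> B"
  shows "is_subalgebra s B"
  using assms by (auto simp: is_subalgebra_def)

lemma is_subalgebraD:
  assumes "is_subalgebra s B"
  shows "s c \<in> B" "x \<in> B \<Longrightarrow> y \<in> B \<Longrightarrow> x + y \<in> B" "x \<in> B \<Longrightarrow> y \<in> B \<Longrightarrow> x * y \<in> B"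
  using assms by (auto simp: is_subalgebra_def)

lemma is_subalgebra_hull: "is_subalgebra s (is_subalgebra s hull X)"
  by (rule hull_in) (auto simp: is_subalgebra_def)

lemma is_subalgebra_subring:
  fixes s :: "'k::field \<Rightarrow> 'a::comm_ring_1"
  assumes s: "k_algebra s" and B: "is_subalgebra s B"
  shows "subring B"
  unfolding subring_def
proof (intro conjI ballI)
  show "1 \<in> B" using s B unfolding k_algebra_def is_subalgebra_def by metis
  fix x y assume xy: "x \<in> B" "y \<in> B"
  then show "x * y \<in> B" using B by (simp add: is_subalgebra_def)
  have "s (- 1) * y = - y" using k_algebra_uminus[OF s] s by (simp add: k_algebra_def)
  then have "- y \<in> B" using B xy unfolding is_subalgebra_def by metis
  then have "x + - y \<in> B" using B xy unfolding is_subalgebra_def by blast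
  then show "x - y \<in> B" by simp
qed

text \<open>
A finitely generated algebra over a field arises from the field by adjoining one element at a time.
\<close>

theorem noetherian_hull:
  fixes s :: "'k::field \<Rightarrow> 'a::comm_ring_1"
  assumes s: "k_algebra s" and X: "finite X"
  shows "noetherian (is_subalgebra s hull X)"
  using X
proof (induction X)
  case empty
  have "is_subalgebra s hull {} = range s"
  proof (rule hull_unique)
    have "s c + s d = s (c + d)" "s c * s d = s (c * d)" for c d
      using s by (auto simp: k_algebra_def)
    then show "is_subalgebra s (range s)" by (auto simp: is_subalgebra_def)
  qed (auto simp: is_subalgebra_def)
  moreover have "noetherian (range s)"
    unfolding noetherian_def
  proof (intro allI impI)
    fix I assume I: "ideal_of (range s) I"
    have R: "subring (range s)" 
      using is_subalgebra_subring[OF s is_subalgebra_hull] \<open>is_subalgebra s hull {} = range s\<close> by metis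
    show "\<exists>G. finite G \<and> G \<subseteq> I \<and> I = ideal_of (range s) hull G"
    proof (cases "I = {0}")
      case True
      then show ?thesis using ideal_of_hull[OF R, of "{}"] hull_minimal[of "{}" I "ideal_of (range s)"] I
        by (intro exI[of _ "{}"]) (auto simp: ideal_of_def)
    next
      case False
      then obtain c where c: "s c \<in> I" "s c \<noteq> 0" using ideal_ofD(1,2)[OF I] by blast
      have "1 = s (inverse c) * s c"
      proof -
        have "c \<noteq> 0" using c k_algebra_0[OF s] by auto
        then show ?thesis using s unfolding k_algebra_def by (metis left_inverse)
      qed
      then have one: "1 \<in> I'" if "ideal_of (range s) I'" "s c \<in> I'" for I'
        using ideal_ofD(4)[OF that(1) _ that(2)] by (metis rangeI)
      have all: "I' = range s" if "ideal_of (range s) I'" "s c \<in> I'" for I'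
        using ideal_ofD(4)[OF that(1) _ one[OF that]] ideal_ofD(1)[OF that(1)] by auto
      have "ideal_of (range s) (ideal_of (range s) hull {s c})" by (rule ideal_of_hull[OF R]) auto
      from all[OF this] all[OF I c(1)] c(1) show ?thesis
        by (intro exI[of _ "{s c}"]) (auto intro: hull_inc)
    qed
  qed
  ultimately show ?case by simp
next
  case (insert x X)
  let ?S = "is_subalgebra s hull X"
  have S: "is_subalgebra s ?S" by (rule is_subalgebra_hull)
  have R: "subring ?S" by (rule is_subalgebra_subring[OF s S])
  have const: "c \<in> adjoin ?S x" if "c \<in> ?S" for c
    using that subringD(2)[OF R] by (auto simp: adjoin_def coeff_pCons split: nat.split intro!: exI[of _ "[:c:]"])
  have "is_subalgebra s hull (insert x X) = adjoin ?S x"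
  proof (rule hull_unique)
    have "x \<in> adjoin ?S x" using subringD(1,2)[OF R]
      by (auto simp: adjoin_def coeff_pCons split: nat.split intro!: exI[of _ "[:0, 1:]"])
    then show "insert x X \<subseteq> adjoin ?S x" using const by (auto intro: hull_inc)
    show "is_subalgebra s (adjoin ?S x)"
    proof (rule is_subalgebraI)
      show "s c \<in> adjoin ?S x" for c by (intro const is_subalgebraD(1)[OF S])
    qed (auto intro: subringD(4,6)[OF subring_adjoin[OF R]])
    fix B assume B: "insert x X \<subseteq> B" "is_subalgebra s B"
    then have "?S \<subseteq> B" by (intro hull_minimal) auto
    note RB = is_subalgebra_subring[OF s B(2)]
    show "adjoin ?S x \<subseteq> B"
      using B(1) \<open>?S \<subseteq> B\<close>
      by (auto simp: adjoin_def poly_altdef intro!: subring_sum[OF RB] subringD(4)[OF RB] subring_power[OF RB])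
  qed
  then show ?case using noetherian_adjoin[OF R insert.IH] by simp
qed

section \<open>Contracting an ideal forces torsion-freeness\<close>

text \<open>
Since \<open>\<sigma>\<close> fixes \<open>\<tau>\<close>, is the identity modulo \<open>J\<close> and maps \<open>J\<^sup>n\<close> into \<open>J\<^sup>2\<^sup>n\<close>, the elements \<open>\<sigma>\<^sup>k x\<close> are congruent to
\<open>x\<close> and satisfy \<open>\<tau> \<sigma>\<^sup>k x \<in> J\<^bsup>2^k\<^esup>\<close>. By Artin-Rees \<open>J\<^sup>c \<inter> \<tau>S \<subseteq> \<tau>J\<close> for large \<open>c\<close>, and \<open>\<tau>\<close> can be cancelled.

Both steps take place in the Rees algebra \<open>\<Oplus> J\<^sup>n X\<^sup>n \<subseteq> S[X]\<close>. Powers of \<open>J\<close> are never formed: membership of \<open>a\<close>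
in \<open>J\<^sup>n\<close> is expressed by \<open>monom a n \<in> Rees\<close>.
\<close>

theorem torsion_free_of_contraction:
  fixes s :: "'k::field \<Rightarrow> 'a::comm_ring_1"
  assumes s: "k_algebra s" and X: "finite X" and S_def: "S = is_subalgebra s hull X"
    and J: "ideal_of S J"
    and \<sigma>_add: "\<And>x y. \<sigma> (x + y) = \<sigma> x + \<sigma> y" and \<sigma>_mult: "\<And>x y. \<sigma> (x * y) = \<sigma> x * \<sigma> y"
    and \<sigma>_S: "\<And>x. x \<in> S \<Longrightarrow> \<sigma> x \<in> S" and \<sigma>_id: "\<And>x. x \<in> S \<Longrightarrow> \<sigma> x - x \<in> J"
    and \<sigma>_J: "\<And>x. x \<in> J \<Longrightarrow> \<sigma> x \<in> ideal_of S hull {a * b |a b. a \<in> J \<and> b \<in> J}"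
    and \<tau>: "\<tau> \<in> S" "\<sigma> \<tau> = \<tau>" "\<And>x. \<tau> * x = 0 \<Longrightarrow> x = 0"
    and x: "x \<in> S" "\<tau> * x \<in> J"
  shows "x \<in> J"
proof -
  note S = is_subalgebra_subring[OF s is_subalgebra_hull, of X, folded S_def]
  have "noetherian S" unfolding S_def by (rule noetherian_hull[OF s X])
  then obtain G where G: "finite G" "G \<subseteq> J" "J = ideal_of S hull G"
    using J unfolding noetherian_def by blast
  note JS = ideal_ofD(1)[OF J]
  have \<sigma>0: "\<sigma> 0 = 0" using \<sigma>_add[of 0 0] by simp
  have \<sigma>_sum: "\<sigma> (sum f K) = (\<Sum>i\<in>K. \<sigma> (f i))" for f and K :: "nat set"
    by (induction K rule: infinite_finite_induct) (auto simp: \<sigma>0 \<sigma>_add)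

  \<comment> \<open>The Rees algebra, generated by \<open>S\<close> in degree \<open>0\<close> and by generators of \<open>J\<close> in degree \<open>1\<close>.\<close>
  define s' where "s' c = [:s c:]" for c
  define Y where "Y = (\<lambda>a. [:a:]) ` X \<union> (\<lambda>g. monom g 1) ` G"
  define Rees where "Rees = is_subalgebra s' hull Y"
  have s': "k_algebra s'" using s by (auto simp: s'_def k_algebra_def one_pCons)
  have subR: "is_subalgebra s' Rees" unfolding Rees_def by (rule is_subalgebra_hull)
  have R: "subring Rees" by (rule is_subalgebra_subring[OF s' subR])
  have minR: "Rees \<subseteq> B" if "Y \<subseteq> B" "is_subalgebra s' B" for B
    unfolding Rees_def using that by (rule hull_minimal)
  have YR: "y \<in> Rees" if "y \<in> Y" for y unfolding Rees_def using that by (rule hull_inc)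
  have const: "[:a:] \<in> Rees" if "a \<in> S" for a
  proof -
    have "X \<subseteq> {a. [:a:] \<in> Rees}" using YR by (auto simp: Y_def)
    moreover have "is_subalgebra s {a. [:a:] \<in> Rees}"
    proof (rule is_subalgebraI)
      show "s c \<in> {a. [:a:] \<in> Rees}" for c using is_subalgebraD(1)[OF subR, of c] by (simp add: s'_def)
      fix x y assume xy: "x \<in> {a. [:a:] \<in> Rees}" "y \<in> {a. [:a:] \<in> Rees}"
      show "x + y \<in> {a. [:a:] \<in> Rees}" using subringD(6)[OF R, of "[:x:]" "[:y:]"] xy by simp
      show "x * y \<in> {a. [:a:] \<in> Rees}" using subringD(4)[OF R, of "[:x:]" "[:y:]"] xy by (simp add: mult_ac)
    qed
    ultimately have "S \<subseteq> {a. [:a:] \<in> Rees}" unfolding S_def by (rule hull_minimal)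
    with that show ?thesis by auto
  qed
  have ideal_monom: "ideal_of S {a \<in> S. monom a n \<in> Rees}" for n
  proof (rule ideal_ofI)
    show "0 \<in> {a \<in> S. monom a n \<in> Rees}" using subringD(2)[OF S] subringD(2)[OF R] by simp
    fix x y assume "x \<in> {a \<in> S. monom a n \<in> Rees}" "y \<in> {a \<in> S. monom a n \<in> Rees}"
    then show "x + y \<in> {a \<in> S. monom a n \<in> Rees}"
      using subringD(6)[OF S] subringD(6)[OF R] by (simp flip: add_monom)
  next
    fix q x assume "q \<in> S" "x \<in> {a \<in> S. monom a n \<in> Rees}"
    moreover from this have "[:q:] * monom x n \<in> Rees" using subringD(4)[OF R] const by blast
    ultimately show "q * x \<in> {a \<in> S. monom a n \<in> Rees}"
      using subringD(4)[OF S] by (simp add: smult_monom)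
  qed auto
  have JR: "monom a 1 \<in> Rees" if "a \<in> J" for a
  proof -
    have "G \<subseteq> {a \<in> S. monom a 1 \<in> Rees}" using YR JS G(2) by (auto simp: Y_def)
    from ideal_of_hull_minimal[OF this ideal_monom] that G(3) show ?thesis by auto
  qed
  have J2R: "monom a 2 \<in> Rees" if "a \<in> ideal_of S hull {a * b |a b. a \<in> J \<and> b \<in> J}" for a
  proof -
    have "{a * b |a b. a \<in> J \<and> b \<in> J} \<subseteq> {a \<in> S. monom a 2 \<in> Rees}"
    proof safe
      fix a b assume ab: "a \<in> J" "b \<in> J"
      then show "a * b \<in> S" using JS subringD(4)[OF S] by blast
      have "monom (a * b) 2 = monom a 1 * monom b 1" by (simp add: mult_monom numeral_2_eq_2)
      then show "monom (a * b) 2 \<in> Rees" using subringD(4)[OF R] JR ab by simp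
    qed
    from ideal_of_hull_minimal[OF this ideal_monom] that show ?thesis by auto
  qed
  have coeff_R: "coeff p n \<in> S \<and> (n \<ge> 1 \<longrightarrow> coeff p n \<in> J)" if "p \<in> Rees" for p n
  proof -
    let ?B = "{p. \<forall>n. coeff p n \<in> S \<and> (n \<ge> 1 \<longrightarrow> coeff p n \<in> J)}"
    have X': "X \<subseteq> S" unfolding S_def by (rule hull_subset)
    have "Y \<subseteq> ?B"
      using X' G(2) JS subringD(2)[OF S] ideal_ofD(2)[OF J]
      by (auto simp: Y_def coeff_pCons split: nat.split)
    moreover have "is_subalgebra s' ?B"
    proof (rule is_subalgebraI)
      have "s c \<in> S" for c unfolding S_def by (rule is_subalgebraD(1)[OF is_subalgebra_hull])
      then show "s' c \<in> ?B" for c using subringD(2)[OF S] ideal_ofD(2)[OF J]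
        by (auto simp: s'_def coeff_pCons split: nat.split)
      fix p q assume pq: "p \<in> ?B" "q \<in> ?B"
      show "p + q \<in> ?B" using pq subringD(6)[OF S] ideal_ofD(3)[OF J] by simp
      have "coeff p i * coeff q (n - i) \<in> J" if "n \<ge> 1" "i \<le> n" for n i
      proof (cases "i = 0")
        case True then show ?thesis using pq that ideal_ofD(4)[OF J] by simp
      next
        case False then show ?thesis using pq that ideal_ofD(4)[OF J, of "coeff q (n - i)" "coeff p i"]
          by (simp add: mult.commute)
      qed
      then show "p * q \<in> ?B" using pq
        by (auto simp: coeff_mult intro!: subring_sum[OF S] subringD(4)[OF S] ideal_of_sum[OF J])
    qed
    ultimately show ?thesis using minR[of ?B] that by blast
  qed
  \<comment> \<open>The statement \<open>\<sigma>(J\<^sup>n) \<subseteq> J\<^sup>2\<^sup>n\<close>, proved by induction on the generation of the Rees algebra.\<close>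
  have \<sigma>R: "monom (\<sigma> (coeff p n)) (2 * n) \<in> Rees" if "p \<in> Rees" for p n
  proof -
    let ?B = "{p. \<forall>n. monom (\<sigma> (coeff p n)) (2 * n) \<in> Rees}"
    have B_const: "[:a:] \<in> ?B" if "a \<in> S" for a
      using const[OF \<sigma>_S[OF that]] subringD(2)[OF R]
      by (auto simp: coeff_pCons \<sigma>0 monom_0 split: nat.split)
    have X': "X \<subseteq> S" unfolding S_def by (rule hull_subset)
    have "Y \<subseteq> ?B" unfolding Y_def
    proof (intro Un_least image_subsetI)
      fix g assume "g \<in> G"
      then have "monom (\<sigma> g) 2 \<in> Rees" using J2R \<sigma>_J G(2) by blast
      then show "monom g 1 \<in> ?B" using subringD(2)[OF R] by (auto simp: \<sigma>0)
    qed (use X' B_const in blast)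
    moreover have "is_subalgebra s' ?B"
    proof (rule is_subalgebraI)
      have "s c \<in> S" for c unfolding S_def by (rule is_subalgebraD(1)[OF is_subalgebra_hull])
      then show "s' c \<in> ?B" for c using B_const unfolding s'_def by blast
      fix p q assume pq: "p \<in> ?B" "q \<in> ?B"
      show "p + q \<in> ?B" using pq subringD(6)[OF R] by (simp add: \<sigma>_add flip: add_monom)
      have *: "2 * i + 2 * (n - i) = 2 * n" if "i \<le> n" for i n :: nat using that by simp
      have "monom (\<sigma> (coeff (p * q) n)) (2 * n) =
          (\<Sum>i\<le>n. monom (\<sigma> (coeff p i)) (2 * i) * monom (\<sigma> (coeff q (n - i))) (2 * (n - i)))" for n
        by (auto simp: coeff_mult \<sigma>_sum \<sigma>_mult monom_sum mult_monom * intro!: sum.cong)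
      then show "p * q \<in> ?B" using pq by (auto intro!: subring_sum[OF R] subringD(4)[OF R])
    qed
    ultimately show ?thesis using minR[of ?B] that by blast
  qed
  define \<sigma>k where "\<sigma>k k = (\<sigma> ^^ k) x" for k
  have \<sigma>k: "\<sigma>k k \<in> S \<and> \<sigma>k k - x \<in> J \<and> monom (\<tau> * \<sigma>k k) (2 ^ k) \<in> Rees" for k
  proof (induction k)
    case 0
    then show ?case using x JR ideal_ofD(2)[OF J] by (simp add: \<sigma>k_def)
  next
    case (Suc k)
    have "(\<sigma> (\<sigma>k k) - \<sigma>k k) + (\<sigma>k k - x) \<in> J"
      using Suc \<sigma>_id by (intro ideal_ofD(3)[OF J]) auto
    moreover have "monom (\<sigma> (\<tau> * \<sigma>k k)) (2 * 2 ^ k) \<in> Rees"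
      using \<sigma>R[of "monom (\<tau> * \<sigma>k k) (2 ^ k)" "2 ^ k"] Suc by simp
    ultimately show ?case using Suc \<sigma>_S by (simp add: \<sigma>k_def \<sigma>_mult \<tau>)
  qed

  \<comment> \<open>The ideal \<open>\<Oplus> (J\<^sup>n \<inter> \<tau>S) X\<^sup>n\<close>. Above the degrees \<open>\<le> c\<close> of its generators its coefficients lie in
    \<open>J \<cdot> \<tau>S = \<tau>J\<close>, because a multiplier of positive degree has coefficients in \<open>J\<close>.\<close>
  define N where "N = {p \<in> Rees. \<forall>n. coeff p n \<in> (*) \<tau> ` S}"
  have \<tau>S: "ideal_of S ((*) \<tau> ` S)"
  proof (rule ideal_ofI)
    show "(*) \<tau> ` S \<subseteq> S" using \<tau>(1) subringD(4)[OF S] by auto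
    show "0 \<in> (*) \<tau> ` S" using subringD(2)[OF S] by (auto intro!: image_eqI[of _ _ 0])
    fix a b assume "a \<in> (*) \<tau> ` S" "b \<in> (*) \<tau> ` S"
    then show "a + b \<in> (*) \<tau> ` S" using subringD(6)[OF S] by (auto simp flip: distrib_left)
  next
    fix q a assume "q \<in> S" "a \<in> (*) \<tau> ` S"
    then show "q * a \<in> (*) \<tau> ` S" using subringD(4)[OF S]
      by (auto simp: mult.left_commute[of q \<tau>])
  qed
  have N: "ideal_of Rees N"
  proof (rule ideal_ofI)
    show "0 \<in> N" using subringD(2)[OF R] ideal_ofD(2)[OF \<tau>S] by (simp add: N_def)
    fix p q assume "p \<in> N" "q \<in> N"
    then show "p + q \<in> N" using subringD(6)[OF R] ideal_ofD(3)[OF \<tau>S] by (simp add: N_def)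
  next
    fix q p assume "q \<in> Rees" "p \<in> N"
    then show "q * p \<in> N" using subringD(4)[OF R] coeff_R
      by (auto simp: N_def coeff_mult intro!: ideal_of_sum[OF \<tau>S] ideal_ofD(4)[OF \<tau>S])
  qed (auto simp: N_def)
  have "noetherian Rees" unfolding Rees_def
    by (rule noetherian_hull[OF s']) (use X G(1) in \<open>auto simp: Y_def\<close>)
  then obtain G' where G': "finite G'" "G' \<subseteq> N" "N = ideal_of Rees hull G'"
    using N unfolding noetherian_def by blast
  define c where "c = Max (insert 0 (degree ` G'))"
  have c: "degree p \<le> c" if "p \<in> G'" for p using that G'(1) by (auto simp: c_def intro!: Max_ge)
  define N' where "N' = {p \<in> N. \<forall>n>c. coeff p n \<in> (*) \<tau> ` J}"
  have J0: "0 \<in> (*) \<tau> ` J" using ideal_ofD(2)[OF J] by (auto intro!: image_eqI[of _ _ 0])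
  have \<tau>J_sum: "sum f K \<in> (*) \<tau> ` J" if "\<And>i. i \<in> K \<Longrightarrow> f i \<in> (*) \<tau> ` J" for f and K :: "nat set"
    using that
  proof (induction K rule: infinite_finite_induct)
    case (insert i K)
    then obtain a b where "f i = \<tau> * a" "a \<in> J" "sum f K = \<tau> * b" "b \<in> J" by blast
    then have "sum f (insert i K) = \<tau> * (a + b)" "a + b \<in> J"
      using insert ideal_ofD(3)[OF J] by (auto simp: distrib_left)
    then show ?case by blast
  qed (use J0 in auto)
  have N': "ideal_of Rees N'"
  proof (rule ideal_ofI)
    show "N' \<subseteq> Rees" by (auto simp: N'_def N_def)
    show "0 \<in> N'" using ideal_ofD(2)[OF N] J0 by (simp add: N'_def)
    fix p q assume pq: "p \<in> N'" "q \<in> N'"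
    have "coeff p n + coeff q n \<in> (*) \<tau> ` J" if "n > c" for n
    proof -
      from pq that obtain a b where "coeff p n = \<tau> * a" "a \<in> J" "coeff q n = \<tau> * b" "b \<in> J"
        unfolding N'_def by blast
      then show ?thesis using ideal_ofD(3)[OF J] by (auto simp flip: distrib_left)
    qed
    then show "p + q \<in> N'" using pq ideal_ofD(3)[OF N] by (simp add: N'_def)
  next
    fix q p assume q: "q \<in> Rees" and p: "p \<in> N'"
    have "coeff p i * coeff q (n - i) \<in> (*) \<tau> ` J" if n: "n > c" "i \<le> n" for n i
    proof (cases "i > c")
      case True
      with p obtain a where "coeff p i = \<tau> * a" "a \<in> J" by (auto simp: N'_def)
      then have "coeff p i * coeff q (n - i) = \<tau> * (coeff q (n - i) * a)" "coeff q (n - i) * a \<in> J"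
        using coeff_R[OF q, of "n - i"] ideal_ofD(4)[OF J, of "coeff q (n - i)" a]
        by (simp_all add: mult_ac)
      then show ?thesis by blast
    next
      case False
      with n have "coeff q (n - i) \<in> J" using coeff_R[OF q] by simp
      moreover from p obtain a where "coeff p i = \<tau> * a" "a \<in> S" by (auto simp: N'_def N_def)
      ultimately have "coeff p i * coeff q (n - i) = \<tau> * (a * coeff q (n - i))" "a * coeff q (n - i) \<in> J"
        using ideal_ofD(4)[OF J, of a "coeff q (n - i)"] by (simp_all add: mult_ac)
      then show ?thesis by blast
    qed
    then have "coeff (p * q) n \<in> (*) \<tau> ` J" if "n > c" for n
      unfolding coeff_mult using that by (intro \<tau>J_sum) auto
    moreover have "q * p \<in> N" using ideal_ofD(4)[OF N] q p by (simp add: N'_def)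
    ultimately show "q * p \<in> N'" by (auto simp: N'_def mult.commute)
  qed
  have "G' \<subseteq> N'"
  proof
    fix p assume "p \<in> G'"
    then have "coeff p n = 0" if "n > c" for n using that c[of p]
      by (intro coeff_eq_0) auto
    then show "p \<in> N'" using \<open>p \<in> G'\<close> G'(2) J0 by (auto simp: N'_def)
  qed
  from ideal_of_hull_minimal[OF this N'] G'(3) have NN': "N \<subseteq> N'" by simp
  have "monom (\<tau> * \<sigma>k c) (2 ^ c) \<in> N"
    using \<sigma>k[of c] ideal_ofD(2)[OF \<tau>S] by (auto simp: N_def)
  with NN' have "coeff (monom (\<tau> * \<sigma>k c) (2 ^ c)) (2 ^ c) \<in> (*) \<tau> ` J"
    unfolding N'_def using less_exp[of c] by blast
  then obtain a where a: "a \<in> J" "\<tau> * \<sigma>k c = \<tau> * a" by auto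
  then have "\<tau> * (\<sigma>k c - a) = 0" by (simp add: right_diff_distrib)
  from \<tau>(3)[OF this] a(1) have "\<sigma>k c \<in> J" by simp
  moreover have "- (\<sigma>k c - x) \<in> J" using \<sigma>k[of c] by (intro ideal_of_uminus[OF S J]) simp
  ultimately have "\<sigma>k c + - (\<sigma>k c - x) \<in> J" by (rule ideal_ofD(3)[OF J])
  then show ?thesis by simp
qed

section \<open>Monoid algebras and their gradings\<close>

lemma poly_mapping_sum_singles:
  "p = (\<Sum>m\<in>Poly_Mapping.keys p. Poly_Mapping.single m (Poly_Mapping.lookup p m))"
  by (rule poly_mapping_eqI)
    (auto simp: lookup_sum lookup_single when_def in_keys_iff sum.delta)

lemma poly_mapping_induct [case_names zero single add]:
  fixes p :: "'m \<Rightarrow>\<^sub>0 'b::comm_monoid_add"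
  assumes "P 0"
    and "\<And>m. m \<in> Poly_Mapping.keys p \<Longrightarrow> P (Poly_Mapping.single m (Poly_Mapping.lookup p m))"
    and "\<And>p q. P p \<Longrightarrow> P q \<Longrightarrow> P (p + q)"
  shows "P p"
proof -
  have "P (\<Sum>m\<in>K. Poly_Mapping.single m (Poly_Mapping.lookup p m))" if "K \<subseteq> Poly_Mapping.keys p" for K
    using that by (induction K rule: infinite_finite_induct) (auto intro: assms)
  from this[OF subset_refl] poly_mapping_sum_singles[of p] show ?thesis by simp
qed

text \<open>
The ring homomorphism out of a monoid algebra that extends \<open>c\<close> on coefficients and \<open>\<chi>\<close> on the monoid. All
homomorphisms out of polynomial and Laurent polynomial rings below are of this form.
\<close>

definition alg_eval :: "('b::comm_ring \<Rightarrow> 'r::comm_ring) \<Rightarrow> ('m \<Rightarrow> 'r) \<Rightarrow> ('m \<Rightarrow>\<^sub>0 'b) \<Rightarrow> 'r" where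
  "alg_eval c \<chi> p = (\<Sum>m\<in>Poly_Mapping.keys p. c (Poly_Mapping.lookup p m) * \<chi> m)"

context
  fixes c :: "'b::comm_ring \<Rightarrow> 'r::comm_ring"
  assumes c_add: "\<And>x y. c (x + y) = c x + c y"
begin

lemma coeff_hom_0: "c 0 = 0"
  using c_add[of 0 0] by simp

lemma alg_eval_superset:
  "finite K \<Longrightarrow> Poly_Mapping.keys p \<subseteq> K \<Longrightarrow> alg_eval c \<chi> p = (\<Sum>m\<in>K. c (Poly_Mapping.lookup p m) * \<chi> m)"
  unfolding alg_eval_def by (rule sum.mono_neutral_left) (auto simp: in_keys_iff coeff_hom_0)

lemma alg_eval_0 [simp]: "alg_eval c \<chi> 0 = 0"
  by (simp add: alg_eval_def)

lemma alg_eval_single: "alg_eval c \<chi> (Poly_Mapping.single m a) = c a * \<chi> m"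
  by (cases "a = 0") (auto simp: alg_eval_def coeff_hom_0)

lemma alg_eval_add: "alg_eval c \<chi> (p + q) = alg_eval c \<chi> p + alg_eval c \<chi> q"
proof -
  let ?K = "Poly_Mapping.keys p \<union> Poly_Mapping.keys q"
  have "Poly_Mapping.keys (p + q) \<subseteq> ?K" by (rule Poly_Mapping.keys_add)
  then show ?thesis
    by (simp add: alg_eval_superset[of ?K] lookup_add c_add distrib_right sum.distrib)
qed

lemma alg_eval_sum: "alg_eval c \<chi> (sum f I) = (\<Sum>i\<in>I. alg_eval c \<chi> (f i))"
  by (induction I rule: infinite_finite_induct) (simp_all add: alg_eval_add)

lemma alg_eval_diff: "alg_eval c \<chi> (p - q) = alg_eval c \<chi> p - alg_eval c \<chi> q"
  using alg_eval_add[of \<chi> "p - q" q] by simp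

end

text \<open>
Multiplicativity of \<open>\<chi>\<close> is required on the supports of the two factors only, because the map
\<open>tilde_eval\<close> below is a homomorphism on a subring and not on the whole Laurent polynomial ring.
\<close>

lemma alg_eval_mult:
  fixes p q :: "'m::comm_monoid_add \<Rightarrow>\<^sub>0 'b::comm_ring"
  assumes c: "\<And>x y. c (x + y) = c x + c y" "\<And>x y. c (x * y) = c x * c y"
    and \<chi>: "\<And>m n. m \<in> Poly_Mapping.keys p \<Longrightarrow> n \<in> Poly_Mapping.keys q \<Longrightarrow> \<chi> (m + n) = \<chi> m * \<chi> n"
  shows "alg_eval c \<chi> (p * q) = alg_eval c \<chi> p * alg_eval c \<chi> q"
proof -
  let ?s = "\<lambda>p m. Poly_Mapping.single m (Poly_Mapping.lookup p m)"
  have "p * q = (\<Sum>m\<in>Poly_Mapping.keys p. \<Sum>n\<in>Poly_Mapping.keys q. ?s p m * ?s q n)"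
    by (subst poly_mapping_sum_singles[of p], subst poly_mapping_sum_singles[of q]) (simp add: sum_product)
  then have "alg_eval c \<chi> (p * q) =
      (\<Sum>m\<in>Poly_Mapping.keys p. \<Sum>n\<in>Poly_Mapping.keys q.
        c (Poly_Mapping.lookup p m * Poly_Mapping.lookup q n) * \<chi> (m + n))"
    by (simp add: alg_eval_sum[of c] alg_eval_single[of c] c(1) mult_single)
  also have "\<dots> = alg_eval c \<chi> p * alg_eval c \<chi> q"
    by (simp add: alg_eval_def sum_product c(2) \<chi> mult_ac)
  finally show ?thesis .
qed

text \<open>
A grading of a monoid algebra is given by an additive map \<open>\<delta>\<close> from the monoid to the integers.
\<close>

definition component :: "('m \<Rightarrow> int) \<Rightarrow> int \<Rightarrow> ('m \<Rightarrow>\<^sub>0 'b::zero) \<Rightarrow> ('m \<Rightarrow>\<^sub>0 'b)" where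
  "component \<delta> n p = Poly_Mapping.mapp (\<lambda>m c. c when \<delta> m = n) p"

definition homogeneous :: "('m \<Rightarrow> int) \<Rightarrow> int \<Rightarrow> ('m \<Rightarrow>\<^sub>0 'b::zero) \<Rightarrow> bool" where
  "homogeneous \<delta> n p \<longleftrightarrow> (\<forall>m\<in>Poly_Mapping.keys p. \<delta> m = n)"

lemma lookup_component: "Poly_Mapping.lookup (component \<delta> n p) m = (Poly_Mapping.lookup p m when \<delta> m = n)"
  by (simp add: component_def lookup_mapp in_keys_iff when_def)

lemma keys_component: "Poly_Mapping.keys (component \<delta> n p) = {m \<in> Poly_Mapping.keys p. \<delta> m = n}"
  by (auto simp: in_keys_iff lookup_component)

lemma homogeneous_component: "homogeneous \<delta> n (component \<delta> n p)"
  by (simp add: homogeneous_def keys_component)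

lemma component_0 [simp]: "component \<delta> n 0 = 0"
  by (rule poly_mapping_eqI) (simp add: lookup_component)

lemma component_add:
  "component \<delta> n (p + q) = component \<delta> n p + component \<delta> n (q :: _ \<Rightarrow>\<^sub>0 _::comm_monoid_add)"
  by (rule poly_mapping_eqI) (simp add: lookup_component lookup_add when_add_distrib)

lemma component_sum:
  "component \<delta> n (sum f I) = (\<Sum>i\<in>I. component \<delta> n (f i :: _ \<Rightarrow>\<^sub>0 _::comm_monoid_add))"
  by (induction I rule: infinite_finite_induct) (simp_all add: component_add)

lemma component_diff:
  "component \<delta> n (p - q) = component \<delta> n p - component \<delta> n (q :: _ \<Rightarrow>\<^sub>0 _::ab_group_add)"
  by (rule poly_mapping_eqI) (simp add: lookup_component lookup_minus when_def)

lemma component_of_homogeneous: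
  "homogeneous \<delta> n p \<Longrightarrow> component \<delta> k p = (if k = n then p else 0)"
  by (rule poly_mapping_eqI) (auto simp: lookup_component homogeneous_def in_keys_iff when_def)

lemma homogeneous_0 [simp]: "homogeneous \<delta> n 0"
  by (simp add: homogeneous_def)

lemma homogeneous_single: "\<delta> m = n \<Longrightarrow> homogeneous \<delta> n (Poly_Mapping.single m a)"
  by (auto simp: homogeneous_def split: if_splits)

lemma homogeneous_add:
  "homogeneous \<delta> n p \<Longrightarrow> homogeneous \<delta> n q \<Longrightarrow> homogeneous \<delta> n (p + q :: _ \<Rightarrow>\<^sub>0 _::comm_monoid_add)"
  using Poly_Mapping.keys_add[of p q] by (auto simp: homogeneous_def)

lemma homogeneous_diff:
  "homogeneous \<delta> n p \<Longrightarrow> homogeneous \<delta> n q \<Longrightarrow> homogeneous \<delta> n (p - q :: _ \<Rightarrow>\<^sub>0 _::ab_group_add)"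
  by (metis component_diff component_of_homogeneous homogeneous_component)

lemma homogeneous_sum:
  "(\<And>i. i \<in> I \<Longrightarrow> homogeneous \<delta> n (f i)) \<Longrightarrow> homogeneous \<delta> n (sum f I :: _ \<Rightarrow>\<^sub>0 _::comm_monoid_add)"
  by (induction I rule: infinite_finite_induct) (auto intro: homogeneous_add)

lemma homogeneous_mult:
  fixes p q :: "'m::comm_monoid_add \<Rightarrow>\<^sub>0 'b::comm_semiring_0"
  assumes "\<And>m n. \<delta> (m + n) = \<delta> m + \<delta> n"
  shows "homogeneous \<delta> i p \<Longrightarrow> homogeneous \<delta> j q \<Longrightarrow> homogeneous \<delta> (i + j) (p * q)"
  using keys_mult[of p q] assms by (fastforce simp: homogeneous_def)

lemma component_mult_homogeneous:
  fixes p q :: "'m::comm_monoid_add \<Rightarrow>\<^sub>0 'b::comm_ring"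
  assumes \<delta>: "\<And>m n. \<delta> (m + n) = \<delta> m + \<delta> n" and p: "homogeneous \<delta> i p"
  shows "component \<delta> (i + j) (p * q) = p * component \<delta> j q"
proof (induction q rule: poly_mapping_induct)
  case (single m)
  have "homogeneous \<delta> (\<delta> m) (Poly_Mapping.single m (Poly_Mapping.lookup q m))"
    by (rule homogeneous_single) simp
  from component_of_homogeneous[OF this] component_of_homogeneous[OF homogeneous_mult[OF \<delta> p this]]
  show ?case by simp
qed (simp_all add: component_add distrib_left)

lemma sum_components:
  fixes p :: "'m \<Rightarrow>\<^sub>0 'b::comm_monoid_add"
  shows "p = (\<Sum>n\<in>\<delta> ` Poly_Mapping.keys p. component \<delta> n p)"
proof (rule poly_mapping_eqI)
  fix m
  have "(\<Sum>n\<in>\<delta> ` Poly_Mapping.keys p. Poly_Mapping.lookup p m when \<delta> m = n) =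
      (if \<delta> m \<in> \<delta> ` Poly_Mapping.keys p then Poly_Mapping.lookup p m else 0)"
    by (simp add: when_def sum.delta)
  also have "\<dots> = Poly_Mapping.lookup p m" by (auto simp: in_keys_iff)
  finally show "Poly_Mapping.lookup p m =
      Poly_Mapping.lookup (\<Sum>n\<in>\<delta> ` Poly_Mapping.keys p. component \<delta> n p) m"
    by (simp add: lookup_sum lookup_component)
qed

lemma monomial_induct [case_names zero step]:
  fixes \<alpha> :: "nat \<Rightarrow>\<^sub>0 nat"
  assumes "P 0" "\<And>i \<alpha>. P \<alpha> \<Longrightarrow> P (Poly_Mapping.single i 1 + \<alpha>)"
  shows "P \<alpha>"
proof -
  have "\<forall>\<beta>. P \<beta> \<longrightarrow> P (\<alpha> + \<beta>)"
  proof (induction \<alpha> rule: poly_mapping_induct)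
    case (single i)
    have "P (Poly_Mapping.single i k + \<beta>)" if "P \<beta>" for k \<beta>
    proof (induction k)
      case (Suc k)
      have "Poly_Mapping.single i (Suc k) = Poly_Mapping.single i 1 + Poly_Mapping.single i k"
        by (simp flip: single_add)
      with assms(2)[OF Suc] show ?case by (simp add: add.assoc)
    qed (use that in simp)
    then show ?case by blast
  qed (simp_all add: add.assoc)
  with assms(1) show ?thesis by force
qed

definition weight :: "(nat \<Rightarrow> int) \<Rightarrow> (nat \<Rightarrow>\<^sub>0 nat) \<Rightarrow> int" where
  "weight d \<alpha> = (\<Sum>i\<in>Poly_Mapping.keys \<alpha>. int (Poly_Mapping.lookup \<alpha> i) * d i)"

lemma weight_0 [simp]: "weight d 0 = 0"
  by (simp add: weight_def)

lemma weight_single [simp]: "weight d (Poly_Mapping.single i (Suc 0)) = d i"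
  by (simp add: weight_def)

lemma weight_add: "weight d (\<alpha> + \<beta>) = weight d \<alpha> + weight d \<beta>"
  unfolding weight_def by (rule setsum_keys_plus_distrib) (auto simp: algebra_simps)

lemma weight_nonneg: "(\<And>i. d i \<ge> 0) \<Longrightarrow> weight d \<alpha> \<ge> 0"
  by (auto simp: weight_def intro!: sum_nonneg)

lemma weight_fun_add: "weight (\<lambda>i. d i + e i) \<alpha> = weight d \<alpha> + weight e \<alpha>"
  by (simp add: weight_def sum.distrib distrib_left)

definition mono_eval :: "(nat \<Rightarrow> 'r::comm_monoid_mult) \<Rightarrow> (nat \<Rightarrow>\<^sub>0 nat) \<Rightarrow> 'r" where
  "mono_eval v \<alpha> = (\<Prod>i\<in>Poly_Mapping.keys \<alpha>. v i ^ Poly_Mapping.lookup \<alpha> i)"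

lemma mono_eval_0 [simp]: "mono_eval v 0 = 1"
  by (simp add: mono_eval_def)

lemma mono_eval_single [simp]: "mono_eval v (Poly_Mapping.single i (Suc 0)) = v i"
  by (simp add: mono_eval_def)

lemma mono_eval_add: "mono_eval v (\<alpha> + \<beta>) = mono_eval v \<alpha> * mono_eval v \<beta>"
proof -
  let ?K = "Poly_Mapping.keys \<alpha> \<union> Poly_Mapping.keys \<beta>"
  have *: "mono_eval v \<gamma> = (\<Prod>i\<in>?K. v i ^ Poly_Mapping.lookup \<gamma> i)" if "Poly_Mapping.keys \<gamma> \<subseteq> ?K" for \<gamma>
    unfolding mono_eval_def using that by (intro prod.mono_neutral_left) (auto simp: in_keys_iff)
  show ?thesis
    using Poly_Mapping.keys_add[of \<alpha> \<beta>] by (simp add: * lookup_add power_add prod.distrib)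
qed

lemma alg_homsD:
  assumes "h \<in> alg_homs s s'"
  shows "h (x + y) = h x + h y" "h (x * y) = h x * h y" "h (s c) = s' c" "h 0 = 0" "h (- x) = - h x"
    "h (x - y) = h x - h y"
proof -
  have add: "h (x + y) = h x + h y" for x y using assms by (simp add: alg_homs_def)
  then show "h (x + y) = h x + h y" .
  show "h (x * y) = h x * h y" "h (s c) = s' c" using assms by (simp_all add: alg_homs_def)
  show 0: "h 0 = 0" using add[of 0 0] by simp
  show "h (- x) = - h x" using add[of x "- x"] by (simp add: 0 eq_neg_iff_add_eq_0 add.commute)
  show "h (x - y) = h x - h y" using add[of "x - y" y] by simp
qed

lemma alg_homs_sum: "h \<in> alg_homs s s' \<Longrightarrow> h (sum f I) = (\<Sum>i\<in>I. h (f i))"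
  by (induction I rule: infinite_finite_induct) (auto simp: alg_homsD)

lemma k_algebra_single_0: "k_algebra (Poly_Mapping.single 0 :: 'k::field \<Rightarrow> 'm::comm_monoid_add \<Rightarrow>\<^sub>0 'k)"
  by (simp add: k_algebra_def single_add mult_single)

lemma alg_eval_hom:
  fixes s :: "'k::field \<Rightarrow> 'r::comm_ring" and \<chi> :: "'m::comm_monoid_add \<Rightarrow> 'r"
  assumes s: "\<And>c d. s (c + d) = s c + s d" "\<And>c d. s (c * d) = s c * s d"
    and \<chi>: "\<And>c. s c * \<chi> 0 = s c" "\<And>m n. \<chi> (m + n) = \<chi> m * \<chi> n"
  shows "alg_eval s \<chi> \<in> alg_homs (Poly_Mapping.single 0) s"
  unfolding alg_homs_def using s \<chi>
  by (auto simp: alg_eval_add[of s] alg_eval_mult alg_eval_single[of s])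

type_synonym 'k mpoly = "(nat \<Rightarrow>\<^sub>0 nat) \<Rightarrow>\<^sub>0 'k"

definition var :: "nat \<Rightarrow> 'k::field mpoly" where
  "var i = Poly_Mapping.single (Poly_Mapping.single i 1) 1"

definition mpoly_eval :: "('k::field \<Rightarrow> 'r::{comm_ring, comm_monoid_mult}) \<Rightarrow> (nat \<Rightarrow> 'r) \<Rightarrow> 'k mpoly \<Rightarrow> 'r" where
  "mpoly_eval s v = alg_eval s (mono_eval v)"

lemma mpoly_eval_hom: "k_algebra s \<Longrightarrow> mpoly_eval s v \<in> alg_homs (Poly_Mapping.single 0) s"
  unfolding mpoly_eval_def by (rule alg_eval_hom) (auto simp: k_algebra_def mono_eval_add)

lemma mpoly_eval_single: "k_algebra s \<Longrightarrow> mpoly_eval s v (Poly_Mapping.single \<alpha> c) = s c * mono_eval v \<alpha>"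
  unfolding mpoly_eval_def by (rule alg_eval_single) (auto simp: k_algebra_def)

lemma mpoly_eval_var: "k_algebra s \<Longrightarrow> mpoly_eval s v (var i) = v i"
  by (simp add: var_def mpoly_eval_single k_algebra_def)

text \<open>
Polynomials are generated by the variables that occur in them; the index set \<open>K\<close> allows to use this for
polynomials in finitely many variables.
\<close>

lemma mpoly_generated:
  fixes B :: "'k::field mpoly set"
  assumes B: "is_subalgebra (Poly_Mapping.single 0) B"
    and K: "\<And>\<alpha>. \<alpha> \<in> Poly_Mapping.keys p \<Longrightarrow> Poly_Mapping.keys \<alpha> \<subseteq> K" and v: "\<And>i. i \<in> K \<Longrightarrow> var i \<in> B"
  shows "p \<in> B"
proof (induction p rule: poly_mapping_induct)
  case zero
  show ?case using is_subalgebraD(1)[OF B, of 0] by simp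
next
  case (single \<alpha>)
  have "Poly_Mapping.keys \<beta> \<subseteq> K \<longrightarrow> Poly_Mapping.single \<beta> 1 \<in> B" for \<beta>
  proof (induction \<beta> rule: monomial_induct)
    case zero
    show ?case using is_subalgebraD(1)[OF B, of 1] by simp
  next
    case (step i \<beta>)
    have k: "Poly_Mapping.keys (Poly_Mapping.single i 1 + \<beta>) = insert i (Poly_Mapping.keys \<beta>)"
      by (auto simp: in_keys_iff lookup_add lookup_single when_def split: if_splits)
    have "Poly_Mapping.single (Poly_Mapping.single i 1 + \<beta>) 1 = var i * Poly_Mapping.single \<beta> (1::'k)"
      by (simp add: var_def mult_single)
    then show ?case using k step v is_subalgebraD(3)[OF B] by auto
  qed
  then have "Poly_Mapping.single \<alpha> 1 \<in> B" using K single by blast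
  moreover have "Poly_Mapping.single \<alpha> (Poly_Mapping.lookup p \<alpha>) =
      Poly_Mapping.single 0 (Poly_Mapping.lookup p \<alpha>) * Poly_Mapping.single \<alpha> 1"
    by (simp add: mult_single)
  ultimately show ?case using is_subalgebraD(1,3)[OF B] by metis
qed (rule is_subalgebraD(2)[OF B])

lemma is_subalgebra_equalizer:
  "h \<in> alg_homs s s' \<Longrightarrow> h' \<in> alg_homs s s' \<Longrightarrow> is_subalgebra s {x. h x = h' x}"
  by (auto simp: is_subalgebra_def alg_homsD)

lemma mpoly_hom_eqI:
  assumes "h \<in> alg_homs (Poly_Mapping.single 0) s" "h' \<in> alg_homs (Poly_Mapping.single 0) s"
    and "\<And>i. h (var i) = h' (var i)"
  shows "h p = h' p"
  using mpoly_generated[OF is_subalgebra_equalizer[OF assms(1,2)], of p UNIV] assms(3) by auto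

lemma alg_homs_comp: "h \<in> alg_homs s s' \<Longrightarrow> h' \<in> alg_homs s' s'' \<Longrightarrow> (\<lambda>x. h' (h x)) \<in> alg_homs s s''"
  by (auto simp: alg_homs_def)

lemma is_subalgebra_vimage:
  "h \<in> alg_homs s s' \<Longrightarrow> is_subalgebra s' B \<Longrightarrow> is_subalgebra s {x. h x \<in> B}"
  by (auto simp: is_subalgebra_def alg_homsD)

lemma is_subalgebra_image:
  assumes h: "h \<in> alg_homs s s'" and B: "is_subalgebra s B"
  shows "is_subalgebra s' (h ` B)"
proof (rule is_subalgebraI)
  show "s' c \<in> h ` B" for c using is_subalgebraD(1)[OF B, of c] alg_homsD(3)[OF h, of c] by (metis imageI)
  fix x y assume "x \<in> h ` B" "y \<in> h ` B"
  then obtain u v where "x = h u" "y = h v" "u \<in> B" "v \<in> B" by blast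
  then show "x + y \<in> h ` B" "x * y \<in> h ` B"
    using is_subalgebraD(2,3)[OF B, of u v] by (auto simp flip: alg_homsD(1,2)[OF h])
qed

lemma homogeneous_mpoly_eval:
  assumes v: "\<And>i. homogeneous (weight d) (d i) (v i :: 'k::field mpoly)"
    and p: "homogeneous (weight d) n p"
  shows "homogeneous (weight d) n (mpoly_eval (Poly_Mapping.single 0) v p)"
proof -
  have "homogeneous (weight d) (weight d \<alpha>) (mono_eval v \<alpha>)" for \<alpha>
  proof (induction \<alpha> rule: monomial_induct)
    case zero
    show ?case by (simp add: homogeneous_def)
  next
    case (step i \<alpha>)
    then show ?case using homogeneous_mult[OF weight_add v[of i] step]
      by (simp add: mono_eval_add weight_add)
  qed
  then have "homogeneous (weight d) (0 + n) (Poly_Mapping.single 0 c * mono_eval v \<alpha>)"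
    if "\<alpha> \<in> Poly_Mapping.keys p" for \<alpha> c
    using p that by (intro homogeneous_mult weight_add homogeneous_single) (auto simp: homogeneous_def)
  then show ?thesis by (auto simp: mpoly_eval_def alg_eval_def intro!: homogeneous_sum)
qed

text \<open>
Used for squares of ideals: the products of two elements generate the square as an additive monoid
already.
\<close>

definition add_span :: "'a::comm_monoid_add set \<Rightarrow> 'a set" where
  "add_span B = (\<lambda>T. 0 \<in> T \<and> (\<forall>x\<in>T. \<forall>y\<in>T. x + y \<in> T)) hull B"

lemma add_span_zero: "0 \<in> add_span B" and add_span_add: "x \<in> add_span B \<Longrightarrow> y \<in> add_span B \<Longrightarrow> x + y \<in> add_span B"
  and add_span_inc: "x \<in> B \<Longrightarrow> x \<in> add_span B"
  by (auto simp: add_span_def hull_def)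

lemma add_span_sum: "(\<And>i. i \<in> I \<Longrightarrow> f i \<in> add_span B) \<Longrightarrow> sum f I \<in> add_span B"
  by (induction I rule: infinite_finite_induct) (auto intro: add_span_zero add_span_add)

lemma add_span_induct [consumes 1, case_names zero base add]:
  assumes "x \<in> add_span B" "P 0" "\<And>x. x \<in> B \<Longrightarrow> P x" "\<And>x y. P x \<Longrightarrow> P y \<Longrightarrow> P (x + y)"
  shows "P x"
proof -
  have "add_span B \<subseteq> {x. P x}" unfolding add_span_def by (rule hull_minimal) (use assms in auto)
  with assms(1) show ?thesis by auto
qed

section \<open>The grading of the coordinate ring\<close>

lemma Gm_actionD:
  fixes sA :: "'k::field \<Rightarrow> 'a::{comm_ring, comm_monoid_mult}"
  assumes "Gm_action sA \<rho>"
  shows "\<rho> \<in> alg_homs sA (\<lambda>c. Poly_Mapping.single 0 (sA c))"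
    and "\<rho> (Poly_Mapping.lookup (\<rho> a) n) = Poly_Mapping.single n (Poly_Mapping.lookup (\<rho> a) n)"
    and "a = (\<Sum>n\<in>Poly_Mapping.keys (\<rho> a). Poly_Mapping.lookup (\<rho> a) n)"
proof -
  show hom: "\<rho> \<in> alg_homs sA (\<lambda>c. Poly_Mapping.single 0 (sA c))"
    using assms by (simp add: Gm_action_def)
  show "a = (\<Sum>n\<in>Poly_Mapping.keys (\<rho> a). Poly_Mapping.lookup (\<rho> a) n)"
    using assms by (simp add: Gm_action_def)
  have eq: "Poly_Mapping.map \<rho> (\<rho> a) =
        (\<Sum>n \<in> Poly_Mapping.keys (\<rho> a).
           Poly_Mapping.single n (Poly_Mapping.single n (Poly_Mapping.lookup (\<rho> a) n)))"
    using assms by (simp add: Gm_action_def)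
  have "Poly_Mapping.lookup (Poly_Mapping.map \<rho> (\<rho> a)) n = \<rho> (Poly_Mapping.lookup (\<rho> a) n)"
    using alg_homsD(4)[OF hom] by (simp add: Poly_Mapping.map.rep_eq when_def)
  moreover have "Poly_Mapping.lookup (\<Sum>n \<in> Poly_Mapping.keys (\<rho> a).
           Poly_Mapping.single n (Poly_Mapping.single n (Poly_Mapping.lookup (\<rho> a) n))) n =
     Poly_Mapping.single n (Poly_Mapping.lookup (\<rho> a) n)"
    by (auto simp: lookup_sum lookup_single when_def sum.delta in_keys_iff)
  ultimately show "\<rho> (Poly_Mapping.lookup (\<rho> a) n) = Poly_Mapping.single n (Poly_Mapping.lookup (\<rho> a) n)"
    using eq by simp
qed

lemma Gm_action_monomial:
  fixes sA :: "'k::field \<Rightarrow> 'a::{comm_ring, comm_monoid_mult}"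
  assumes sA: "k_algebra sA" and \<rho>: "\<rho> \<in> alg_homs sA (\<lambda>c. Poly_Mapping.single 0 (sA c))"
    and a: "\<And>i. \<rho> (a i) = Poly_Mapping.single (d i) (a i)"
  shows "\<rho> (mono_eval a \<alpha>) = Poly_Mapping.single (weight d \<alpha>) (mono_eval a \<alpha>)"
proof (induction \<alpha> rule: monomial_induct)
  case zero
  show ?case using alg_homsD(3)[OF \<rho>, of 1] sA by (simp add: k_algebra_def)
next
  case (step i \<alpha>)
  then show ?case by (simp add: mono_eval_add weight_add alg_homsD(2)[OF \<rho>] a mult_single)
qed

text \<open>
Evaluation at homogeneous elements is a graded homomorphism; in particular its kernel is a homogeneous
ideal.
\<close>

lemma Gm_action_mpoly_eval:
  fixes sA :: "'k::field \<Rightarrow> 'a::{comm_ring, comm_monoid_mult}"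
  assumes sA: "k_algebra sA" and \<rho>: "\<rho> \<in> alg_homs sA (\<lambda>c. Poly_Mapping.single 0 (sA c))"
    and a: "\<And>i. \<rho> (a i) = Poly_Mapping.single (d i) (a i)"
  shows "Poly_Mapping.lookup (\<rho> (mpoly_eval sA a p)) n = mpoly_eval sA a (component (weight d) n p)"
proof (induction p rule: poly_mapping_induct)
  case zero
  show ?case using alg_homsD(4)[OF mpoly_eval_hom[OF sA]] alg_homsD(4)[OF \<rho>] by simp
next
  case (single \<alpha>)
  have "homogeneous (weight d) (weight d \<alpha>) (Poly_Mapping.single \<alpha> (Poly_Mapping.lookup p \<alpha>))"
    by (rule homogeneous_single) simp
  from component_of_homogeneous[OF this, of n] alg_homsD(4)[OF mpoly_eval_hom[OF sA]]
  show ?case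
    by (auto simp: mpoly_eval_single[OF sA] alg_homsD[OF \<rho>] Gm_action_monomial[OF assms] mult_single
        lookup_single when_def)
next
  case (add p q)
  then show ?case
    by (simp add: alg_homsD(1)[OF mpoly_eval_hom[OF sA]] alg_homsD(1)[OF \<rho>] lookup_add component_add)
qed

definition vars_below :: "nat \<Rightarrow> 'k::field mpoly set" where
  "vars_below m = {p. \<forall>\<alpha>\<in>Poly_Mapping.keys p. Poly_Mapping.keys \<alpha> \<subseteq> {..<m}}"

lemma is_subalgebra_vars_below: "is_subalgebra (Poly_Mapping.single 0) (vars_below m :: 'k::field mpoly set)"
proof (rule is_subalgebraI)
  show "Poly_Mapping.single 0 c \<in> vars_below m" for c :: 'k by (auto simp: vars_below_def split: if_splits)
  fix p q :: "'k mpoly" assume pq: "p \<in> vars_below m" "q \<in> vars_below m"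
  show "p + q \<in> vars_below m" using pq Poly_Mapping.keys_add[of p q] by (auto simp: vars_below_def)
  show "p * q \<in> vars_below m" 
    using pq keys_mult[of p q] Poly_Mapping.keys_add
    by (force simp: vars_below_def)
qed

lemma var_vars_below: "i < m \<Longrightarrow> var i \<in> vars_below m"
  by (auto simp: vars_below_def var_def)

lemma homogeneous_var: "homogeneous (weight d) (d i) (var i)"
  unfolding var_def by (rule homogeneous_single) simp

lemma mpoly_eval_mem_subalgebra:
  assumes s: "k_algebra s" and B: "is_subalgebra s B" and v: "\<And>i. v i \<in> B"
  shows "mpoly_eval s v p \<in> B"
  using mpoly_generated[OF is_subalgebra_vimage[OF mpoly_eval_hom[OF s] B], of p UNIV v] v
  by (auto simp: mpoly_eval_var[OF s])

lemma component_vars_below: "p \<in> vars_below m \<Longrightarrow> component \<delta> n p \<in> vars_below m"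
  by (auto simp: vars_below_def keys_component)

section \<open>A graded lift to the square of the ideal of relations\<close>

lemma quot_homs_coset: "f \<in> quot_homs s s' I \<Longrightarrow> \<exists>x. f a = coset I x"
  unfolding quot_homs_def by blast

lemma quot_homs_mem_iff:
  assumes I: "is_ideal I" and f: "f \<in> quot_homs s s' I" and x: "x \<in> f a"
  shows "y \<in> f a \<longleftrightarrow> y - x \<in> I"
proof -
  obtain z where z: "f a = coset I z" using quot_homs_coset[OF f] by blast
  have D: "u - v \<in> I" if "u \<in> I" "v \<in> I" for u v using I that by (auto simp: is_ideal_def)
  have I0: "0 \<in> I" using I by (auto simp: is_ideal_def)
  from x z have xz: "x - z \<in> I" by (simp add: coset_def)
  show ?thesis
  proof
    assume "y \<in> f a"
    then have "(y - z) - (x - z) \<in> I" using xz z by (intro D[of "y - z" "x - z"]) (simp_all add: coset_def)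
    then show "y - x \<in> I" by simp
  next
    assume "y - x \<in> I"
    then have "(y - x) - (0 - (x - z)) \<in> I" using D[OF _ D[OF I0 xz]] by blast
    then show "y \<in> f a" using z by (simp add: coset_def)
  qed
qed

lemma quot_homsD:
  assumes "f \<in> quot_homs s s' I"
  shows "x \<in> f a \<Longrightarrow> y \<in> f b \<Longrightarrow> x + y \<in> f (a + b)" "x \<in> f a \<Longrightarrow> y \<in> f b \<Longrightarrow> x * y \<in> f (a * b)"
    "s' c \<in> f (s c)"
  using assms by (auto simp: quot_homs_def)

lemma quot_homs_nonempty:
  assumes "is_ideal I" "f \<in> quot_homs s s' I" shows "\<exists>x. x \<in> f a"
proof -
  obtain z where z: "f a = coset I z" using quot_homs_coset[OF assms(2)] by blast
  have "z \<in> f a" unfolding z coset_def using assms(1) by (simp add: is_ideal_def)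
  then show ?thesis ..
qed

definition products :: "'a::times set \<Rightarrow> 'a set" where
  "products B = {f * g |f g. f \<in> B \<and> g \<in> B}"

lemma is_ideal_square:
  fixes M :: "'a::comm_ring_1 set"
  assumes M: "is_ideal M"
  shows "is_ideal (add_span (products M))"
proof -
  let ?P = "products M"
  have q: "q * x \<in> add_span ?P" if "x \<in> add_span ?P" for q x
    using that
  proof (induction rule: add_span_induct)
    case (base x)
    then obtain f g where fg: "x = f * g" "f \<in> M" "g \<in> M" by (auto simp: products_def)
    then have "q * f \<in> M" using M by (auto simp: is_ideal_def)
    moreover have "q * x = (q * f) * g" using fg by (simp add: mult_ac)
    ultimately show ?case using fg(3) unfolding products_def by (intro add_span_inc) blast
  qed (auto simp: distrib_left intro: add_span_zero add_span_add)
  have "x - y \<in> add_span ?P" if "x \<in> add_span ?P" "y \<in> add_span ?P" for x y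
    using add_span_add[OF that(1) q[OF that(2), of "-1"]] by simp
  with q show ?thesis by (auto simp: is_ideal_def add_span_zero)
qed

text \<open>
The degree \<open>n\<close> part of the ideal of relations between the first \<open>m\<close> generators.
\<close>

definition hom_kernel :: "('k::field mpoly \<Rightarrow> 'a::zero) \<Rightarrow> (nat \<Rightarrow> int) \<Rightarrow> nat \<Rightarrow> int \<Rightarrow> 'k mpoly set" where
  "hom_kernel ev d m n = {f \<in> vars_below m. homogeneous (weight d) n f \<and> ev f = 0}"

text \<open>
Let \<open>M\<close> be the kernel of \<open>k[x\<^sub>0, x\<^sub>1, \<dots>] \<rightarrow> A\<close>. Formal smoothness lifts the identity of \<open>A = P/M\<close> to \<open>A \<rightarrow> P/M\<^sup>2\<close>, that
is, it gives an endomorphism \<open>s\<^sub>0\<close> of \<open>P\<close> that is the identity modulo \<open>M\<close> and maps \<open>M\<close> into \<open>M\<^sup>2\<close>. Replacing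
\<open>s\<^sub>0 x\<^sub>i\<close> by its component of degree \<open>d\<^sub>i\<close> makes it graded. This does not spoil the second property: on
homogeneous elements of degree \<open>n\<close>, taking the degree \<open>n\<close> component of \<open>s\<^sub>0\<close> is multiplicative modulo \<open>M\<^sup>2\<close>,
because all other components lie in \<open>M\<close>, and a product of two of those lies in \<open>M\<^sup>2\<close>. Finally the variables
\<open>x\<^sub>i\<close> with \<open>i \<ge> m\<close>, which are relations themselves, are set to zero.
\<close>

theorem equivariant_contraction:
  fixes sA :: "'k::field \<Rightarrow> 'a::{comm_ring, comm_monoid_mult}"
  assumes sA: "k_algebra sA" and smooth: "formally_smooth sA"
    and \<rho>: "\<rho> \<in> alg_homs sA (\<lambda>c. Poly_Mapping.single 0 (sA c))"
    and a: "\<And>i. \<rho> (a i) = Poly_Mapping.single (d i) (a i)"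
    and am: "\<And>i. i \<ge> m \<Longrightarrow> a i = 0"
    and surj: "surj (mpoly_eval sA a)"
  shows "\<exists>v. (\<forall>i. homogeneous (weight d) (d i) (v i) \<and> v i \<in> vars_below m \<and> mpoly_eval sA a (v i) = a i) \<and>
    (\<forall>n p. p \<in> hom_kernel (mpoly_eval sA a) d m n \<longrightarrow>
       mpoly_eval (Poly_Mapping.single 0) v p \<in> add_span (\<Union>i. {f * g |f g.
         f \<in> hom_kernel (mpoly_eval sA a) d m i \<and> g \<in> hom_kernel (mpoly_eval sA a) d m (n - i)}))"
proof -
  let ?c = "Poly_Mapping.single 0 :: 'k \<Rightarrow> 'k mpoly"
  note c = k_algebra_single_0
  define ev where "ev = mpoly_eval sA a"
  have ev: "ev \<in> alg_homs ?c sA" unfolding ev_def by (rule mpoly_eval_hom[OF sA])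
  note evD = alg_homsD[OF ev]
  have ev_comp: "ev (component (weight d) n p) = Poly_Mapping.lookup (\<rho> (ev p)) n" for n p
    unfolding ev_def by (rule Gm_action_mpoly_eval[OF sA \<rho> a, symmetric])
  define M where "M = {p. ev p = 0}"
  have M: "is_ideal M" by (auto simp: is_ideal_def M_def evD)
  have M_comp: "component (weight d) n p \<in> M" if "p \<in> M" for n p
    using that alg_homsD(4)[OF \<rho>] by (simp add: M_def ev_comp)
  define M2 where "M2 = add_span (products M)"
  have M2: "is_ideal M2" unfolding M2_def by (rule is_ideal_square[OF M])
  have M2_0: "0 \<in> M2" and M2_diff: "\<And>x y. x \<in> M2 \<Longrightarrow> y \<in> M2 \<Longrightarrow> x - y \<in> M2"
    and M2_mult: "\<And>x q. x \<in> M2 \<Longrightarrow> q * x \<in> M2"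
    using M2 by (auto simp: is_ideal_def)
  have M2_add: "x + y \<in> M2" if "x \<in> M2" "y \<in> M2" for x y
    using that add_span_add by (auto simp: M2_def)
  have MM: "x * y \<in> M2" if "x \<in> M" "y \<in> M" for x y
    using that by (auto simp: M2_def products_def intro!: add_span_inc)
  have M2M: "M2 \<subseteq> M"
  proof
    fix x assume "x \<in> M2"
    then show "x \<in> M" unfolding M2_def
    proof (induction rule: add_span_induct)
      case (base x) then show ?case by (auto simp: products_def M_def evD)
    qed (auto simp: M_def evD)
  qed

  have comp_mult: "component (weight d) (i + j) (p * q) = p * component (weight d) j q"
    if "homogeneous (weight d) i p" for i j and p q :: "'k mpoly"
    by (rule component_mult_homogeneous[OF weight_add that])

  \<comment> \<open>The identity of \<open>A\<close>, regarded as a homomorphism \<open>A \<rightarrow> P/M\<close>.\<close>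
  define g where "g b = {p. ev p = b}" for b
  have g: "g \<in> quot_homs sA ?c M"
  proof -
    have "\<exists>x. g b = coset M x" for b
    proof -
      from surj obtain x where "ev x = b" unfolding ev_def surj_def by metis
      then have "g b = coset M x" by (auto simp: g_def coset_def M_def evD)
      then show ?thesis ..
    qed
    then show ?thesis by (auto simp: quot_homs_def g_def evD)
  qed
  obtain h where h: "h \<in> quot_homs sA ?c M2" and hg: "\<And>b. h b \<subseteq> g b"
  proof -
    have "\<forall>x\<in>M. \<forall>y\<in>M. x * y \<in> M2" using MM by blast
    then have "\<exists>h\<in>quot_homs sA ?c M2. \<forall>b. h b \<subseteq> g b"
      using smooth M2 M M2M g unfolding formally_smooth_def by simp
    then show ?thesis using that by blast
  qed
  note hD = quot_homsD[OF h]
  have h_iff: "y \<in> h b \<longleftrightarrow> y - x \<in> M2" if "x \<in> h b" for x y b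
    by (rule quot_homs_mem_iff[OF M2 h that])
  have "\<exists>w. \<forall>i. w i \<in> h (a i)" using quot_homs_nonempty[OF M2 h] by (intro choice allI)
  then obtain w where w: "\<And>i. w i \<in> h (a i)" by blast
  define s0 where "s0 = mpoly_eval ?c w"
  have s0: "s0 \<in> alg_homs ?c ?c" unfolding s0_def by (rule mpoly_eval_hom[OF c])
  note s0D = alg_homsD[OF s0]
  have s0h: "s0 p \<in> h (ev p)" for p
  proof -
    have "is_subalgebra ?c {p. s0 p \<in> h (ev p)}"
      by (rule is_subalgebraI) (auto simp: s0D evD intro: hD)
    from mpoly_generated[OF this, of p UNIV] show ?thesis
      using w by (auto simp: s0_def ev_def mpoly_eval_var[OF c] mpoly_eval_var[OF sA])
  qed
  have ev_s0: "ev (s0 p) = ev p" for p using s0h hg by (auto simp: g_def)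
  have s0M: "s0 p \<in> M2" if "p \<in> M" for p
  proof -
    have "ev 0 = 0" by (rule evD)
    then have "0 \<in> h 0" using s0h[of 0] by (simp add: s0D)
    from h_iff[OF this] s0h[of p] that show ?thesis by (simp add: M_def)
  qed

  \<comment> \<open>The graded modification \<open>s1\<close> of \<open>s0\<close>.\<close>
  define w' where "w' i = component (weight d) (d i) (w i)" for i
  define s1 where "s1 = mpoly_eval ?c w'"
  have s1: "s1 \<in> alg_homs ?c ?c" unfolding s1_def by (rule mpoly_eval_hom[OF c])
  note s1D = alg_homsD[OF s1]
  have ev_w: "ev (w i) = a i" for i using ev_s0[of "var i"]
    by (simp add: s0_def ev_def mpoly_eval_var[OF c] mpoly_eval_var[OF sA])
  have ev_w': "ev (w' i) = a i" for i by (simp add: w'_def ev_comp ev_w a)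
  have hom_w': "homogeneous (weight d) (d i) (w' i)" for i unfolding w'_def by (rule homogeneous_component)
  have M_rest: "x - component (weight d) n x \<in> M" if "\<rho> (ev x) = Poly_Mapping.single n (ev x)" for x n
    using that by (simp add: M_def evD ev_comp)
  have M2_comp: "component (weight d) n x \<in> add_span (\<Union>i. {f * g |f g.
      (f \<in> M \<and> homogeneous (weight d) i f) \<and> (g \<in> M \<and> homogeneous (weight d) (n - i) g)})"
    (is "_ \<in> add_span (?Q n)") if "x \<in> M2" for x n
    using that unfolding M2_def
  proof (induction rule: add_span_induct)
    case zero
    show ?case by (simp add: add_span_zero)
  next
    case (base x)
    then obtain f g where fg: "x = f * g" "f \<in> M" "g \<in> M" by (auto simp: products_def)
    have "component (weight d) n (component (weight d) i f * g) =
        component (weight d) i f * component (weight d) (n - i) g" for i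
      using comp_mult[of i "component (weight d) i f" "n - i" g, OF homogeneous_component] by simp
    then have "component (weight d) n x =
        (\<Sum>i\<in>weight d ` Poly_Mapping.keys f. component (weight d) i f * component (weight d) (n - i) g)"
      by (subst (1) fg(1), subst (1) sum_components[of f "weight d"])
         (simp add: sum_distrib_right component_sum)
    also have "\<dots> \<in> add_span (?Q n)"
    proof (intro add_span_sum add_span_inc)
      fix i
      have "component (weight d) i f \<in> M" "component (weight d) (n - i) g \<in> M" using fg M_comp by auto
      then show "component (weight d) i f * component (weight d) (n - i) g \<in> ?Q n"
        by (intro UN_I[of i] UNIV_I CollectI exI[of _ "component (weight d) i f"]
            exI[of _ "component (weight d) (n - i) g"] conjI refl homogeneous_component)
    qed
    finally show ?case .
  next
    case (add x y)
    then show ?case by (simp add: component_add add_span_add)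
  qed
  have QM2: "x \<in> M2" if "x \<in> add_span (?Q n)" for x n
    using that
  proof (induction rule: add_span_induct)
    case (base x) then show ?case using MM by blast
  qed (use M2_0 M2_add in auto)
  \<comment> \<open>The graded endomorphism agrees modulo \<open>M\<^sup>2\<close> with the degree-preserving part of \<open>s0\<close>.\<close>
  have key: "mono_eval w' \<alpha> - component (weight d) (weight d \<alpha>) (mono_eval w \<alpha>) \<in> M2" for \<alpha>
  proof (induction \<alpha> rule: monomial_induct)
    case zero
    have "component (weight d) 0 1 = (1 :: 'k mpoly)"
      by (subst component_of_homogeneous[of _ 0]) (auto simp: homogeneous_def)
    then show ?case using M2_0 by simp
  next
    case (step i \<alpha>)
    define e where "e = weight d \<alpha>"
    define y where "y = mono_eval w \<alpha>"
    define y' where "y' = component (weight d) e y"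
    \<comment> \<open>Both factors differ from their main components by elements of \<open>M\<close>; the degree \<open>d i + e\<close> component of the
      product of the two differences compares the two sides.\<close>
    have "w i - w' i \<in> M" by (simp add: M_def evD ev_w ev_w')
    moreover have "y - y' \<in> M"
    proof -
      have "y = s0 (Poly_Mapping.single \<alpha> 1)" by (simp add: y_def s0_def mpoly_eval_single[OF c])
      then have "ev y = mono_eval a \<alpha>" using sA ev_s0 by (simp add: ev_def mpoly_eval_single[OF sA] k_algebra_def)
      then show ?thesis unfolding y'_def e_def
        by (intro M_rest) (simp add: Gm_action_monomial[OF sA \<rho> a])
    qed
    ultimately have "component (weight d) (d i + e) ((w i - w' i) * (y - y')) \<in> M2"
      using MM M2_comp QM2 by blast
    moreover have "component (weight d) (d i + e) ((w i - w' i) * (y - y')) =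
        component (weight d) (d i + e) (w i * y) - w' i * y'"
    proof -
      have 1: "component (weight d) (d i + e) (w' i * y) = w' i * y'"
        unfolding y'_def by (rule comp_mult[OF hom_w'])
      have 2: "component (weight d) (d i + e) (w i * y') = w' i * y'"
        using comp_mult[of e "component (weight d) e y" "d i" "w i", OF homogeneous_component]
        unfolding y'_def w'_def by (simp add: mult.commute add.commute)
      have 3: "component (weight d) (d i + e) (w' i * y') = w' i * y'"
        using component_of_homogeneous[OF homogeneous_mult[OF weight_add hom_w' homogeneous_component]]
        unfolding y'_def by fastforce
      have "(w i - w' i) * (y - y') = w i * y - w' i * y - (w i * y' - w' i * y')"
        by (simp add: algebra_simps)
      then show ?thesis by (simp add: component_diff 1 2 3)
    qed
    ultimately have *: "component (weight d) (d i + e) (w i * y) - w' i * y' \<in> M2" by simp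
    have "w' i * (mono_eval w' \<alpha> - y') - (component (weight d) (d i + e) (w i * y) - w' i * y') \<in> M2"
      using step by (intro M2_diff[OF M2_mult *]) (simp add: y'_def y_def e_def)
    then show ?case by (simp add: mono_eval_add weight_add e_def y_def algebra_simps)
  qed
  have key': "s1 p - component (weight d) n (s0 p) \<in> M2" if "homogeneous (weight d) n p" for n p
  proof -
    have "s1 p - component (weight d) n (s0 p) = (\<Sum>\<alpha>\<in>Poly_Mapping.keys p.
        ?c (Poly_Mapping.lookup p \<alpha>) * (mono_eval w' \<alpha> - component (weight d) n (mono_eval w \<alpha>)))"
    proof -
      have "component (weight d) n (?c z * y) = ?c z * component (weight d) n y" for z y
        using comp_mult[of 0 "?c z" n y, OF homogeneous_single] by simp
      then show ?thesis
        by (simp add: s1_def s0_def mpoly_eval_def alg_eval_def component_sum right_diff_distrib sum_subtractf)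
    qed
    also have "\<dots> \<in> M2" unfolding M2_def
    proof (rule add_span_sum)
      fix \<alpha> assume "\<alpha> \<in> Poly_Mapping.keys p"
      with that have "weight d \<alpha> = n" by (auto simp: homogeneous_def)
      with key[of \<alpha>] M2_mult show "?c (Poly_Mapping.lookup p \<alpha>) *
          (mono_eval w' \<alpha> - component (weight d) n (mono_eval w \<alpha>)) \<in> add_span (products M)"
        unfolding M2_def by blast
    qed
    finally show ?thesis .
  qed
  have s1M: "s1 p \<in> add_span (?Q n)" if p: "p \<in> M" "homogeneous (weight d) n p" for p n
  proof -
    have "component (weight d) n (s0 p) \<in> M2" using M2_comp[OF s0M[OF p(1)]] QM2 by blast
    from M2_add[OF key'[OF p(2)] this] have "s1 p \<in> M2" by simp
    moreover have "homogeneous (weight d) n (s1 p)"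
      unfolding s1_def by (rule homogeneous_mpoly_eval[OF hom_w' p(2)])
    ultimately show ?thesis using M2_comp[of "s1 p" n] component_of_homogeneous[of "weight d" n "s1 p" n] by simp
  qed

  \<comment> \<open>The retraction \<open>\<pi>\<close> onto the polynomials in the first \<open>m\<close> variables is graded and compatible with \<open>ev\<close>.\<close>
  define r where "r i = (if i < m then var i else 0 :: 'k mpoly)" for i
  define \<pi> where "\<pi> = mpoly_eval ?c r"
  have \<pi>: "\<pi> \<in> alg_homs ?c ?c" unfolding \<pi>_def by (rule mpoly_eval_hom[OF c])
  note \<pi>D = alg_homsD[OF \<pi>]
  have ev_\<pi>: "ev (\<pi> p) = ev p" for p
    by (rule mpoly_hom_eqI[OF alg_homs_comp[OF \<pi> ev] ev])
       (auto simp: \<pi>_def ev_def mpoly_eval_var[OF c] mpoly_eval_var[OF sA] r_def am alg_homsD(4)[OF mpoly_eval_hom[OF sA]])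
  have hom_\<pi>: "homogeneous (weight d) n (\<pi> p)" if "homogeneous (weight d) n p" for n p
    unfolding \<pi>_def by (rule homogeneous_mpoly_eval[OF _ that]) (auto simp: r_def homogeneous_var)
  have vars_\<pi>: "\<pi> p \<in> vars_below m" for p
    unfolding \<pi>_def
  proof (rule mpoly_eval_mem_subalgebra[OF c is_subalgebra_vars_below])
    show "r i \<in> vars_below m" for i by (auto simp: r_def var_vars_below) (simp add: vars_below_def)
  qed
  define v where "v i = \<pi> (w' i)" for i
  define Q where "Q n = (\<Union>i. {f * g |f g. f \<in> hom_kernel ev d m i \<and> g \<in> hom_kernel ev d m (n - i)})" for n
  have \<pi>_hk: "\<pi> f \<in> hom_kernel ev d m i" if "f \<in> M" "homogeneous (weight d) i f" for f i
    using that by (simp add: hom_kernel_def M_def ev_\<pi> hom_\<pi> vars_\<pi>)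
  have \<pi>Q: "\<pi> x \<in> add_span (Q n)" if "x \<in> add_span (?Q n)" for x n
    using that
  proof (induction rule: add_span_induct)
    case (base x)
    then obtain i f g where "x = f * g" "f \<in> M" "homogeneous (weight d) i f" "g \<in> M" "homogeneous (weight d) (n - i) g"
      by blast
    then have "\<pi> x = \<pi> f * \<pi> g" "\<pi> f \<in> hom_kernel ev d m i" "\<pi> g \<in> hom_kernel ev d m (n - i)"
      using \<pi>_hk by (auto simp: \<pi>D)
    then show ?case unfolding Q_def by (intro add_span_inc) blast
  qed (auto simp: \<pi>D add_span_zero intro: add_span_add)
  have "mpoly_eval ?c v p = \<pi> (s1 p)" for p
    by (rule mpoly_hom_eqI[OF mpoly_eval_hom[OF c] alg_homs_comp[OF s1 \<pi>]])
       (simp add: s1_def mpoly_eval_var[OF c] v_def)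
  then have "mpoly_eval ?c v p \<in> add_span (Q n)" if "p \<in> hom_kernel ev d m n" for p n
    using \<pi>Q[OF s1M] that by (simp add: hom_kernel_def M_def)
  moreover have "homogeneous (weight d) (d i) (v i) \<and> v i \<in> vars_below m \<and> ev (v i) = a i" for i
    by (simp add: v_def ev_\<pi> ev_w' vars_\<pi> hom_\<pi>[OF hom_w'])
  ultimately show ?thesis unfolding Q_def ev_def by blast
qed

section \<open>Functions on the space of equivariant maps to affine space\<close>

text \<open>
The ring \<open>k[x\<^sub>0, x\<^sub>1, \<dots>][u, u\<inverse>]\<close> as a single monoid algebra. It is the ring of functions on \<open>G\<^sub>m \<times> W\<close>, \<open>W\<close> an affine
space with coordinates \<open>x\<^sub>i\<close>; \<open>emb\<close> and \<open>coact\<close> are the comorphisms of projection and action.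
\<close>

type_synonym 'k laurent = "(int \<times> (nat \<Rightarrow>\<^sub>0 nat)) \<Rightarrow>\<^sub>0 'k"

definition upow :: "int \<Rightarrow> 'k::field laurent" where
  "upow n = Poly_Mapping.single (n, 0) 1"

definition emb :: "'k::field mpoly \<Rightarrow> 'k laurent" where
  "emb = alg_eval (Poly_Mapping.single 0) (\<lambda>\<alpha>. Poly_Mapping.single (0, \<alpha>) 1)"

definition coact :: "(nat \<Rightarrow> int) \<Rightarrow> 'k::field mpoly \<Rightarrow> 'k laurent" where
  "coact d = alg_eval (Poly_Mapping.single 0) (\<lambda>\<alpha>. Poly_Mapping.single (weight d \<alpha>, \<alpha>) 1)"

lemma upow_mult: "upow m * upow n = upow (m + n)"
  by (simp add: upow_def mult_single)

lemma upow_0 [simp]: "upow 0 = 1"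
  by (simp add: upow_def flip: zero_prod_def)

lemma zero_pair [simp]: "(0::'a::zero, 0::'b::zero) = 0"
  by (simp add: zero_prod_def)

lemma case_prod_zero [simp]: "(case 0 of (a, b) \<Rightarrow> f a b) = f 0 0"
  by (simp add: zero_prod_def del: zero_pair)

lemma emb_hom: "emb \<in> alg_homs (Poly_Mapping.single 0) (Poly_Mapping.single 0)"
  unfolding emb_def by (rule alg_eval_hom) (auto simp: single_add mult_single)

lemma coact_hom: "coact d \<in> alg_homs (Poly_Mapping.single 0) (Poly_Mapping.single 0)"
  unfolding coact_def by (rule alg_eval_hom) (auto simp: single_add mult_single weight_add)

lemma emb_single: "emb (Poly_Mapping.single \<alpha> a) = Poly_Mapping.single (0, \<alpha>) a"
  unfolding emb_def by (subst alg_eval_single) (auto simp: single_add mult_single)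

lemma coact_single: "coact d (Poly_Mapping.single \<alpha> a) = Poly_Mapping.single (weight d \<alpha>, \<alpha>) a"
  unfolding coact_def by (subst alg_eval_single) (auto simp: single_add mult_single)

lemma upow_emb_single: "upow n * emb (Poly_Mapping.single \<alpha> a) = Poly_Mapping.single (n, \<alpha>) a"
  by (simp add: emb_single upow_def mult_single)

lemma coact_homogeneous:
  assumes "homogeneous (weight d) n p" shows "coact d p = upow n * emb p"
proof -
  have "coact d p = (\<Sum>\<alpha>\<in>Poly_Mapping.keys p. coact d (Poly_Mapping.single \<alpha> (Poly_Mapping.lookup p \<alpha>)))"
    by (subst poly_mapping_sum_singles) (rule alg_homs_sum[OF coact_hom])
  also have "\<dots> = (\<Sum>\<alpha>\<in>Poly_Mapping.keys p. upow n * emb (Poly_Mapping.single \<alpha> (Poly_Mapping.lookup p \<alpha>)))"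
    using assms by (intro sum.cong) (auto simp: coact_single upow_emb_single homogeneous_def)
  also have "\<dots> = upow n * emb p"
    by (subst (3) poly_mapping_sum_singles) (simp add: sum_distrib_left alg_homs_sum[OF emb_hom])
  finally show ?thesis .
qed

lemma laurent_slices:
  fixes x :: "'k::field laurent"
  shows "x = (\<Sum>n\<in>fst ` Poly_Mapping.keys x. upow n * emb (Poly_Mapping.map_key (Pair n) x))"
proof (rule poly_mapping_eqI)
  have inj: "inj (Pair n)" for n :: int by (auto simp: inj_def)
  have emb: "upow n * emb f = (\<Sum>\<alpha>\<in>Poly_Mapping.keys f. Poly_Mapping.single (n, \<alpha>) (Poly_Mapping.lookup f \<alpha>))"
    for n and f :: "'k mpoly"
    by (subst poly_mapping_sum_singles[of f])
       (simp add: alg_homs_sum[OF emb_hom] sum_distrib_left upow_emb_single)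
  have "Poly_Mapping.lookup (upow n * emb (Poly_Mapping.map_key (Pair n) x)) (k, \<alpha>) =
      (if n = k then Poly_Mapping.lookup x (k, \<alpha>) else 0)" for n k \<alpha>
  proof -
    have "Poly_Mapping.lookup (upow n * emb (Poly_Mapping.map_key (Pair n) x)) (k, \<alpha>) =
      (\<Sum>\<beta>\<in>Poly_Mapping.keys (Poly_Mapping.map_key (Pair n) x).
         if \<beta> = \<alpha> then (if n = k then Poly_Mapping.lookup x (n, \<beta>) else 0) else 0)"
      unfolding emb lookup_sum
      by (intro sum.cong) (auto simp: lookup_single when_def map_key.rep_eq[OF inj])
    also have "\<dots> = (if n = k then Poly_Mapping.lookup x (k, \<alpha>) else 0)"
      by (auto simp: sum.delta in_keys_iff map_key.rep_eq[OF inj])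
    finally show ?thesis .
  qed
  then show "Poly_Mapping.lookup x k\<alpha> =
    Poly_Mapping.lookup (\<Sum>n\<in>fst ` Poly_Mapping.keys x. upow n * emb (Poly_Mapping.map_key (Pair n) x)) k\<alpha>" for k\<alpha>
    by (cases k\<alpha>) (force simp: lookup_sum sum.delta in_keys_iff image_iff)
qed

text \<open>
An equivariant map from \<open>\<X>\<^sub>S\<close> to affine space sends the coordinate \<open>x\<^sub>i\<close> to \<open>y\<^sub>i \<tau>\<^sub>1\<^bsup>d\<^sub>i\<^esup>\<close> or to \<open>y\<^sub>i \<tau>\<^sub>2\<^bsup>-d\<^sub>i\<^esup>\<close>, so the
\<open>y\<^sub>i\<close> are coordinates on the space of these maps. Over \<open>\<tau>\<^sub>1 = 1\<close>, \<open>\<tau>\<^sub>2 = u\<close>, one has \<open>x\<^sub>i = y\<^sub>i\<close> or \<open>x\<^sub>i = u\<^bsup>-d\<^sub>i\<^esup> y\<^sub>i\<close>;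
this is how the ring generated by \<open>t\<close> and the \<open>y\<^sub>i\<close> becomes a subring of the Laurent polynomials.
\<close>

definition tilde_var :: "(nat \<Rightarrow> int) \<Rightarrow> nat \<Rightarrow> 'k::field laurent" where
  "tilde_var d i = upow (min (d i) 0) * emb (var i)"

definition tilde_ring :: "(nat \<Rightarrow> int) \<Rightarrow> nat \<Rightarrow> 'k::field laurent set" where
  "tilde_ring d m = is_subalgebra (Poly_Mapping.single 0) hull (insert (upow 1) (tilde_var d ` {..<m}))"

lemma is_subalgebra_tilde: "is_subalgebra (Poly_Mapping.single 0) (tilde_ring d m)"
  unfolding tilde_ring_def by (rule is_subalgebra_hull)

lemma subring_tilde: "subring (tilde_ring d m)"
  by (rule is_subalgebra_subring[OF k_algebra_single_0 is_subalgebra_tilde])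

lemma tilde_var_mem: "i < m \<Longrightarrow> tilde_var d i \<in> tilde_ring d m"
  unfolding tilde_ring_def by (rule hull_inc) auto

lemma tilde_ring_minimal:
  "is_subalgebra (Poly_Mapping.single 0) B \<Longrightarrow> upow 1 \<in> B \<Longrightarrow> (\<And>i. i < m \<Longrightarrow> tilde_var d i \<in> B) \<Longrightarrow>
    tilde_ring d m \<subseteq> B"
  unfolding tilde_ring_def by (rule hull_minimal) auto

lemma upow_mem: "n \<ge> 0 \<Longrightarrow> upow n \<in> tilde_ring d m"
proof -
  have "upow (int k) \<in> tilde_ring d m" for k
  proof (induction k)
    case 0 then show ?case using subringD(1)[OF subring_tilde] by simp
  next
    case (Suc k)
    have "upow 1 \<in> tilde_ring d m" unfolding tilde_ring_def by (rule hull_inc) auto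
    from subringD(4)[OF subring_tilde this Suc] show ?case by (simp add: upow_mult add.commute)
  qed
  from this[of "nat n"] show "n \<ge> 0 \<Longrightarrow> upow n \<in> tilde_ring d m" by simp
qed

text \<open>
The two sections of \<open>\<X> \<rightarrow> \<bbbA>\<^sup>1\<close> are defined over all of \<open>\<bbbA>\<^sup>1\<close>, so pulling back functions along them gives regular
functions and not just functions over \<open>u \<noteq> 0\<close>. Concretely, \<open>x\<^sub>i\<close> and \<open>u\<^bsup>d\<^sub>i\<^esup> x\<^sub>i\<close> are multiples of \<open>y\<^sub>i\<close> by
nonnegative powers of \<open>u\<close>.
\<close>

lemma emb_coact_mem:
  fixes p :: "'k::field mpoly"
  assumes p: "p \<in> vars_below m"
  shows "emb p \<in> tilde_ring d m" "coact d p \<in> tilde_ring d m"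
proof -
  have keys: "Poly_Mapping.keys \<alpha> \<subseteq> {..<m}" if "\<alpha> \<in> Poly_Mapping.keys p" for \<alpha>
    using p that by (auto simp: vars_below_def)
  have "upow n * emb (var i :: 'k mpoly) \<in> tilde_ring d m" if i: "i < m" and n: "n = 0 \<or> n = d i" for i n
  proof -
    have "upow (n - min (d i) 0) * tilde_var d i \<in> tilde_ring d m"
      by (intro subringD(4)[OF subring_tilde] upow_mem tilde_var_mem i) (use n in auto)
    then show ?thesis by (simp add: tilde_var_def upow_mult flip: mult.assoc)
  qed
  from this[of _ 0] this[of i "d i" for i]
  have v: "emb (var i :: 'k mpoly) \<in> tilde_ring d m" "coact d (var i :: 'k mpoly) \<in> tilde_ring d m" if "i < m" for i
    using that by (auto simp: coact_homogeneous[OF homogeneous_var])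
  show "emb p \<in> tilde_ring d m"
    using mpoly_generated[OF is_subalgebra_vimage[OF emb_hom is_subalgebra_tilde] keys] v by blast
  show "coact d p \<in> tilde_ring d m"
    using mpoly_generated[OF is_subalgebra_vimage[OF coact_hom is_subalgebra_tilde] keys] v by blast
qed

text \<open>
For \<open>f\<close> homogeneous of degree \<open>n\<close>, the coefficient of the power of \<open>\<tau>\<^sub>1\<close> or \<open>\<tau>\<^sub>2\<close> in the pull-back of \<open>f\<close> along the
universal equivariant map.
\<close>

definition tilde :: "int \<Rightarrow> 'k::field mpoly \<Rightarrow> 'k laurent" where
  "tilde n f = upow (min n 0) * emb f"

lemma tilde_mem:
  assumes "p \<in> vars_below m" "homogeneous (weight d) n p"
  shows "tilde n p \<in> tilde_ring d m"
  using emb_coact_mem[OF assms(1), of d] coact_homogeneous[OF assms(2)]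
  by (cases "n \<ge> 0") (auto simp: tilde_def min_def)

text \<open>
The second bound makes the exponent in \<open>tilde_eval\<close> nonnegative.
\<close>

lemma tilde_ring_keys:
  assumes x: "x \<in> tilde_ring d m" and k: "(n, \<alpha>) \<in> Poly_Mapping.keys x"
  shows "Poly_Mapping.keys \<alpha> \<subseteq> {..<m}" "n + weight (\<lambda>i. max 0 (- d i)) \<alpha> \<ge> 0"
proof -
  let ?w = "weight (\<lambda>i. max 0 (- d i))"
  let ?B = "{x :: 'a laurent. \<forall>(n, \<alpha>)\<in>Poly_Mapping.keys x. Poly_Mapping.keys \<alpha> \<subseteq> {..<m} \<and> n + ?w \<alpha> \<ge> 0}"
  have "tilde_ring d m \<subseteq> ?B"
  proof (rule tilde_ring_minimal)
    show "is_subalgebra (Poly_Mapping.single 0) ?B"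
    proof (rule is_subalgebraI)
      show "Poly_Mapping.single 0 c \<in> ?B" for c by (auto split: if_splits simp del: zero_pair simp add: zero_prod_def)
      fix p q assume p: "p \<in> ?B" and q: "q \<in> ?B"
      show "p + q \<in> ?B" using p q Poly_Mapping.keys_add[of p q] by blast
      have "Poly_Mapping.keys \<alpha> \<subseteq> {..<m} \<and> n + ?w \<alpha> \<ge> 0" if na: "(n, \<alpha>) \<in> Poly_Mapping.keys (p * q)" for n \<alpha>
      proof -
        from na keys_mult[of p q] obtain i \<beta> j \<gamma> where *: "n = i + j" "\<alpha> = \<beta> + \<gamma>"
          "(i, \<beta>) \<in> Poly_Mapping.keys p" "(j, \<gamma>) \<in> Poly_Mapping.keys q" by fastforce
        with p q have "Poly_Mapping.keys \<beta> \<subseteq> {..<m}" "i + ?w \<beta> \<ge> 0" "Poly_Mapping.keys \<gamma> \<subseteq> {..<m}" "j + ?w \<gamma> \<ge> 0"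
          by fastforce+
        then show ?thesis unfolding *(1,2) using Poly_Mapping.keys_add[of \<beta> \<gamma>]
          by (auto simp: weight_add)
      qed
      then show "p * q \<in> ?B" by blast
    qed
    show "upow 1 \<in> ?B" by (auto simp: upow_def)
    show "tilde_var d i \<in> ?B" if "i < m" for i
      using that by (auto simp: tilde_var_def var_def upow_emb_single)
  qed
  with x have "x \<in> ?B" by blast
  with k show "Poly_Mapping.keys \<alpha> \<subseteq> {..<m}" "n + ?w \<alpha> \<ge> 0" by blast+
qed

text \<open>
The ideal that cuts out the equivariant maps to \<open>Z\<close> among those to affine space: the coefficient of each
homogeneous relation has to vanish.
\<close>

definition tilde_ideal :: "('k::field mpoly \<Rightarrow> 'a::zero) \<Rightarrow> (nat \<Rightarrow> int) \<Rightarrow> nat \<Rightarrow> 'k laurent set" where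
  "tilde_ideal ev d m = ideal_of (tilde_ring d m) hull (\<Union>n. tilde n ` hom_kernel ev d m n)"

lemma tilde_mem_ideal:
  "f \<in> hom_kernel ev d m n \<Longrightarrow> tilde n f \<in> tilde_ideal ev d m"
  unfolding tilde_ideal_def by (rule hull_inc) auto

lemma tilde_ideal:
  shows "ideal_of (tilde_ring d m) (tilde_ideal ev d m)"
  unfolding tilde_ideal_def
  by (rule ideal_of_hull[OF subring_tilde]) (auto simp: hom_kernel_def intro: tilde_mem)

lemma tilde_ideal_minimal:
  assumes "ideal_of (tilde_ring d m) I" "\<And>n f. f \<in> hom_kernel ev d m n \<Longrightarrow> tilde n f \<in> I"
  shows "tilde_ideal ev d m \<subseteq> I"
  unfolding tilde_ideal_def by (rule ideal_of_hull_minimal[OF _ assms(1)]) (use assms(2) in auto)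

definition laurent_endo :: "(nat \<Rightarrow> 'k::field mpoly) \<Rightarrow> 'k laurent \<Rightarrow> 'k laurent" where
  "laurent_endo v = alg_eval (Poly_Mapping.single 0) (\<lambda>(n, \<alpha>). upow n * emb (mono_eval v \<alpha>))"

lemma emb_1: "emb 1 = 1"
  using alg_homsD(3)[OF emb_hom, of 1] by simp

lemma laurent_endo_hom:
  "laurent_endo v \<in> alg_homs (Poly_Mapping.single 0) (Poly_Mapping.single 0)"
  unfolding laurent_endo_def
proof (rule alg_eval_hom)
  show "(case p + q of (n, \<alpha>) \<Rightarrow> upow n * emb (mono_eval v \<alpha>)) =
      (case p of (n, \<alpha>) \<Rightarrow> upow n * emb (mono_eval v \<alpha>)) * (case q of (n, \<alpha>) \<Rightarrow> upow n * emb (mono_eval v \<alpha>))" for p q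
    by (cases p; cases q) (simp add: mono_eval_add alg_homsD(2)[OF emb_hom] mult_ac flip: upow_mult)
qed (auto simp: single_add mult_single emb_1)

lemma laurent_endo_single:
  "laurent_endo v (Poly_Mapping.single (n, \<alpha>) a) = Poly_Mapping.single 0 a * (upow n * emb (mono_eval v \<alpha>))"
  unfolding laurent_endo_def by (subst alg_eval_single) (auto simp: single_add)

lemma laurent_endo_upow: "laurent_endo v (upow n) = upow n"
  unfolding upow_def[of n] by (subst laurent_endo_single) (simp add: emb_1 upow_def)

lemma laurent_endo_emb: "laurent_endo v (emb p) = emb (mpoly_eval (Poly_Mapping.single 0) v p)"
  by (rule mpoly_hom_eqI[OF alg_homs_comp[OF emb_hom laurent_endo_hom] alg_homs_comp[OF mpoly_eval_hom emb_hom]])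
     (simp_all add: k_algebra_single_0 var_def emb_single laurent_endo_single mpoly_eval_single)

text \<open>
A graded endomorphism of the affine space acts on the equivariant maps into it. If it contracts the ideal of
relations, it contracts \<open>tilde_ideal\<close> too, since for homogeneous \<open>f\<close>, \<open>g\<close> of degrees \<open>i\<close>, \<open>n - i\<close> the element
\<open>tilde n (f g)\<close> is a multiple of \<open>tilde i f \<cdot> tilde (n - i) g\<close>. So \<open>torsion_free_of_contraction\<close>
applies with \<open>\<tau> = u\<^sup>N\<close>.
\<close>

theorem tilde_ideal_saturated:
  fixes ev :: "'k::field mpoly \<Rightarrow> 'a::{comm_ring, comm_monoid_mult}"
  assumes ev: "ev \<in> alg_homs (Poly_Mapping.single 0) sA"
    and v: "\<And>i. homogeneous (weight d) (d i) (v i)" "\<And>i. v i \<in> vars_below m" "\<And>i. ev (v i) = ev (var i)"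
    and contr: "\<And>n p. p \<in> hom_kernel ev d m n \<Longrightarrow>
       mpoly_eval (Poly_Mapping.single 0) v p \<in> add_span (\<Union>i. {f * g |f g.
         f \<in> hom_kernel ev d m i \<and> g \<in> hom_kernel ev d m (n - i)})"
    and x: "x \<in> tilde_ring d m" "upow (int N) * x \<in> tilde_ideal ev d m"
  shows "x \<in> tilde_ideal ev d m"
proof -
  let ?S = "tilde_ring d m :: 'k laurent set" and ?J = "tilde_ideal ev d m" and ?\<sigma> = "laurent_endo v"
  have S: "subring ?S" by (rule subring_tilde)
  note J = tilde_ideal[of d m ev]
  note \<sigma>D = alg_homsD[OF laurent_endo_hom[of v]]
  note embD = alg_homsD[OF emb_hom]
  have \<sigma>_gen: "?\<sigma> (tilde_var d i) = tilde (d i) (v i)" for i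
    by (simp add: tilde_var_def \<sigma>D laurent_endo_upow laurent_endo_emb tilde_def mpoly_eval_var k_algebra_single_0)
  have "?S \<subseteq> {x. ?\<sigma> x \<in> ?S}"
    by (rule tilde_ring_minimal)
       (auto simp: laurent_endo_upow upow_mem \<sigma>_gen intro!: tilde_mem v
         is_subalgebra_vimage[OF laurent_endo_hom is_subalgebra_tilde])
  then have \<sigma>S: "?\<sigma> x \<in> ?S" if "x \<in> ?S" for x using that by blast
  have "?S \<subseteq> {x \<in> ?S. ?\<sigma> x - x \<in> ?J}"
  proof (rule tilde_ring_minimal)
    show "is_subalgebra (Poly_Mapping.single 0) {x \<in> ?S. ?\<sigma> x - x \<in> ?J}"
    proof (rule is_subalgebraI)
      show "Poly_Mapping.single 0 c \<in> {x \<in> ?S. ?\<sigma> x - x \<in> ?J}" for c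
        using is_subalgebraD(1)[OF is_subalgebra_tilde] ideal_ofD(2)[OF J] by (simp add: \<sigma>D)
      fix x y assume xy: "x \<in> {x \<in> ?S. ?\<sigma> x - x \<in> ?J}" "y \<in> {x \<in> ?S. ?\<sigma> x - x \<in> ?J}"
      have "(?\<sigma> x - x) + (?\<sigma> y - y) \<in> ?J" using xy by (intro ideal_ofD(3)[OF J]) auto
      then show "x + y \<in> {x \<in> ?S. ?\<sigma> x - x \<in> ?J}"
        using xy subringD(6)[OF S] by (simp add: \<sigma>D algebra_simps)
      have "?\<sigma> x * (?\<sigma> y - y) + y * (?\<sigma> x - x) \<in> ?J"
        using xy \<sigma>S by (intro ideal_ofD(3)[OF J] ideal_ofD(4)[OF J]) auto
      then show "x * y \<in> {x \<in> ?S. ?\<sigma> x - x \<in> ?J}"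
        using xy subringD(4)[OF S] by (simp add: \<sigma>D algebra_simps)
    qed
    show "upow 1 \<in> {x \<in> ?S. ?\<sigma> x - x \<in> ?J}"
      using ideal_ofD(2)[OF J] by (simp add: laurent_endo_upow upow_mem)
    fix i assume i: "i < m"
    have "v i - var i \<in> vars_below m"
      using subringD(3)[OF is_subalgebra_subring[OF k_algebra_single_0 is_subalgebra_vars_below]] v(2) var_vars_below[OF i]
      by blast
    then have "v i - var i \<in> hom_kernel ev d m (d i)"
      by (simp add: hom_kernel_def alg_homsD[OF ev] v homogeneous_diff homogeneous_var)
    moreover have "?\<sigma> (tilde_var d i) - tilde_var d i = tilde (d i) (v i - var i)"
      unfolding \<sigma>_gen by (simp add: tilde_def tilde_var_def embD right_diff_distrib)
    ultimately have "?\<sigma> (tilde_var d i) - tilde_var d i \<in> ?J" by (simp add: tilde_mem_ideal)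
    then show "tilde_var d i \<in> {x \<in> ?S. ?\<sigma> x - x \<in> ?J}" using tilde_var_mem[OF i] by simp
  qed
  then have \<sigma>_id: "?\<sigma> x - x \<in> ?J" if "x \<in> ?S" for x using that by blast
  let ?J2 = "ideal_of ?S hull {a * b |a b. a \<in> ?J \<and> b \<in> ?J}"
  have J2: "ideal_of ?S ?J2"
    by (rule ideal_of_hull[OF S]) (use ideal_ofD(1)[OF J] in \<open>auto intro!: subringD(4)[OF S]\<close>)
  have "?J \<subseteq> {x \<in> ?S. ?\<sigma> x \<in> ?J2}"
  proof (rule tilde_ideal_minimal)
    show "ideal_of ?S {x \<in> ?S. ?\<sigma> x \<in> ?J2}"
      using ideal_ofD(2)[OF J2]
      by (auto simp: \<sigma>D intro!: ideal_ofI subringD[OF S] ideal_ofD(3,4)[OF J2] \<sigma>S)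
    fix n f assume f: "f \<in> hom_kernel ev d m n"
    have "upow (min n 0) * emb p \<in> ?J2"
      if "p \<in> add_span (\<Union>i. {f * g |f g. f \<in> hom_kernel ev d m i \<and> g \<in> hom_kernel ev d m (n - i)})" for p
      using that
    proof (induction rule: add_span_induct)
      case zero
      show ?case using ideal_ofD(2)[OF J2] by (simp add: embD)
    next
      case (base p)
      then obtain i f g where p: "p = f * g" "f \<in> hom_kernel ev d m i" "g \<in> hom_kernel ev d m (n - i)" by blast
      \<comment> \<open>This exponent is nonnegative because \<open>\<lambda>n. min n 0\<close> is superadditive.\<close>
      define k where "k = min n 0 - min i 0 - min (n - i) 0"
      have "upow k * (tilde i f * tilde (n - i) g) \<in> ?J2"
      proof (rule ideal_ofD(4)[OF J2])
        show "upow k \<in> ?S" by (rule upow_mem) (auto simp: k_def)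
        show "tilde i f * tilde (n - i) g \<in> ?J2"
          by (rule hull_inc) (use tilde_mem_ideal[OF p(2)] tilde_mem_ideal[OF p(3)] in blast)
      qed
      moreover have "upow (min n 0) = upow k * upow (min i 0) * (upow (min (n - i) 0) :: 'k laurent)"
        by (simp add: upow_mult k_def)
      ultimately show ?case by (simp add: p(1) tilde_def embD mult_ac)
    next
      case (add p q)
      then show ?case using ideal_ofD(3)[OF J2] by (simp add: embD distrib_left)
    qed
    from this[OF contr[OF f]] have "?\<sigma> (tilde n f) \<in> ?J2"
      by (simp add: tilde_def \<sigma>D laurent_endo_upow laurent_endo_emb)
    then show "tilde n f \<in> {x \<in> ?S. ?\<sigma> x \<in> ?J2}" using f by (auto simp: hom_kernel_def intro: tilde_mem)
  qed
  then have \<sigma>J: "?\<sigma> x \<in> ?J2" if "x \<in> ?J" for x using that by blast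
  show ?thesis
  proof (rule torsion_free_of_contraction[OF k_algebra_single_0 _ tilde_ring_def J, of ?\<sigma> "upow (int N)"])
    show "x = 0" if "upow (int N) * x = 0" for x :: "'k laurent"
    proof -
      have "x = upow (- int N) * (upow (int N) * x)" by (simp add: upow_mult flip: mult.assoc)
      with that show ?thesis by simp
    qed
  qed (use \<sigma>D \<sigma>S \<sigma>_id \<sigma>J x in \<open>auto simp: upow_mem laurent_endo_upow\<close>)
qed

section \<open>Functions vanishing on the graph\<close>

text \<open>
The components of a finite set of generators generate. The sequence of generators is continued by
zeros, so that it can serve as a presentation by the polynomial ring in infinitely many variables, in terms
of which formal smoothness is expressed, while the first \<open>m\<close> variables suffice.
\<close>

lemma homogeneous_generators:
  fixes sA :: "'k::field \<Rightarrow> 'a::{comm_ring, comm_monoid_mult}"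
  assumes sA: "k_algebra sA" and ft: "finite_type sA" and \<rho>: "Gm_action sA \<rho>"
  obtains a d m where "\<And>i. \<rho> (a i) = Poly_Mapping.single (d i) (a i)" "\<And>i. i \<ge> m \<Longrightarrow> a i = 0"
    "mpoly_eval sA a ` vars_below m = UNIV"
proof -
  obtain X where X: "finite X" "is_subalgebra sA hull X = UNIV" using ft by (auto simp: finite_type_def)
  define Y where "Y = (\<Union>x\<in>X. Poly_Mapping.lookup (\<rho> x) ` Poly_Mapping.keys (\<rho> x))"
  have "finite Y" using X(1) by (auto simp: Y_def)
  then obtain ys where ys: "set ys = Y" using finite_list by blast
  define a where "a i = (if i < length ys then ys ! i else 0)" for i
  have "\<exists>n. \<rho> (a i) = Poly_Mapping.single n (a i)" for i
  proof (cases "i < length ys")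
    case True
    then have "a i \<in> Y" using ys by (auto simp: a_def)
    then show ?thesis using Gm_actionD(2)[OF \<rho>] by (auto simp: Y_def)
  qed (auto simp: a_def alg_homsD(4)[OF Gm_actionD(1)[OF \<rho>]])
  then obtain d where d: "\<And>i. \<rho> (a i) = Poly_Mapping.single (d i) (a i)" by metis
  let ?B = "mpoly_eval sA a ` vars_below (length ys)"
  have B: "is_subalgebra sA ?B"
    by (rule is_subalgebra_image[OF mpoly_eval_hom[OF sA] is_subalgebra_vars_below])
  have YB: "y \<in> ?B" if "y \<in> Y" for y
  proof -
    from that ys obtain i where i: "i < length ys" "y = ys ! i" by (auto simp: in_set_conv_nth)
    then have "y = mpoly_eval sA a (var i)" by (simp add: mpoly_eval_var[OF sA] a_def)
    then show ?thesis using var_vars_below[OF i(1)] by blast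
  qed
  have "X \<subseteq> ?B"
  proof
    fix x assume x: "x \<in> X"
    have "(\<Sum>n\<in>K. Poly_Mapping.lookup (\<rho> x) n) \<in> ?B" if "K \<subseteq> Poly_Mapping.keys (\<rho> x)" for K
      using that
    proof (induction K rule: infinite_finite_induct)
      case (insert n K)
      have "Poly_Mapping.lookup (\<rho> x) n \<in> ?B" by (rule YB) (use x insert in \<open>auto simp: Y_def\<close>)
      then show ?case using insert is_subalgebraD(2)[OF B] by simp
    qed (use is_subalgebraD(1)[OF B, of 0] k_algebra_0[OF sA] in simp_all)
    from this[OF subset_refl] show "x \<in> ?B" using Gm_actionD(3)[OF \<rho>, of x] by simp
  qed
  then have "is_subalgebra sA hull X \<subseteq> ?B" using B by (rule hull_minimal)
  with X(2) have "?B = UNIV" by auto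
  then show thesis using d by (intro that[of a d "length ys"]) (auto simp: a_def)
qed

text \<open>
The restriction of functions to \<open>G\<^sub>m \<times> Z\<close>, that is, to \<open>\<Gamma>\<close>.
\<close>

definition laurent_eval ::
  "('k::field \<Rightarrow> 'a::{comm_ring, comm_monoid_mult}) \<Rightarrow> (nat \<Rightarrow> 'a) \<Rightarrow> 'k laurent \<Rightarrow> (int \<Rightarrow>\<^sub>0 'a)" where
  "laurent_eval sA a =
     alg_eval (\<lambda>c. Poly_Mapping.single 0 (sA c)) (\<lambda>(n, \<alpha>). Poly_Mapping.single n (mono_eval a \<alpha>))"

context
  fixes sA :: "'k::field \<Rightarrow> 'a::{comm_ring, comm_monoid_mult}" and a :: "nat \<Rightarrow> 'a"
  assumes sA: "k_algebra sA"
begin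

lemma sA_simps: "sA (c + d) = sA c + sA d" "sA (c * d) = sA c * sA d" "sA 1 = 1"
  using sA by (auto simp: k_algebra_def)

lemma laurent_eval_hom:
  "laurent_eval sA a \<in> alg_homs (Poly_Mapping.single 0) (\<lambda>c. Poly_Mapping.single 0 (sA c))"
  unfolding laurent_eval_def
proof (rule alg_eval_hom)
  show "(case p + q of (n, \<alpha>) \<Rightarrow> Poly_Mapping.single n (mono_eval a \<alpha>)) =
      (case p of (n, \<alpha>) \<Rightarrow> Poly_Mapping.single n (mono_eval a \<alpha>)) *
      (case q of (n, \<alpha>) \<Rightarrow> Poly_Mapping.single n (mono_eval a \<alpha>))" for p q :: "int \<times> (nat \<Rightarrow>\<^sub>0 nat)"
    by (cases p; cases q) (simp add: mono_eval_add mult_single)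
qed (auto simp: single_add mult_single sA_simps)

lemma laurent_eval_single:
  "laurent_eval sA a (Poly_Mapping.single (n, \<alpha>) c) = Poly_Mapping.single n (sA c * mono_eval a \<alpha>)"
  unfolding laurent_eval_def by (subst alg_eval_single) (auto simp: single_add mult_single sA_simps)

lemma laurent_eval_upow: "laurent_eval sA a (upow n) = Poly_Mapping.single n 1"
  unfolding upow_def by (simp add: laurent_eval_single sA_simps)

lemma laurent_eval_emb: "laurent_eval sA a (emb p) = Poly_Mapping.single 0 (mpoly_eval sA a p)"
proof (rule mpoly_hom_eqI[OF alg_homs_comp[OF emb_hom laurent_eval_hom]])
  have "Poly_Mapping.single 0 \<in> alg_homs sA (\<lambda>c. Poly_Mapping.single (0::int) (sA c))"
    by (auto simp: alg_homs_def single_add mult_single)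
  from alg_homs_comp[OF mpoly_eval_hom[OF sA] this]
  show "(\<lambda>p. Poly_Mapping.single 0 (mpoly_eval sA a p)) \<in>
      alg_homs (Poly_Mapping.single 0) (\<lambda>c. Poly_Mapping.single (0::int) (sA c))" .
qed (simp add: mpoly_eval_var[OF sA] var_def emb_single laurent_eval_single mpoly_eval_single[OF sA])

lemma laurent_eval_coact:
  assumes \<rho>: "\<rho> \<in> alg_homs sA (\<lambda>c. Poly_Mapping.single 0 (sA c))"
    and a: "\<And>i. \<rho> (a i) = Poly_Mapping.single (d i) (a i)"
  shows "laurent_eval sA a (coact d p) = \<rho> (mpoly_eval sA a p)"
  by (rule mpoly_hom_eqI[OF alg_homs_comp[OF coact_hom laurent_eval_hom] alg_homs_comp[OF mpoly_eval_hom[OF sA] \<rho>]])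
     (simp add: mpoly_eval_var[OF sA] a, simp add: var_def coact_single laurent_eval_single sA_simps)

text \<open>
Over \<open>u \<noteq> 0\<close> the space of equivariant maps is the graph: a function that vanishes on the graph has
coefficients in the ideal of relations, and a large power of \<open>u\<close> turns each homogeneous component of a
coefficient into a multiple of a generator of \<open>tilde_ideal\<close>.
\<close>

lemma kernel_power_in_tilde_ideal:
  assumes \<rho>: "\<rho> \<in> alg_homs sA (\<lambda>c. Poly_Mapping.single 0 (sA c))"
    and a: "\<And>i. \<rho> (a i) = Poly_Mapping.single (d i) (a i)"
    and x: "x \<in> tilde_ring d m" "laurent_eval sA a x = 0"
  shows "\<exists>N. upow (int N) * x \<in> tilde_ideal (mpoly_eval sA a) d m"
proof -
  let ?ev = "mpoly_eval sA a" and ?J = "tilde_ideal (mpoly_eval sA a) d m"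
  have J: "ideal_of (tilde_ring d m) ?J" by (rule tilde_ideal)
  \<comment> \<open>It is essential that all large exponents are admitted: this makes the property stable under sums and under
    multiplication by negative powers of \<open>u\<close>.\<close>
  define P where "P y \<longleftrightarrow> (\<exists>N. \<forall>N'\<ge>N. upow N' * y \<in> ?J)" for y
  have P_add: "P (y + z)" if y: "P y" and z: "P z" for y z
  proof -
    from y z obtain M N where "\<forall>N'\<ge>M. upow N' * y \<in> ?J" "\<forall>N'\<ge>N. upow N' * z \<in> ?J"
      unfolding P_def by blast
    then have "\<forall>N'\<ge>max M N. upow N' * (y + z) \<in> ?J"
      by (auto simp: distrib_left intro!: ideal_ofD(3)[OF J])
    then show ?thesis unfolding P_def by blast
  qed
  have P_0: "P 0" using ideal_ofD(2)[OF J] by (auto simp: P_def)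
  have P_sum: "P (sum f I)" if "\<And>i. i \<in> I \<Longrightarrow> P (f i)" for f and I :: "int set"
    using that by (induction I rule: infinite_finite_induct) (auto intro: P_add P_0)
  have P_upow: "P (upow n * y)" if "P y" for n y
  proof -
    from that obtain N where N: "\<And>N'. N' \<ge> N \<Longrightarrow> upow N' * y \<in> ?J" unfolding P_def by blast
    have "upow N' * (upow n * y) \<in> ?J" if "N' \<ge> N - n" for N'
      using N[of "N' + n"] that by (simp add: upow_mult flip: mult.assoc)
    then show ?thesis unfolding P_def by blast
  qed
  have P_hom: "P (emb f)" if f: "f \<in> hom_kernel ?ev d m n" for f n
  proof -
    have "upow N * emb f \<in> ?J" if "N \<ge> 0" for N
    proof -
      have "upow (N - min n 0) * tilde n f \<in> ?J"
        using that by (intro ideal_ofD(4)[OF J] upow_mem tilde_mem_ideal f) auto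
      then show ?thesis by (simp add: tilde_def upow_mult flip: mult.assoc)
    qed
    then show ?thesis unfolding P_def by blast
  qed
  have P_ker: "P (emb f)" if f: "f \<in> vars_below m" "?ev f = 0" for f
  proof -
    have "emb f = (\<Sum>n\<in>weight d ` Poly_Mapping.keys f. emb (component (weight d) n f))"
      by (subst (1) sum_components[of f "weight d"]) (rule alg_homs_sum[OF emb_hom])
    moreover have "component (weight d) n f \<in> hom_kernel ?ev d m n" for n
      using f Gm_action_mpoly_eval[where a = a and d = d and p = f and n = n, OF sA \<rho> a] alg_homsD(4)[OF \<rho>]
      by (simp add: hom_kernel_def component_vars_below homogeneous_component)
    ultimately show ?thesis by (auto intro!: P_sum intro: P_hom)
  qed
  define f where "f n = Poly_Mapping.map_key (Pair n) x" for n
  have inj: "inj (Pair n)" for n :: int by (auto simp: inj_def)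
  let ?K = "fst ` Poly_Mapping.keys x"
  have x_sum: "x = (\<Sum>n\<in>?K. upow n * emb (f n))" unfolding f_def by (rule laurent_slices)
  have "?ev (f n) = 0" if "n \<in> ?K" for n
  proof -
    have "laurent_eval sA a x = (\<Sum>n\<in>?K. Poly_Mapping.single n (?ev (f n)))"
      by (subst (1) x_sum)
        (simp add: alg_homs_sum[OF laurent_eval_hom] alg_homsD(2)[OF laurent_eval_hom] laurent_eval_upow
          laurent_eval_emb mult_single)
    then have "Poly_Mapping.lookup (\<Sum>n\<in>?K. Poly_Mapping.single n (?ev (f n))) n = 0" using x(2) by simp
    then show ?thesis using that by (simp add: lookup_sum lookup_single when_def sum.delta)
  qed
  moreover have "f n \<in> vars_below m" for n
    using tilde_ring_keys(1)[OF x(1)]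
    by (auto simp: vars_below_def f_def keys_map_key[OF inj])
  ultimately have "P x" by (subst x_sum) (intro P_sum P_upow P_ker)
  then obtain N where "\<And>N'. N' \<ge> N \<Longrightarrow> upow N' * x \<in> ?J" unfolding P_def by blast
  then have "upow (int (nat N)) * x \<in> ?J" by simp
  then show ?thesis ..
qed

end

text \<open>
Evaluation at the point of the space of equivariant maps with coordinates \<open>t\<close> and \<open>y\<^sub>i = \<phi> i\<close>, in terms of
\<open>x\<^sub>i\<close> and \<open>u\<close>: as \<open>u\<^sup>n x\<^sup>\<alpha> = u\<^bsup>n + w \<alpha>\<^esup> y\<^sup>\<alpha>\<close> with \<open>w = weight (\<lambda>i. max 0 (- d i))\<close>, the exponent of \<open>t\<close> is
nonnegative on \<open>tilde_ring\<close>.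
\<close>

definition tilde_eval ::
  "('k::field \<Rightarrow> 'r::{comm_ring, comm_monoid_mult}) \<Rightarrow> 'r \<Rightarrow> (nat \<Rightarrow> int) \<Rightarrow> (nat \<Rightarrow> 'r) \<Rightarrow> 'k laurent \<Rightarrow> 'r" where
  "tilde_eval sR t d \<phi> =
     alg_eval sR (\<lambda>(n, \<alpha>). t ^ nat (n + weight (\<lambda>i. max 0 (- d i)) \<alpha>) * mono_eval \<phi> \<alpha>)"

lemma mono_eval_power:
  fixes z :: "'a::{comm_ring, comm_monoid_mult} \<Rightarrow> 'r::{comm_ring, comm_monoid_mult}"
  assumes sA: "k_algebra sA" and sR: "k_algebra sR" and z: "z \<in> alg_homs sA sR"
    and a: "\<And>i. z (a i) = t ^ nat (e i) * \<phi> i" and e: "\<And>i. e i \<ge> 0"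
  shows "z (mono_eval a \<alpha>) = t ^ nat (weight e \<alpha>) * mono_eval \<phi> \<alpha>"
proof (induction \<alpha> rule: monomial_induct)
  case zero
  then show ?case using alg_homsD(3)[OF z, of 1] sA sR by (simp add: k_algebra_def)
next
  case (step i \<alpha>)
  moreover have "weight e \<alpha> \<ge> 0" by (rule weight_nonneg) (rule e)
  ultimately show ?case using e[of i]
    by (simp add: mono_eval_add alg_homsD(2)[OF z] a weight_add nat_add_distrib power_add mult_ac)
qed

text \<open>
The relations between \<open>z1\<close> and \<open>z2\<close> say that they come from a common homomorphism \<open>\<Phi>\<close> on \<open>tilde_ring\<close> along
the two sections, and that \<open>\<Phi>\<close> kills \<open>tilde_ideal\<close>. The function \<open>F\<close> lifts to an element of \<open>tilde_ring\<close> which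
vanishes on the graph, hence lies in \<open>tilde_ideal\<close> after multiplication by a power of \<open>u\<close>, hence lies in it.
\<close>

theorem graph_function_vanishes:
  fixes sA :: "'k::field \<Rightarrow> 'a::{comm_ring, comm_monoid_mult}"
    and sR :: "'k \<Rightarrow> 'r::{comm_ring, comm_monoid_mult}"
  assumes sA: "k_algebra sA" and ft: "finite_type sA" and act: "Gm_action sA \<rho>"
    and smooth: "formally_smooth sA" and sR: "k_algebra sR"
    and z1: "z1 \<in> alg_homs sA sR" and z2: "z2 \<in> alg_homs sA sR"
    and pos: "\<And>n a. \<rho> a = Poly_Mapping.single n a \<Longrightarrow> n \<ge> 0 \<Longrightarrow> z2 a = t ^ nat n * z1 a"
    and neg: "\<And>n a. \<rho> a = Poly_Mapping.single n a \<Longrightarrow> n \<le> 0 \<Longrightarrow> z1 a = t ^ nat (- n) * z2 a"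
    and F: "restrict_graph \<rho> F = 0"
  shows "eval_at (t, z1, z2) F = 0"
proof -
  note \<rho> = Gm_actionD(1)[OF act]
  obtain a d m where a: "\<And>i. \<rho> (a i) = Poly_Mapping.single (d i) (a i)"
    and am: "\<And>i. i \<ge> m \<Longrightarrow> a i = 0" and surj: "mpoly_eval sA a ` vars_below m = UNIV"
    using homogeneous_generators[OF sA ft act] by metis
  define ev where "ev = mpoly_eval sA a"
  have ev: "ev \<in> alg_homs (Poly_Mapping.single 0) sA" unfolding ev_def by (rule mpoly_eval_hom[OF sA])
  have "surj (mpoly_eval sA a)" using surj by auto
  from equivariant_contraction[OF sA smooth \<rho> a am this] obtain v where
    v: "\<And>i. homogeneous (weight d) (d i) (v i)" "\<And>i. v i \<in> vars_below m" "\<And>i. ev (v i) = a i"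
    and contr: "\<And>n p. p \<in> hom_kernel ev d m n \<Longrightarrow>
       mpoly_eval (Poly_Mapping.single 0) v p \<in> add_span (\<Union>i. {f * g |f g.
         f \<in> hom_kernel ev d m i \<and> g \<in> hom_kernel ev d m (n - i)})"
    unfolding ev_def by blast
  have v': "ev (v i) = ev (var i)" for i unfolding v(3) by (simp add: ev_def mpoly_eval_var[OF sA])
  let ?S = "tilde_ring d m :: 'k laurent set"
  have S: "subring ?S" by (rule subring_tilde)

  \<comment> \<open>The coordinate \<open>y\<^sub>i\<close> is the value of \<open>x\<^sub>i\<close> along the section on which the relevant variable \<open>\<tau>\<^sub>1\<close> or \<open>\<tau>\<^sub>2\<close> is
    equal to \<open>1\<close>.\<close>
  define \<phi> where "\<phi> i = (if d i \<ge> 0 then z1 (a i) else z2 (a i))" for i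
  define \<Phi> where "\<Phi> = tilde_eval sR t d \<phi>"
  let ?w = "weight (\<lambda>i. max 0 (- d i))"
  have sR_simps: "sR (c + d) = sR c + sR d" "sR (c * d) = sR c * sR d" "sR 1 = 1" for c d
    using sR by (auto simp: k_algebra_def)
  have \<Phi>_add: "\<Phi> (x + y) = \<Phi> x + \<Phi> y" for x y
    unfolding \<Phi>_def tilde_eval_def by (rule alg_eval_add) (rule sR_simps)
  have \<Phi>_0: "\<Phi> 0 = 0" using \<Phi>_add[of 0 0] by simp
  have \<Phi>_mult: "\<Phi> (x * y) = \<Phi> x * \<Phi> y" if x: "x \<in> ?S" and y: "y \<in> ?S" for x y
    unfolding \<Phi>_def tilde_eval_def
  proof (rule alg_eval_mult)
    fix p q assume p: "p \<in> Poly_Mapping.keys x" and q: "q \<in> Poly_Mapping.keys y"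
    obtain i \<alpha> j \<beta> where pq: "p = (i, \<alpha>)" "q = (j, \<beta>)" by (cases p; cases q)
    have "i + ?w \<alpha> \<ge> 0" "j + ?w \<beta> \<ge> 0" using p q tilde_ring_keys(2)[OF x] tilde_ring_keys(2)[OF y]
      unfolding pq by blast+
    then have "nat (i + j + ?w (\<alpha> + \<beta>)) = nat (i + ?w \<alpha>) + nat (j + ?w \<beta>)"
      by (simp add: weight_add algebra_simps flip: nat_add_distrib)
    then show "(case p + q of (n, \<alpha>) \<Rightarrow> t ^ nat (n + ?w \<alpha>) * mono_eval \<phi> \<alpha>) =
      (case p of (n, \<alpha>) \<Rightarrow> t ^ nat (n + ?w \<alpha>) * mono_eval \<phi> \<alpha>) *
      (case q of (n, \<alpha>) \<Rightarrow> t ^ nat (n + ?w \<alpha>) * mono_eval \<phi> \<alpha>)"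
      by (simp add: pq power_add mono_eval_add mult_ac)
  qed (simp_all add: sR_simps)
  have \<Phi>_single: "\<Phi> (Poly_Mapping.single (n, \<alpha>) c) = sR c * (t ^ nat (n + ?w \<alpha>) * mono_eval \<phi> \<alpha>)" for n \<alpha> c
    unfolding \<Phi>_def tilde_eval_def by (subst alg_eval_single) (auto simp: sR_simps)
  have \<Phi>_upow: "\<Phi> (upow (int n)) = t ^ n" for n
    unfolding upow_def \<Phi>_single by (simp add: sR_simps)
  have z1a: "z1 (a i) = t ^ nat (max 0 (- d i)) * \<phi> i" for i
    using neg[OF a, of i] by (auto simp: \<phi>_def max_def)
  have z2a: "z2 (a i) = t ^ nat (max 0 (d i)) * \<phi> i" for i
    using pos[OF a, of i] by (auto simp: \<phi>_def max_def)
  have \<Phi>_emb: "\<Phi> (emb p) = z1 (ev p)" for p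
  proof (induction p rule: poly_mapping_induct)
    case zero
    show ?case by (simp add: alg_homsD(4)[OF emb_hom] alg_homsD(4)[OF ev] alg_homsD(4)[OF z1] \<Phi>_0)
  next
    case (single \<alpha>)
    show ?case
      by (simp add: emb_single \<Phi>_single ev_def mpoly_eval_single[OF sA] alg_homsD(2,3)[OF z1]
          mono_eval_power[OF sA sR z1 z1a])
  next
    case (add p q)
    then show ?case by (simp add: alg_homsD(1)[OF emb_hom] alg_homsD(1)[OF ev] alg_homsD(1)[OF z1] \<Phi>_add)
  qed
  have w_pos: "weight d \<alpha> + ?w \<alpha> = weight (\<lambda>i. max 0 (d i)) \<alpha>" for \<alpha>
    by (subst weight_fun_add[symmetric]) (auto intro!: arg_cong2[of _ _ _ _ weight] simp: max_def)
  have \<Phi>_coact: "\<Phi> (coact d p) = z2 (ev p)" for p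
  proof (induction p rule: poly_mapping_induct)
    case zero
    show ?case by (simp add: alg_homsD(4)[OF coact_hom] alg_homsD(4)[OF ev] alg_homsD(4)[OF z2] \<Phi>_0)
  next
    case (single \<alpha>)
    show ?case
      by (simp add: coact_single \<Phi>_single w_pos ev_def mpoly_eval_single[OF sA] alg_homsD(2,3)[OF z2]
          mono_eval_power[OF sA sR z2 z2a])
  next
    case (add p q)
    then show ?case by (simp add: alg_homsD(1)[OF coact_hom] alg_homsD(1)[OF ev] alg_homsD(1)[OF z2] \<Phi>_add)
  qed
  have "tilde_ideal ev d m \<subseteq> {x \<in> ?S. \<Phi> x = 0}"
  proof (rule tilde_ideal_minimal)
    show "ideal_of ?S {x \<in> ?S. \<Phi> x = 0}"
      by (rule ideal_ofI) (auto simp: \<Phi>_add \<Phi>_0 \<Phi>_mult intro: subringD[OF S])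
    fix n f assume f: "f \<in> hom_kernel ev d m n"
    have "tilde n f = (if n \<ge> 0 then emb f else coact d f)"
      using coact_homogeneous[of d n f] f by (auto simp: tilde_def hom_kernel_def min_def)
    then have "\<Phi> (tilde n f) = 0"
      using f alg_homsD(4)[OF z1] alg_homsD(4)[OF z2] by (auto simp: hom_kernel_def \<Phi>_emb \<Phi>_coact)
    then show "tilde n f \<in> {x \<in> ?S. \<Phi> x = 0}" using f by (auto simp: hom_kernel_def intro: tilde_mem)
  qed
  then have \<Phi>_J: "\<Phi> x = 0" if "x \<in> tilde_ideal ev d m" for x using that by blast

  \<comment> \<open>Lift \<open>F\<close>: the first factor along \<open>emb\<close>, the second one along \<open>coact\<close>.\<close>
  have "\<forall>b. \<exists>p. p \<in> vars_below m \<and> ev p = b" using surj unfolding ev_def by (metis UNIV_I imageE)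
  then obtain l where l: "\<And>b. l b \<in> vars_below m" "\<And>b. ev (l b) = b" by metis
  have "\<exists>x\<in>?S. laurent_eval sA a x = restrict_graph \<rho> F \<and> \<Phi> x = eval_at (t, z1, z2) F"
  proof (induction F)
    case Nil
    show ?case using subringD(2)[OF S] alg_homsD(4)[OF laurent_eval_hom[OF sA]]
      by (intro bexI[of _ 0]) (auto simp: restrict_graph_def eval_at_def \<Phi>_0)
  next
    case (Cons nbc F)
    obtain n b c where nbc: "nbc = (n, b, c)" by (cases nbc)
    from Cons obtain x where x: "x \<in> ?S" "laurent_eval sA a x = restrict_graph \<rho> F"
      "\<Phi> x = eval_at (t, z1, z2) F" by blast
    let ?y = "upow (int n) * emb (l b) * coact d (l c) :: 'k laurent"
    have mem: "upow (int n) \<in> ?S" "emb (l b) \<in> ?S" "coact d (l c) \<in> ?S"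
      by (auto intro: upow_mem emb_coact_mem l)
    then have y: "?y \<in> ?S" by (intro subringD(4)[OF S])
    have "\<Phi> ?y = t ^ n * z1 b * z2 c"
      using mem subringD(4)[OF S] by (simp add: \<Phi>_mult \<Phi>_upow \<Phi>_emb \<Phi>_coact l)
    moreover have "laurent_eval sA a ?y = Poly_Mapping.single (int n) b * \<rho> c"
      using l(2) by (simp add: alg_homsD(2)[OF laurent_eval_hom[OF sA]] laurent_eval_upow[OF sA]
          laurent_eval_emb[OF sA] laurent_eval_coact[OF sA \<rho> a] ev_def mult_single)
    ultimately show ?case using x y subringD(6)[OF S]
      by (intro bexI[of _ "?y + x"])
        (auto simp: nbc restrict_graph_def eval_at_def \<Phi>_add alg_homsD(1)[OF laurent_eval_hom[OF sA]])
  qed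
  with F obtain x where x: "x \<in> ?S" "laurent_eval sA a x = 0" "\<Phi> x = eval_at (t, z1, z2) F" by auto
  from kernel_power_in_tilde_ideal[OF sA \<rho> a x(1,2)] obtain N where
    "upow (int N) * x \<in> tilde_ideal ev d m" unfolding ev_def by blast
  from tilde_ideal_saturated[OF ev v(1,2) v' contr x(1) this] have "x \<in> tilde_ideal ev d m" .
  from \<Phi>_J[OF this] x(3) show ?thesis by simp
qed

section \<open>Equivariant maps and their restrictions to the two sections\<close>

definition tau_deg :: "nat \<times> nat \<Rightarrow> int" where
  "tau_deg = (\<lambda>(i, j). int i - int j)"

lemma tau_deg_add: "tau_deg (m + n) = tau_deg m + tau_deg n"
  by (cases m; cases n) (simp add: tau_deg_def)

lemma lookup_XS_coaction: "Poly_Mapping.lookup (XS_coaction p) n = component tau_deg n p"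
proof (rule poly_mapping_eqI)
  fix k
  let ?f = "\<lambda>(i, j). Poly_Mapping.single (int i - int j)
          (Poly_Mapping.single (i, j) (Poly_Mapping.lookup p (i, j)))"
  have "Poly_Mapping.lookup (Poly_Mapping.lookup (?f ij) n) k =
      (if ij = k then (Poly_Mapping.lookup p k when tau_deg k = n) else 0)" for ij
    by (cases ij) (auto simp: lookup_single when_def tau_deg_def)
  then show "Poly_Mapping.lookup (Poly_Mapping.lookup (XS_coaction p) n) k =
      Poly_Mapping.lookup (component tau_deg n p) k"
    by (auto simp: XS_coaction_def lookup_sum lookup_component sum.delta in_keys_iff when_def)
qed

lemma eval2_alg_eval: "eval2 u v = alg_eval (\<lambda>c. c) (\<lambda>(i, j). u ^ i * v ^ j)"
  by (rule ext) (simp add: eval2_def alg_eval_def split_def mult.assoc)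

lemma eval2_add: "eval2 u v (p + q) = eval2 u v p + eval2 u v q"
  unfolding eval2_alg_eval by (rule alg_eval_add) simp

lemma eval2_diff: "eval2 u v (p - q) = eval2 u v p - eval2 u v q"
  unfolding eval2_alg_eval by (rule alg_eval_diff) simp

lemma eval2_sum: "eval2 u v (sum f K) = (\<Sum>i\<in>K. eval2 u v (f i))"
  unfolding eval2_alg_eval by (rule alg_eval_sum) simp

lemma eval2_mult: "eval2 u v (p * q) = eval2 u v p * eval2 u v q"
  unfolding eval2_alg_eval by (rule alg_eval_mult) (auto simp: power_add mult_ac)

lemma eval2_single: "eval2 u v (Poly_Mapping.single (i, j) c) = c * u ^ i * v ^ j"
  unfolding eval2_alg_eval by (subst alg_eval_single) (auto simp: mult_ac)

context
  fixes t :: "'r::{comm_ring, comm_monoid_mult}"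
begin

abbreviation "XS_rel \<equiv> Poly_Mapping.single (1, 1) 1 - Poly_Mapping.single (0, 0) t"

lemma is_ideal_XS: "is_ideal (XS_ideal t)"
proof -
  have "x - y \<in> XS_ideal t" if "x \<in> XS_ideal t" "y \<in> XS_ideal t" for x y
    using that unfolding XS_ideal_def by (auto simp flip: left_diff_distrib)
  moreover have "q * x \<in> XS_ideal t" if "x \<in> XS_ideal t" for q x
    using that unfolding XS_ideal_def by (auto simp flip: mult.assoc)
  moreover have "0 \<in> XS_ideal t" unfolding XS_ideal_def by (rule image_eqI[of _ _ 0]) auto
  ultimately show ?thesis by (simp add: is_ideal_def)
qed

lemma XS_ideal_add: "x \<in> XS_ideal t \<Longrightarrow> y \<in> XS_ideal t \<Longrightarrow> x + y \<in> XS_ideal t"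
  unfolding XS_ideal_def by (auto simp flip: distrib_right)

lemma XS_ideal_0: "0 \<in> XS_ideal t" and XS_ideal_diff: "x \<in> XS_ideal t \<Longrightarrow> y \<in> XS_ideal t \<Longrightarrow> x - y \<in> XS_ideal t"
  and XS_ideal_mult: "x \<in> XS_ideal t \<Longrightarrow> q * x \<in> XS_ideal t"
  using is_ideal_XS by (auto simp: is_ideal_def)

lemma eval2_XS_ideal:
  assumes "u * v = t" "p \<in> XS_ideal t" shows "eval2 u v p = 0"
proof -
  obtain q where "p = q * XS_rel" using assms(2) by (auto simp: XS_ideal_def)
  then show ?thesis using assms(1) eval2_single[of u v 0 0 t] eval2_single[of u v 1 1 1]
    by (simp add: eval2_mult eval2_diff)
qed

lemma component_XS_ideal:
  assumes "p \<in> XS_ideal t" shows "component tau_deg n p \<in> XS_ideal t"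
proof -
  obtain q where q: "p = XS_rel * q" using assms by (auto simp: XS_ideal_def mult.commute)
  have "homogeneous tau_deg 0 XS_rel"
    by (intro homogeneous_diff homogeneous_single) (simp_all add: tau_deg_def del: zero_pair)
  from component_mult_homogeneous[OF tau_deg_add this, of n q]
  have "component tau_deg n p = component tau_deg n q * XS_rel" by (simp add: q mult.commute)
  then show ?thesis unfolding XS_ideal_def by blast
qed

text \<open>
The monomial \<open>c \<tau>\<^sub>1\<^sup>n\<close> for \<open>n \<ge> 0\<close> and \<open>c \<tau>\<^sub>2\<^sup>-\<^sup>n\<close> for \<open>n \<le> 0\<close>; truncation of \<open>nat\<close> at zero unifies the two cases.
\<close>

definition normal_form :: "int \<Rightarrow> 'r \<Rightarrow> ((nat \<times> nat) \<Rightarrow>\<^sub>0 'r)" where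
  "normal_form n c = Poly_Mapping.single (nat n, nat (- n)) c"

lemma normal_form_add: "normal_form n (c + d) = normal_form n c + normal_form n d"
  by (simp add: normal_form_def single_add)

lemma normal_form_0 [simp]: "normal_form n 0 = 0"
  by (simp add: normal_form_def)

lemma homogeneous_normal_form: "homogeneous tau_deg n (normal_form n c)"
  unfolding normal_form_def by (rule homogeneous_single) (simp add: tau_deg_def)

lemma single_shift: "Poly_Mapping.single (i + k, j + k) c - Poly_Mapping.single (i, j) (t ^ k * c) \<in> XS_ideal t"
proof (induction k arbitrary: c)
  case 0
  then show ?case by (simp add: XS_ideal_0)
next
  case (Suc k)
  have "Poly_Mapping.single (i + Suc k, j + Suc k) c - Poly_Mapping.single (i + k, j + k) (t * c) =
      Poly_Mapping.single (i + k, j + k) c * XS_rel"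
    by (simp add: right_diff_distrib mult_single mult.commute del: zero_pair)
  then have "Poly_Mapping.single (i + Suc k, j + Suc k) c - Poly_Mapping.single (i + k, j + k) (t * c) \<in> XS_ideal t"
    unfolding XS_ideal_def by simp
  from XS_ideal_add[OF this Suc[of "t * c"]] show ?case by (simp add: mult_ac)
qed

lemma single_normal_form:
  "Poly_Mapping.single (i, j) c - normal_form (int i - int j) (t ^ min i j * c) \<in> XS_ideal t"
proof -
  have "nat (int i - int j) + min i j = i" "nat (- (int i - int j)) + min i j = j" by auto
  then show ?thesis
    using single_shift[of "nat (int i - int j)" "min i j" "nat (- (int i - int j))" c]
    by (simp only: normal_form_def)
qed

text \<open>
Modulo \<open>\<tau>\<^sub>1 \<tau>\<^sub>2 = t\<close> every monomial of degree \<open>n\<close> reduces to the pure power of \<open>\<tau>\<^sub>1\<close> or \<open>\<tau>\<^sub>2\<close>, whose coefficient can be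
read off at \<open>\<tau>\<^sub>1 = 1\<close> or \<open>\<tau>\<^sub>2 = 1\<close>.
\<close>

lemma homogeneous_normal_form_cong:
  assumes p: "homogeneous tau_deg n p"
  shows "n \<ge> 0 \<Longrightarrow> p - normal_form n (eval2 1 t p) \<in> XS_ideal t"
    and "n \<le> 0 \<Longrightarrow> p - normal_form n (eval2 t 1 p) \<in> XS_ideal t"
    and "n \<ge> 0 \<Longrightarrow> eval2 t 1 p = t ^ nat n * eval2 1 t p"
    and "n \<le> 0 \<Longrightarrow> eval2 1 t p = t ^ nat (- n) * eval2 t 1 p"
proof -
  have *: "(n \<ge> 0 \<longrightarrow> p - normal_form n (eval2 1 t p) \<in> XS_ideal t \<and> eval2 t 1 p = t ^ nat n * eval2 1 t p) \<and>
     (n \<le> 0 \<longrightarrow> p - normal_form n (eval2 t 1 p) \<in> XS_ideal t \<and> eval2 1 t p = t ^ nat (- n) * eval2 t 1 p)"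
  proof (induction p rule: poly_mapping_induct)
    case zero
    have "eval2 u v 0 = 0" for u v :: 'r using eval2_add[of u v 0 0] by simp
    then show ?case by (simp add: XS_ideal_0)
  next
    case (single m)
    obtain i j where m: "m = (i, j)" by (cases m)
    with single p have n: "n = int i - int j" by (auto simp: homogeneous_def tau_deg_def)
    let ?c = "Poly_Mapping.lookup p (i, j)"
    note nf = single_normal_form[of i j ?c, folded n]
    show ?case unfolding m
    proof (intro conjI impI)
      assume "n \<ge> 0"
      with n have ij: "i = nat n + j" "min i j = j" by auto
      have ti: "t ^ i = t ^ nat n * t ^ j" by (subst ij(1)) (rule power_add)
      show "Poly_Mapping.single (i, j) ?c - normal_form n (eval2 1 t (Poly_Mapping.single (i, j) ?c)) \<in> XS_ideal t"
        using nf unfolding eval2_single ij(2) by (simp add: mult.commute)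
      show "eval2 t 1 (Poly_Mapping.single (i, j) ?c) = t ^ nat n * eval2 1 t (Poly_Mapping.single (i, j) ?c)"
        unfolding eval2_single ti by (simp add: mult_ac)
    next
      assume "n \<le> 0"
      with n have ij: "j = nat (- n) + i" "min i j = i" by auto
      have tj: "t ^ j = t ^ nat (- n) * t ^ i" by (subst ij(1)) (rule power_add)
      show "Poly_Mapping.single (i, j) ?c - normal_form n (eval2 t 1 (Poly_Mapping.single (i, j) ?c)) \<in> XS_ideal t"
        using nf unfolding eval2_single ij(2) by (simp add: mult.commute)
      show "eval2 1 t (Poly_Mapping.single (i, j) ?c) = t ^ nat (- n) * eval2 t 1 (Poly_Mapping.single (i, j) ?c)"
        unfolding eval2_single tj by (simp add: mult_ac)
    qed
  next
    case (add p q)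
    have *: "(p + q) - normal_form n (eval2 u v (p + q)) =
        (p - normal_form n (eval2 u v p)) + (q - normal_form n (eval2 u v q))" for u v
      by (simp add: eval2_add normal_form_add)
    have nf: "(p + q) - normal_form n (eval2 u v (p + q)) \<in> XS_ideal t"
      if "p - normal_form n (eval2 u v p) \<in> XS_ideal t" "q - normal_form n (eval2 u v q) \<in> XS_ideal t" for u v
      unfolding * by (rule XS_ideal_add[OF that])
    show ?case
    proof (intro conjI impI)
      assume n: "n \<ge> 0"
      show "p + q - normal_form n (eval2 1 t (p + q)) \<in> XS_ideal t" using add n by (intro nf) blast+
      have "eval2 t 1 p = t ^ nat n * eval2 1 t p" "eval2 t 1 q = t ^ nat n * eval2 1 t q" using add n by blast+
      then show "eval2 t 1 (p + q) = t ^ nat n * eval2 1 t (p + q)" by (simp add: eval2_add distrib_left)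
    next
      assume n: "n \<le> 0"
      show "p + q - normal_form n (eval2 t 1 (p + q)) \<in> XS_ideal t" using add n by (intro nf) blast+
      have "eval2 1 t p = t ^ nat (- n) * eval2 t 1 p" "eval2 1 t q = t ^ nat (- n) * eval2 t 1 q" using add n by blast+
      then show "eval2 1 t (p + q) = t ^ nat (- n) * eval2 t 1 (p + q)" by (simp add: eval2_add distrib_left)
    qed
  qed
  then show "n \<ge> 0 \<Longrightarrow> p - normal_form n (eval2 1 t p) \<in> XS_ideal t"
    "n \<le> 0 \<Longrightarrow> p - normal_form n (eval2 t 1 p) \<in> XS_ideal t"
    "n \<ge> 0 \<Longrightarrow> eval2 t 1 p = t ^ nat n * eval2 1 t p"
    "n \<le> 0 \<Longrightarrow> eval2 1 t p = t ^ nat (- n) * eval2 t 1 p" by blast+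
qed

end

text \<open>
The comorphism of the equivariant map with restrictions \<open>z1\<close> and \<open>z2\<close>, up to \<open>XS_ideal\<close>, as a function of the
decomposition \<open>P\<close> of an element of \<open>A\<close> into its components.
\<close>

definition graded_section ::
  "('a::comm_ring \<Rightarrow> 'r) \<Rightarrow> ('a \<Rightarrow> 'r) \<Rightarrow> (int \<Rightarrow>\<^sub>0 'a) \<Rightarrow> ((nat \<times> nat) \<Rightarrow>\<^sub>0 'r::{comm_ring, comm_monoid_mult})" where
  "graded_section z1 z2 P = (\<Sum>n\<in>Poly_Mapping.keys P.
     normal_form n ((if n \<ge> 0 then z1 else z2) (Poly_Mapping.lookup P n)))"

lemma pull_section_eq:
  assumes f: "f \<in> quot_homs sA s (XS_ideal t)" and uv: "u * v = t" and p: "p \<in> f a"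
  shows "pull_section u v f a = eval2 u v p"
proof -
  have "eval2 u v q = eval2 u v p" if "q \<in> f a" for q
  proof -
    have "q - p \<in> XS_ideal t" using quot_homs_mem_iff[OF is_ideal_XS f p, of q] that by simp
    from eval2_XS_ideal[OF uv this] show ?thesis by (simp add: eval2_diff)
  qed
  then have "eval2 u v ` f a = (\<lambda>_. eval2 u v p) ` f a" by (intro image_cong refl)
  also have "\<dots> = {eval2 u v p}" using p by (rule image_constant)
  finally have "eval2 u v ` f a = {eval2 u v p}" .
  then show ?thesis by (simp add: pull_section_def)
qed

context
  fixes sA :: "'k::field \<Rightarrow> 'a::{comm_ring, comm_monoid_mult}"
    and \<rho> :: "'a \<Rightarrow> (int \<Rightarrow>\<^sub>0 'a)"
    and sR :: "'k \<Rightarrow> 'r::{comm_ring, comm_monoid_mult}"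
  assumes sA: "k_algebra sA" and act: "Gm_action sA \<rho>" and sR: "k_algebra sR"
begin

lemma pull_section_hom:
  assumes f: "f \<in> quot_homs sA (\<lambda>c. Poly_Mapping.single 0 (sR c)) (XS_ideal t)" and uv: "u * v = t"
  shows "pull_section u v f \<in> alg_homs sA sR"
proof -
  note ps = pull_section_eq[OF f uv]
  have "pull_section u v f (a + b) = pull_section u v f a + pull_section u v f b \<and>
     pull_section u v f (a * b) = pull_section u v f a * pull_section u v f b" for a b
  proof -
    obtain p q where "p \<in> f a" "q \<in> f b" using quot_homs_nonempty[OF is_ideal_XS f] by metis
    then show ?thesis using quot_homsD(1,2)[OF f, of p a q b] by (simp add: ps eval2_add eval2_mult)
  qed
  moreover have "pull_section u v f (sA c) = sR c" for c
    using ps[OF quot_homsD(3)[OF f]] eval2_single[of u v 0 0 "sR c"] by simp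
  ultimately show ?thesis by (simp add: alg_homs_def)
qed

lemma equivariant_map_homogeneous:
  assumes f: "f \<in> equivariant_maps sA \<rho> sR t" and a: "\<rho> a = Poly_Mapping.single n a"
  shows "n \<ge> 0 \<Longrightarrow> normal_form n (pull_section 1 t f a) \<in> f a"
    and "n \<le> 0 \<Longrightarrow> normal_form n (pull_section t 1 f a) \<in> f a"
    and "n \<ge> 0 \<Longrightarrow> pull_section t 1 f a = t ^ nat n * pull_section 1 t f a"
    and "n \<le> 0 \<Longrightarrow> pull_section 1 t f a = t ^ nat (- n) * pull_section t 1 f a"
proof -
  have f': "f \<in> quot_homs sA (\<lambda>c. Poly_Mapping.single 0 (sR c)) (XS_ideal t)"
    using f by (simp add: equivariant_maps_def)
  obtain p0 where "p0 \<in> f a" using quot_homs_nonempty[OF is_ideal_XS f'] by blast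
  then have "component tau_deg n p0 \<in> f (Poly_Mapping.lookup (\<rho> a) n)"
    using f by (simp add: equivariant_maps_def flip: lookup_XS_coaction)
  then obtain p where p: "p \<in> f a" "homogeneous tau_deg n p" using homogeneous_component by (auto simp: a)
  have ps: "pull_section 1 t f a = eval2 1 t p" "pull_section t 1 f a = eval2 t 1 p"
    by (rule pull_section_eq[OF f' _ p(1)]; simp)+
  note nf = homogeneous_normal_form_cong[OF p(2), of t]
  have mem: "q \<in> f a" if "p - q \<in> XS_ideal t" for q
  proof -
    have "q - p \<in> XS_ideal t" using XS_ideal_diff[OF XS_ideal_0 that] by simp
    then show ?thesis using quot_homs_mem_iff[OF is_ideal_XS f' p(1)] by blast
  qed
  show "n \<ge> 0 \<Longrightarrow> normal_form n (pull_section 1 t f a) \<in> f a"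
    "n \<le> 0 \<Longrightarrow> normal_form n (pull_section t 1 f a) \<in> f a"
    using mem nf(1,2) by (simp_all add: ps)
  show "n \<ge> 0 \<Longrightarrow> pull_section t 1 f a = t ^ nat n * pull_section 1 t f a"
    "n \<le> 0 \<Longrightarrow> pull_section 1 t f a = t ^ nat (- n) * pull_section t 1 f a"
    using nf(3,4) by (simp_all add: ps)
qed

text \<open>
An equivariant map is determined by its restrictions to the two sections, because each homogeneous
element goes to a normal form.
\<close>

lemma equivariant_map_eq_coset:
  assumes f: "f \<in> equivariant_maps sA \<rho> sR t"
  shows "f a = coset (XS_ideal t) (graded_section (pull_section 1 t f) (pull_section t 1 f) (\<rho> a))"
proof -
  let ?z = "\<lambda>n. if n \<ge> 0 then pull_section 1 t f else pull_section t 1 f"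
  have f': "f \<in> quot_homs sA (\<lambda>c. Poly_Mapping.single 0 (sR c)) (XS_ideal t)"
    using f by (simp add: equivariant_maps_def)
  have "(\<Sum>n\<in>K. normal_form n (?z n (Poly_Mapping.lookup (\<rho> a) n))) \<in>
      f (\<Sum>n\<in>K. Poly_Mapping.lookup (\<rho> a) n)" for K
  proof (induction K rule: infinite_finite_induct)
    case empty
    show ?case using quot_homsD(3)[OF f', of 0] k_algebra_0[OF sA] k_algebra_0[OF sR] by simp
  next
    case (infinite K)
    then show ?case using quot_homsD(3)[OF f', of 0] k_algebra_0[OF sA] k_algebra_0[OF sR] by simp
  next
    case (insert n K)
    have "normal_form n (?z n (Poly_Mapping.lookup (\<rho> a) n)) \<in> f (Poly_Mapping.lookup (\<rho> a) n)"
      using equivariant_map_homogeneous(1,2)[OF f Gm_actionD(2)[OF act, of a n]] by simp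
    then show ?case using insert quot_homsD(1)[OF f'] by simp
  qed
  from this[of "Poly_Mapping.keys (\<rho> a)"]
  have "graded_section (pull_section 1 t f) (pull_section t 1 f) (\<rho> a) \<in> f a"
    by (simp add: graded_section_def flip: Gm_actionD(3)[OF act])
  from quot_homs_mem_iff[OF is_ideal_XS f' this] show ?thesis by (auto simp: coset_def)
qed

context
  fixes t :: 'r and z1 z2
  assumes z1: "z1 \<in> alg_homs sA sR" and z2: "z2 \<in> alg_homs sA sR"
    and pos: "\<And>n a. \<rho> a = Poly_Mapping.single n a \<Longrightarrow> n \<ge> 0 \<Longrightarrow> z2 a = t ^ nat n * z1 a"
    and neg: "\<And>n a. \<rho> a = Poly_Mapping.single n a \<Longrightarrow> n \<le> 0 \<Longrightarrow> z1 a = t ^ nat (- n) * z2 a"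
begin

abbreviation "sect \<equiv> graded_section z1 z2"
abbreviation "half n \<equiv> (if n \<ge> (0::int) then z1 else z2)"

lemma half_simps: "half n (a + b) = half n a + half n b" "half n (a * b) = half n a * half n b" "half n 0 = 0"
  using alg_homsD[OF z1] alg_homsD[OF z2] by auto

lemma sect_superset:
  "finite K \<Longrightarrow> Poly_Mapping.keys P \<subseteq> K \<Longrightarrow> sect P = (\<Sum>n\<in>K. normal_form n (half n (Poly_Mapping.lookup P n)))"
  unfolding graded_section_def
  by (rule sum.mono_neutral_left) (auto simp: in_keys_iff alg_homsD(4)[OF z1] alg_homsD(4)[OF z2])

lemma sect_add: "sect (P + P') = sect P + sect P'"
proof -
  let ?K = "Poly_Mapping.keys P \<union> Poly_Mapping.keys P'"
  have "Poly_Mapping.keys (P + P') \<subseteq> ?K" by (rule Poly_Mapping.keys_add)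
  then show ?thesis
    by (simp only: sect_superset[of ?K] finite_Un finite_keys Un_upper1 Un_upper2 lookup_add half_simps
        normal_form_add sum.distrib simp_thms)
qed

lemma sect_0: "sect 0 = 0"
  by (simp add: graded_section_def)

lemma sect_single: "sect (Poly_Mapping.single n a) = normal_form n (half n a)"
  using sect_superset[of "{n}" "Poly_Mapping.single n a"] by simp

text \<open>
If the degrees have opposite signs, \<open>\<tau>\<^sub>1\<close> and \<open>\<tau>\<^sub>2\<close> cancel to a power of \<open>t\<close>, and the relation between \<open>z1\<close> and \<open>z2\<close> for
the factor of smaller absolute degree absorbs it.
\<close>

lemma sect_mult_homogeneous:
  assumes a: "\<rho> a = Poly_Mapping.single n a" and b: "\<rho> b = Poly_Mapping.single m b"
  shows "normal_form n (half n a) * normal_form m (half m b) - normal_form (n + m) (half (n + m) (a * b)) \<in> XS_ideal t"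
proof -
  let ?i = "nat n + nat m" and ?j = "nat (- n) + nat (- m)"
  have "t ^ min ?i ?j * (half n a * half m b) = half (n + m) (a * b)"
  proof -
    consider "n \<ge> 0" "m \<ge> 0" | "n < 0" "m < 0" | "n \<ge> 0" "m < 0" "n + m \<ge> 0" | "n \<ge> 0" "m < 0" "n + m < 0"
      | "n < 0" "m \<ge> 0" "n + m \<ge> 0" | "n < 0" "m \<ge> 0" "n + m < 0" by linarith
    then show ?thesis
    proof cases
      case 3
      then have "min ?i ?j = nat (- m)" by auto
      with 3 neg[OF b] show ?thesis by (simp add: alg_homsD(2)[OF z1] mult_ac)
    next
      case 4
      then have "min ?i ?j = nat n" by auto
      with 4 pos[OF a] show ?thesis by (simp add: alg_homsD(2)[OF z2] mult_ac)
    next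
      case 5
      then have "min ?i ?j = nat (- n)" by auto
      with 5 neg[OF a] show ?thesis by (simp add: alg_homsD(2)[OF z1] mult_ac)
    next
      case 6
      then have "min ?i ?j = nat m" by auto
      with 6 pos[OF b] show ?thesis by (simp add: alg_homsD(2)[OF z2] mult_ac)
    qed (simp_all add: alg_homsD(2)[OF z1] alg_homsD(2)[OF z2])
  qed
  moreover have "int ?i - int ?j = n + m" by simp
  ultimately show ?thesis using single_normal_form[of ?i ?j "half n a * half m b" t]
    by (simp add: normal_form_def mult_single)
qed

lemma sect_mult: "sect (\<rho> a) * sect (\<rho> b) - sect (\<rho> a * \<rho> b) \<in> XS_ideal t"
proof (rule poly_mapping_induct[of "\<lambda>P. sect P * sect (\<rho> b) - sect (P * \<rho> b) \<in> XS_ideal t" "\<rho> a"])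
  show "sect 0 * sect (\<rho> b) - sect (0 * \<rho> b) \<in> XS_ideal t" by (simp add: sect_0 XS_ideal_0)
  show "sect (p + q) * sect (\<rho> b) - sect ((p + q) * \<rho> b) \<in> XS_ideal t"
    if "sect p * sect (\<rho> b) - sect (p * \<rho> b) \<in> XS_ideal t" "sect q * sect (\<rho> b) - sect (q * \<rho> b) \<in> XS_ideal t" for p q
    using XS_ideal_add[OF that] by (simp add: sect_add distrib_right algebra_simps)
  fix n
  define P where "P = Poly_Mapping.single n (Poly_Mapping.lookup (\<rho> a) n)"
  have "sect P * sect (\<rho> b) - sect (P * \<rho> b) \<in> XS_ideal t"
  proof (rule poly_mapping_induct[of "\<lambda>R. sect P * sect R - sect (P * R) \<in> XS_ideal t" "\<rho> b"])
    show "sect P * sect 0 - sect (P * 0) \<in> XS_ideal t" by (simp add: sect_0 XS_ideal_0)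
    show "sect P * sect (p + q) - sect (P * (p + q)) \<in> XS_ideal t"
      if "sect P * sect p - sect (P * p) \<in> XS_ideal t" "sect P * sect q - sect (P * q) \<in> XS_ideal t" for p q
      using XS_ideal_add[OF that] by (simp add: sect_add distrib_left algebra_simps)
    fix m
    show "sect P * sect (Poly_Mapping.single m (Poly_Mapping.lookup (\<rho> b) m)) -
        sect (P * Poly_Mapping.single m (Poly_Mapping.lookup (\<rho> b) m)) \<in> XS_ideal t"
      using sect_mult_homogeneous[OF Gm_actionD(2)[OF act, of a n] Gm_actionD(2)[OF act, of b m]]
      unfolding P_def mult_single sect_single .
  qed
  then show "sect (Poly_Mapping.single n (Poly_Mapping.lookup (\<rho> a) n)) * sect (\<rho> b) -
      sect (Poly_Mapping.single n (Poly_Mapping.lookup (\<rho> a) n) * \<rho> b) \<in> XS_ideal t"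
    by (simp only: P_def)
qed

lemma section_mem_image: "(t, z1, z2) \<in> ptilde ` Ztilde sA \<rho> sR"
proof -
  let ?I = "XS_ideal t"
  define f where "f a = coset ?I (sect (\<rho> a))" for a
  note \<rho> = Gm_actionD(1)[OF act]
  have f_iff: "p \<in> f a \<longleftrightarrow> p - sect (\<rho> a) \<in> ?I" for p a by (simp add: f_def coset_def)
  have f: "f \<in> quot_homs sA (\<lambda>c. Poly_Mapping.single 0 (sR c)) ?I"
  proof -
    have "p + q \<in> f (a + b) \<and> p * q \<in> f (a * b)" if "p \<in> f a" "q \<in> f b" for p q a b
    proof
      have pq: "p - sect (\<rho> a) \<in> ?I" "q - sect (\<rho> b) \<in> ?I" using that by (auto simp: f_iff)
      from XS_ideal_add[OF pq] show "p + q \<in> f (a + b)"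
        by (simp add: f_iff alg_homsD(1)[OF \<rho>] sect_add algebra_simps)
      have "q * (p - sect (\<rho> a)) + sect (\<rho> a) * (q - sect (\<rho> b)) + (sect (\<rho> a) * sect (\<rho> b) - sect (\<rho> a * \<rho> b)) \<in> ?I"
        by (intro XS_ideal_add XS_ideal_mult pq sect_mult)
      then show "p * q \<in> f (a * b)" by (simp add: f_iff alg_homsD(2)[OF \<rho>] algebra_simps)
    qed
    moreover have "Poly_Mapping.single 0 (sR c) \<in> f (sA c)" for c
      by (simp add: f_iff alg_homsD(3)[OF \<rho>] sect_single normal_form_def alg_homsD(3)[OF z1] XS_ideal_0)
    ultimately show ?thesis unfolding quot_homs_def by (auto simp: f_def)
  qed
  have "component tau_deg n p \<in> f (Poly_Mapping.lookup (\<rho> a) n)" if p: "p \<in> f a" for a p n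
  proof -
    have "component tau_deg n (p - sect (\<rho> a)) \<in> ?I" using p by (intro component_XS_ideal) (simp add: f_iff)
    moreover have "component tau_deg n (sect (\<rho> a)) = sect (\<rho> (Poly_Mapping.lookup (\<rho> a) n))"
    proof -
      have "component tau_deg n (sect (\<rho> a)) = (\<Sum>k\<in>Poly_Mapping.keys (\<rho> a).
          if n = k then normal_form k (half k (Poly_Mapping.lookup (\<rho> a) k)) else 0)"
        unfolding graded_section_def component_sum
        by (intro sum.cong refl component_of_homogeneous homogeneous_normal_form)
      also have "\<dots> = normal_form n (half n (Poly_Mapping.lookup (\<rho> a) n))"
        using half_simps(3)[of n] by (auto simp: sum.delta' in_keys_iff)
      finally show ?thesis by (simp add: Gm_actionD(2)[OF act] sect_single)
    qed
    ultimately show ?thesis by (simp add: f_iff component_diff)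
  qed
  then have "f \<in> equivariant_maps sA \<rho> sR t"
    using f by (simp add: equivariant_maps_def lookup_XS_coaction)
  moreover have "pull_section 1 t f a = z1 a \<and> pull_section t 1 f a = z2 a" for a
  proof -
    have mem: "sect (\<rho> a) \<in> f a" by (simp add: f_iff XS_ideal_0)
    have "eval2 1 t (normal_form n (half n b)) = z1 b \<and> eval2 t 1 (normal_form n (half n b)) = z2 b"
      if "\<rho> b = Poly_Mapping.single n b" for n b
      using pos[OF that] neg[OF that] by (simp add: normal_form_def eval2_single mult_ac)
    from this[OF Gm_actionD(2)[OF act]]
    have "eval2 1 t (sect (\<rho> a)) = (\<Sum>n\<in>Poly_Mapping.keys (\<rho> a). z1 (Poly_Mapping.lookup (\<rho> a) n))"
      "eval2 t 1 (sect (\<rho> a)) = (\<Sum>n\<in>Poly_Mapping.keys (\<rho> a). z2 (Poly_Mapping.lookup (\<rho> a) n))"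
      unfolding graded_section_def eval2_sum by (auto intro: sum.cong)
    moreover have "(\<Sum>n\<in>Poly_Mapping.keys (\<rho> a). z (Poly_Mapping.lookup (\<rho> a) n)) = z a"
      if "z \<in> alg_homs sA sR" for z
      using Gm_actionD(3)[OF act, of a] alg_homs_sum[OF that] by metis
    ultimately show ?thesis using z1 z2 pull_section_eq[OF f _ mem] by simp
  qed
  ultimately have "(t, f) \<in> Ztilde sA \<rho> sR" "ptilde (t, f) = (t, z1, z2)"
    by (auto simp: Ztilde_def ptilde_def)
  then show ?thesis by (metis imageI)
qed

end

lemma inj_ptilde: "inj_on ptilde (Ztilde sA \<rho> sR)"
proof (rule inj_onI)
  fix x y assume xy: "x \<in> Ztilde sA \<rho> sR" "y \<in> Ztilde sA \<rho> sR" "ptilde x = ptilde y"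
  obtain t f t' f' where tf: "x = (t, f)" "y = (t', f')" by (cases x; cases y)
  from xy have f: "f \<in> equivariant_maps sA \<rho> sR t" "f' \<in> equivariant_maps sA \<rho> sR t'"
    and eq: "t = t'" "pull_section 1 t f = pull_section 1 t' f'" "pull_section t 1 f = pull_section t' 1 f'"
    by (auto simp: tf Ztilde_def ptilde_def)
  from equivariant_map_eq_coset[OF f(1)] equivariant_map_eq_coset[OF f(2)] eq have "f = f'" by (intro ext) simp
  with eq show "x = y" by (simp add: tf)
qed

text \<open>
For \<open>n \<ge> 0\<close> and \<open>a\<close> of degree \<open>n\<close> the function \<open>t\<^sup>n \<otimes> a \<otimes> 1 - 1 \<otimes> 1 \<otimes> a\<close> vanishes on the graph; for \<open>n \<le> 0\<close> so does
\<open>1 \<otimes> a \<otimes> 1 - t\<^sup>-\<^sup>n \<otimes> 1 \<otimes> a\<close>.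
\<close>

lemma graph_closure_relations:
  assumes x: "(t, z1, z2) \<in> graph_closure sA \<rho> sR" and a: "\<rho> a = Poly_Mapping.single n a"
  shows "n \<ge> 0 \<Longrightarrow> z2 a = t ^ nat n * z1 a" and "n \<le> 0 \<Longrightarrow> z1 a = t ^ nat (- n) * z2 a"
proof -
  from x have z: "z1 \<in> alg_homs sA sR" "z2 \<in> alg_homs sA sR"
    and F: "\<And>F. restrict_graph \<rho> F = 0 \<Longrightarrow> eval_at (t, z1, z2) F = 0"
    by (auto simp: graph_closure_def)
  have one: "sA 1 = 1" "sR 1 = 1" using sA sR by (auto simp: k_algebra_def)
  have z_1: "z1 1 = 1" "z2 1 = 1" using alg_homsD(3)[OF z(1), of 1] alg_homsD(3)[OF z(2), of 1] one by simp_all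
  have \<rho>_1: "\<rho> 1 = Poly_Mapping.single 0 1" using alg_homsD(3)[OF Gm_actionD(1)[OF act], of 1] one by simp
  show "z2 a = t ^ nat n * z1 a" if "n \<ge> 0"
  proof -
    have "restrict_graph \<rho> [(nat n, a, 1), (0, - 1, a)] = 0"
      using that by (simp add: restrict_graph_def \<rho>_1 a mult_single flip: single_add)
    from F[OF this] show ?thesis using alg_homsD(5)[OF z(1), of 1] by (simp add: eval_at_def z_1)
  qed
  show "z1 a = t ^ nat (- n) * z2 a" if "n \<le> 0"
  proof -
    have "restrict_graph \<rho> [(0, a, 1), (nat (- n), - 1, a)] = 0"
      using that by (simp add: restrict_graph_def \<rho>_1 a mult_single flip: single_add)
    from F[OF this] show ?thesis using alg_homsD(5)[OF z(1), of 1] by (simp add: eval_at_def z_1)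
  qed
qed

end

theorem proposition2p3p4:
  fixes sA :: "'k::field \<Rightarrow> 'a::{comm_ring, comm_monoid_mult}"
    and \<rho> :: "'a \<Rightarrow> (int \<Rightarrow>\<^sub>0 'a)"
    and sR :: "'k \<Rightarrow> 'r::{comm_ring, comm_monoid_mult}"
  assumes "k_algebra sA" and "finite_type sA" and "Gm_action sA \<rho>" and "smooth sA"
    and "k_algebra sR"
  shows "inj_on ptilde (Ztilde sA \<rho> sR) \<and>
         ptilde ` Ztilde sA \<rho> sR = graph_closure sA \<rho> sR"
proof (intro conjI equalityI subsetI)
  note A = assms(1,3,5)
  show "inj_on ptilde (Ztilde sA \<rho> sR)" by (rule inj_ptilde[OF A])
  fix x assume "x \<in> ptilde ` Ztilde sA \<rho> sR"
  then obtain t f where f: "f \<in> equivariant_maps sA \<rho> sR t" and x: "x = (t, pull_section 1 t f, pull_section t 1 f)"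
    by (auto simp: Ztilde_def ptilde_def)
  have "f \<in> quot_homs sA (\<lambda>c. Poly_Mapping.single 0 (sR c)) (XS_ideal t)"
    using f by (simp add: equivariant_maps_def)
  then have z: "pull_section 1 t f \<in> alg_homs sA sR" "pull_section t 1 f \<in> alg_homs sA sR"
    by (auto intro: pull_section_hom[OF A])
  have "formally_smooth sA" using assms(4) by (simp add: smooth_def)
  then show "x \<in> graph_closure sA \<rho> sR"
    using graph_function_vanishes[OF assms(1,2,3) _ assms(5) z equivariant_map_homogeneous(3,4)[OF A f]] z
    by (auto simp: graph_closure_def x)
next
  fix x assume x: "x \<in> graph_closure sA \<rho> sR"
  obtain t z1 z2 where x_eq: "x = (t, z1, z2)" by (cases x)
  with x have z: "z1 \<in> alg_homs sA sR" "z2 \<in> alg_homs sA sR" by (auto simp: graph_closure_def)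
  show "x \<in> ptilde ` Ztilde sA \<rho> sR"
    unfolding x_eq
    using section_mem_image[OF assms(1,3,5) z] graph_closure_relations[OF assms(1,3,5) x[unfolded x_eq]]
    by blast
qed

end
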